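(* Let $Z$ be a central ideal of a finite-dimensional triassociative algebra $L$ over a field $\mathbb{F}$, and let $$\delta:M(L)\cong\mathcal{H}^2(L,\mathbb{F})\to\big(\mathrm{Bil}(L/L'\times Z,\mathbb{F})\oplus\mathrm{Bil}(Z\times L/L',\mathbb{F})\big)^3\cong\big(L/L'\otimes Z\oplus Z\otimes L/L'\big)^3$$ be the restriction map defined in the context. Then the following are equivalent: (1) $\delta$ is the trivial (zero) map; (2) the natural map $\beta:M(L)\to M(L/Z)$ is injective; (3) $M(L)\cong\dfrac{M(L/Z)}{L'\cap Z}$; (4) $Z\subseteq Z^*(L)$.
   Context: Fix a field $\mathbb{F}$. A triassociative algebra is an $\mathbb{F}$-vector space $L$ with three bilinear products $\vdash,\dashv,\perp:L\times L\to L$ satisfying, for all $x,y,z\in L$: $(x\vdash y)\vdash z=x\vdash(y\vdash z)$; $(x\dashv y)\dashv z=x\dashv(y\dashv z)$; $(x\dashv y)\vdash z=x\vdash(y\vdash z)$; $(x\dashv y)\dashv z=x\dashv(y\vdash z)$; $(x\vdash y)\dashv z=x\vdash(y\dashv z)$; $(x\perp y)\vdash z=x\vdash(y\vdash z)$; $(x\dashv y)\dashv z=x\dashv(y\perp z)$; $(x\vdash y)\perp z=x\vdash(y\perp z)$; $(x\perp y)\dashv z=x\perp(y\dashv z)$; $(x\dashv y)\perp z=x\perp(y\vdash z)$; $(x\perp y)\perp z=x\perp(y\perp z)$. Homomorphisms are linear maps preserving all three products; ideals and quotients are defined in the usual way. The center $Z(L)$ is the set of all $z\in L$ with $z*x=x*z=0$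 for all $x\in L$ and $*\in\{\vdash,\dashv,\perp\}$; a central ideal is an ideal contained in $Z(L)$. For subalgebras $S,T$ of $L$, $S\lozenge T=S\vdash T+S\dashv T+S\perp T$, where $S*T$ is the span of all $s*t$; and $L'=L\lozenge L$. Multiplier: a defining pair for $L$ is a pair $(K,M)$ of triassociative algebras with $L\cong K/M$ and $M\subseteq Z(K)\cap K'$. If $\dim K$ is maximal among defining pairs, $K$ is called a cover of $L$ and $M=M(L)$ the multiplier of $L$. For finite-dimensional $L$ and any free presentation $0\to R\to F\to L\to 0$ ($F$ a free triassociative algebra, $R$ an ideal of $F$), $M(L)\cong\frac{R\cap F'}{F\lozenge R+R\lozenge F}$ and $M(L)\cong\mathcal{H}^2(L,\mathbb{F})$ as vector spaces. Natural map $\beta$: write $L=F/R$ and $Z=T/R$ with $F$ free and $R\subseteq T$ ideals of $F$, so $L/Z\cong F/T$. Then $\beta:M(L)=\frac{R\cap F'}{F\lozenge R+R\lozenge F}\to M(L/Z)=\frac{T\cap F'}{F\lozenge T+T\lozenge F}$ is $x+(F\lozenge R+R\lozenge F)\mapsto x+(F\lozenge T+T\lozenge F)$. In (3), $L'\cap Z$ is a quotient of $M(L/Z)$ via the natural surjection $M(L/Z)\to L'\cap Z$, $x+(F\lozenge T+T\lozenge F)\mapsto x+R$, and is regarded as a subspace of $M(L/Z)$ via a linear splitting of it; $\cong$ is isomorphism of (finite-dimensional) vector spaces, i.e. (3) says $\dim M(L)=\dim M(L/Z)-\dim(L'\cap Z)$. Cohomology: here $\mathbb{F}$ is regarded as having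 zero products and trivial $L$-action. $\mathcal{Z}^2(L,\mathbb{F})$ is the space of triples $(f_\vdash,f_\dashv,f_\perp)$ of bilinear forms $L\times L\to\mathbb{F}$ such that for all $x,y,z\in L$: $f_\vdash(x\vdash y,z)=f_\vdash(x,y\vdash z)$; $f_\dashv(x\dashv y,z)=f_\dashv(x,y\dashv z)$; $f_\vdash(x\dashv y,z)=f_\vdash(x,y\vdash z)$; $f_\dashv(x\dashv y,z)=f_\dashv(x,y\vdash z)$; $f_\dashv(x\vdash y,z)=f_\vdash(x,y\dashv z)$; $f_\vdash(x\perp y,z)=f_\vdash(x,y\vdash z)$; $f_\dashv(x\dashv y,z)=f_\dashv(x,y\perp z)$; $f_\perp(x\vdash y,z)=f_\vdash(x,y\perp z)$; $f_\dashv(x\perp y,z)=f_\perp(x,y\dashv z)$; $f_\perp(x\dashv y,z)=f_\perp(x,y\vdash z)$; $f_\perp(x\perp y,z)=f_\perp(x,y\perp z)$. $\mathcal{B}^2(L,\mathbb{F})$ is the subspace of triples with $f_*(x,y)=-\varepsilon(x*y)$ for all $x,y$ and all $*\in\{\vdash,\dashv,\perp\}$, for some linear $\varepsilon:L\to\mathbb{F}$, and $\mathcal{H}^2(L,\mathbb{F})=\mathcal{Z}^2(L,\mathbb{F})/\mathcal{B}^2(L,\mathbb{F})$. The map $\delta$ sends the class of $(f_\vdash,f_\dashv,f_\perp)$ to $(f''_\vdash,g''_\vdash,f''_\dashv,g''_\dashv,f''_\perp,g''_\perp)$, where $f''_*(x+L',z)=f_*(x,z)$ and $g''_*(z,x+L')=f_*(z,x)$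 for $x\in L$, $z\in Z$, $*\in\{\vdash,\dashv,\perp\}$ (these are well defined). $\mathrm{Bil}(U\times V,\mathbb{F})$ denotes the space of bilinear forms $U\times V\to\mathbb{F}$. $Z^*(L)$ denotes the intersection of all images $\omega(Z(E))$ over all central extensions $0\to\ker\omega\to E\xrightarrow{\omega}L\to0$ of $L$, i.e. surjective homomorphisms $\omega:E\to L$ of triassociative algebras with $\ker\omega\subseteq Z(E)$. *)

theory Defs
  imports "HOL-Algebra.AbelCoset" "Jordan_Normal_Form.Missing_VectorSpace"
begin

section \<open>Triassociative algebras\<close>

datatype tri = Vdash | Dashv | Perp

record ('k, 'a) trias = "('k, 'a) module" +
  tprod :: "tri \<Rightarrow> 'a \<Rightarrow> 'a \<Rightarrow> 'a"

abbreviation tleft :: "('k, 'a, 'm) trias_scheme \<Rightarrow> 'a \<Rightarrow> 'a \<Rightarrow> 'a" (infixl \<open>\<turnstile>\<index>\<close> 70)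
  where "x \<turnstile>\<^bsub>L\<^esub> y \<equiv> tprod L Vdash x y"

abbreviation tright :: "('k, 'a, 'm) trias_scheme \<Rightarrow> 'a \<Rightarrow> 'a \<Rightarrow> 'a" (infixl \<open>\<stileturn>\<index>\<close> 70)
  where "x \<stileturn>\<^bsub>L\<^esub> y \<equiv> tprod L Dashv x y"

abbreviation tmid :: "('k, 'a, 'm) trias_scheme \<Rightarrow> 'a \<Rightarrow> 'a \<Rightarrow> 'a" (infixl \<open>\<perp>\<index>\<close> 70)
  where "x \<perp>\<^bsub>L\<^esub> y \<equiv> tprod L Perp x y"

text \<open>The fields \<open>mult\<close> and \<open>one\<close>, which the record type \<open>module\<close> inherits from \<open>ring\<close>, carry
  no information here, just as for modules and vector spaces in the libraries.\<close>

locale triassociative = vectorspace k L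
    for k :: "('k, 'c) ring_scheme" and L :: "('k, 'a, 'm) trias_scheme" (structure) +
  assumes tprod_closed:
      "\<And>p x y. \<lbrakk>x \<in> carrier L; y \<in> carrier L\<rbrakk> \<Longrightarrow> tprod L p x y \<in> carrier L"
    and tprod_add_left:
      "\<And>p x y z. \<lbrakk>x \<in> carrier L; y \<in> carrier L; z \<in> carrier L\<rbrakk>
        \<Longrightarrow> tprod L p (x \<oplus> y) z = tprod L p x z \<oplus> tprod L p y z"
    and tprod_add_right:
      "\<And>p x y z. \<lbrakk>x \<in> carrier L; y \<in> carrier L; z \<in> carrier L\<rbrakk>
        \<Longrightarrow> tprod L p x (y \<oplus> z) = tprod L p x y \<oplus> tprod L p x z"
    and tprod_smult_left:
      "\<And>p a x y. \<lbrakk>a \<in> carrier k; x \<in> carrier L; y \<in> carrier L\<rbrakk>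
        \<Longrightarrow> tprod L p (a \<odot> x) y = a \<odot> tprod L p x y"
    and tprod_smult_right:
      "\<And>p a x y. \<lbrakk>a \<in> carrier k; x \<in> carrier L; y \<in> carrier L\<rbrakk>
        \<Longrightarrow> tprod L p x (a \<odot> y) = a \<odot> tprod L p x y"
    and trias_axioms:
      "\<And>x y z. \<lbrakk>x \<in> carrier L; y \<in> carrier L; z \<in> carrier L\<rbrakk> \<Longrightarrow>
          (x \<turnstile> y) \<turnstile> z = x \<turnstile> (y \<turnstile> z)
        \<and> (x \<stileturn> y) \<stileturn> z = x \<stileturn> (y \<stileturn> z)
        \<and> (x \<stileturn> y) \<turnstile> z = x \<turnstile> (y \<turnstile> z)
        \<and> (x \<stileturn> y) \<stileturn> z = x \<stileturn> (y \<turnstile> z)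
        \<and> (x \<turnstile> y) \<stileturn> z = x \<turnstile> (y \<stileturn> z)
        \<and> (x \<perp> y) \<turnstile> z = x \<turnstile> (y \<turnstile> z)
        \<and> (x \<stileturn> y) \<stileturn> z = x \<stileturn> (y \<perp> z)
        \<and> (x \<turnstile> y) \<perp> z = x \<turnstile> (y \<perp> z)
        \<and> (x \<perp> y) \<stileturn> z = x \<perp> (y \<stileturn> z)
        \<and> (x \<stileturn> y) \<perp> z = x \<perp> (y \<turnstile> z)
        \<and> (x \<perp> y) \<perp> z = x \<perp> (y \<perp> z)"

definition trias_hom ::
  "('k, 'c) ring_scheme \<Rightarrow> ('k, 'a, 'm) trias_scheme \<Rightarrow> ('k, 'b, 'n) trias_scheme \<Rightarrow> ('a \<Rightarrow> 'b) set"
  where "trias_hom k A B = {h \<in> module_hom k A B.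
    \<forall>p. \<forall>x \<in> carrier A. \<forall>y \<in> carrier A. h (tprod A p x y) = tprod B p (h x) (h y)}"

definition trias_iso ::
  "('k, 'c) ring_scheme \<Rightarrow> ('k, 'a, 'm) trias_scheme \<Rightarrow> ('k, 'b, 'n) trias_scheme \<Rightarrow> bool"
  where "trias_iso k A B \<longleftrightarrow> (\<exists>h \<in> trias_hom k A B. bij_betw h (carrier A) (carrier B))"

definition trias_ideal :: "('k, 'c) ring_scheme \<Rightarrow> ('k, 'a, 'm) trias_scheme \<Rightarrow> 'a set \<Rightarrow> bool"
  where "trias_ideal k L I \<longleftrightarrow> subspace k I L \<and>
    (\<forall>p. \<forall>x \<in> carrier L. \<forall>i \<in> I. tprod L p x i \<in> I \<and> tprod L p i x \<in> I)"

definition center :: "('k, 'a, 'm) trias_scheme \<Rightarrow> 'a set"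
  where "center L = {z \<in> carrier L.
    \<forall>p. \<forall>x \<in> carrier L. tprod L p z x = \<zero>\<^bsub>L\<^esub> \<and> tprod L p x z = \<zero>\<^bsub>L\<^esub>}"

definition central_ideal :: "('k, 'c) ring_scheme \<Rightarrow> ('k, 'a, 'm) trias_scheme \<Rightarrow> 'a set \<Rightarrow> bool"
  where "central_ideal k L I \<longleftrightarrow> trias_ideal k L I \<and> I \<subseteq> center L"

definition sprod ::
  "('k, 'c) ring_scheme \<Rightarrow> ('k, 'a, 'm) trias_scheme \<Rightarrow> tri \<Rightarrow> 'a set \<Rightarrow> 'a set \<Rightarrow> 'a set"
  where "sprod k L p S T = module.span k L {tprod L p s t | s t. s \<in> S \<and> t \<in> T}"

definition lozenge ::
  "('k, 'c) ring_scheme \<Rightarrow> ('k, 'a, 'm) trias_scheme \<Rightarrow> 'a set \<Rightarrow> 'a set \<Rightarrow> 'a set"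
  where "lozenge k L S T =
    sprod k L Vdash S T <+>\<^bsub>L\<^esub> sprod k L Dashv S T <+>\<^bsub>L\<^esub> sprod k L Perp S T"

definition derived :: "('k, 'c) ring_scheme \<Rightarrow> ('k, 'a, 'm) trias_scheme \<Rightarrow> 'a set"
  where "derived k L = lozenge k L (carrier L) (carrier L)"


section \<open>Quotients and linear isomorphisms\<close>

definition vs_isos ::
  "('k, 'c) ring_scheme \<Rightarrow> ('k, 'a, 'm) module_scheme \<Rightarrow> ('k, 'b, 'n) module_scheme \<Rightarrow> ('a \<Rightarrow> 'b) set"
  where "vs_isos k V W = {h \<in> module_hom k V W. bij_betw h (carrier V) (carrier W)}"

definition vs_quot :: "('k, 'a, 'm) module_scheme \<Rightarrow> 'a set \<Rightarrow> ('k, 'a set) module"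
  where "vs_quot V W = \<lparr>carrier = a_rcosets\<^bsub>V\<^esub> W, mult = (\<lambda>A B. W), one = W, zero = W,
    add = set_add V, smult = (\<lambda>c A. \<Union>x\<in>A. W +>\<^bsub>V\<^esub> (c \<odot>\<^bsub>V\<^esub> x))\<rparr>"

definition trias_quot :: "('k, 'a, 'm) trias_scheme \<Rightarrow> 'a set \<Rightarrow> ('k, 'a set) trias"
  where "trias_quot L I = \<lparr>carrier = a_rcosets\<^bsub>L\<^esub> I, mult = (\<lambda>A B. I), one = I, zero = I,
    add = set_add L, smult = (\<lambda>c A. \<Union>x\<in>A. I +>\<^bsub>L\<^esub> (c \<odot>\<^bsub>L\<^esub> x)),
    tprod = (\<lambda>p A B. \<Union>x\<in>A. \<Union>y\<in>B. I +>\<^bsub>L\<^esub> tprod L p x y)\<rparr>"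


section \<open>Terms\<close>

text \<open>HOL does not allow a definition to quantify over all types. Wherever the mathematics
  quantifies over all triassociative algebras (in the universal property of free algebras, in the
  maximality of covers and in \<open>Zstar\<close>), the definitions below quantify over algebras whose
  carrier lies in a type of terms. Every element of an algebra generated by the image of a map
  \<open>\<sigma>\<close> is the value of a term whose variables are interpreted by \<open>\<sigma>\<close>, so choosing a term for each
  element yields a copy of that algebra on the type of terms. The theorems \<open>free_on_extend\<close>,
  \<open>cover_maximal\<close> and \<open>Zstar_subset\<close> at the end of this theory show that the definitions
  nevertheless have the intended meaning for algebras on arbitrary types.\<close>

datatype ('k, 'a) tterm =
    Gen 'a
  | Zero
  | Add "('k, 'a) tterm" "('k, 'a) tterm"
  | Smult 'k "('k, 'a) tterm"
  | Prod tri "('k, 'a) tterm" "('k, 'a) tterm"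


section \<open>Free presentations\<close>

definition free_on :: "('k, 'c) ring_scheme \<Rightarrow> ('k, 'f) trias \<Rightarrow> 'f set \<Rightarrow> bool"
  where "free_on k F X \<longleftrightarrow> triassociative k F \<and> X \<subseteq> carrier F \<and>
    (\<forall>A :: ('k, ('k, 'f) tterm) trias. triassociative k A \<longrightarrow>
      (\<forall>\<phi> \<in> X \<rightarrow> carrier A.
        \<exists>!h. h \<in> extensional (carrier F) \<and> h \<in> trias_hom k F A \<and> (\<forall>x \<in> X. h x = \<phi> x)))"

definition free_presentation ::
  "('k, 'c) ring_scheme \<Rightarrow> ('k, 'f) trias \<Rightarrow> ('f \<Rightarrow> 'a) \<Rightarrow> ('k, 'a) trias \<Rightarrow> bool"
  where "free_presentation k F \<pi> L \<longleftrightarrow>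
    (\<exists>X. free_on k F X) \<and> \<pi> \<in> trias_hom k F L \<and> \<pi> ` carrier F = carrier L"

definition bracket :: "('k, 'c) ring_scheme \<Rightarrow> ('k, 'f) trias \<Rightarrow> 'f set \<Rightarrow> 'f set"
  where "bracket k F R = lozenge k F (carrier F) R <+>\<^bsub>F\<^esub> lozenge k F R (carrier F)"

text \<open>The model $(R \cap F') / (F \lozenge R + R \lozenge F)$ of the multiplier of $F/R$.\<close>

definition hopf :: "('k, 'c) ring_scheme \<Rightarrow> ('k, 'f) trias \<Rightarrow> 'f set \<Rightarrow> ('k, 'f set) module"
  where "hopf k F R = vs_quot (F\<lparr>carrier := R \<inter> derived k F\<rparr>) (bracket k F R)"

definition beta :: "('k, 'c) ring_scheme \<Rightarrow> ('k, 'f) trias \<Rightarrow> 'f set \<Rightarrow> 'f set \<Rightarrow> 'f set"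
  where "beta k F T A = (\<Union>x\<in>A. bracket k F T +>\<^bsub>F\<^esub> x)"

text \<open>The natural surjection $M(L/Z) \to L' \cap Z$, $x + (F \lozenge T + T \lozenge F) \mapsto x + R$,
  where $F/R$ is identified with $L$ by means of \<open>\<pi>\<close>.\<close>

definition nat_surj :: "('f \<Rightarrow> 'a) \<Rightarrow> 'f set \<Rightarrow> 'a"
  where "nat_surj \<pi> A = the_elem (\<pi> ` A)"


section \<open>Covers and multipliers\<close>

definition defining_pair ::
  "('k, 'c) ring_scheme \<Rightarrow> ('k, 'a) trias \<Rightarrow> ('k, 'b) trias \<Rightarrow> 'b set \<Rightarrow> bool"
  where "defining_pair k L K M \<longleftrightarrow> triassociative k K \<and> trias_ideal k K M \<and>
    trias_iso k (trias_quot K M) L \<and> M \<subseteq> center K \<inter> derived k K"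

text \<open>If \<open>(K, M)\<close> is a cover of \<open>L\<close>, the multiplier of \<open>L\<close> is \<open>M\<close>, that is
  \<open>K\<lparr>carrier := M\<rparr>\<close> as a vector space. \<open>dim\<close> is meaningless for spaces that are not
  finite-dimensional, so maximality includes finite dimension of all defining pairs; for
  finite-dimensional \<open>L\<close> this is automatic (\<open>defining_pair_bound\<close>), and covers exist
  (\<open>cover_exists\<close>).\<close>

definition cover ::
  "('k, 'c) ring_scheme \<Rightarrow> ('k, 'a) trias \<Rightarrow> ('k, 'b) trias \<Rightarrow> 'b set \<Rightarrow> bool"
  where "cover k L K M \<longleftrightarrow> defining_pair k L K M \<and> vectorspace.fin_dim k K \<and>
    (\<forall>(K' :: ('k, ('k, 'a) tterm) trias) M'. defining_pair k L K' M' \<longrightarrow>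
      vectorspace.fin_dim k K' \<and> vectorspace.dim k K' \<le> vectorspace.dim k K)"


section \<open>Central extensions\<close>

definition central_extension ::
  "('k, 'c) ring_scheme \<Rightarrow> ('k, 'b) trias \<Rightarrow> ('b \<Rightarrow> 'a) \<Rightarrow> ('k, 'a) trias \<Rightarrow> bool"
  where "central_extension k E \<omega> L \<longleftrightarrow> triassociative k E \<and> triassociative k L \<and>
    \<omega> \<in> trias_hom k E L \<and> \<omega> ` carrier E = carrier L \<and> a_kernel E L \<omega> \<subseteq> center E"

definition Zstar :: "('k, 'c) ring_scheme \<Rightarrow> ('k, 'a) trias \<Rightarrow> 'a set"
  where "Zstar k L =
    \<Inter> {\<omega> ` center E | (E :: ('k, ('k, 'a) tterm) trias) \<omega>. central_extension k E \<omega> L}"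


section \<open>Cohomology\<close>

definition self_module :: "('k, 'c) ring_scheme \<Rightarrow> ('k, 'k) module"
  where "self_module k = \<lparr>carrier = carrier k, mult = mult k, one = one k, zero = zero k,
    add = add k, smult = mult k\<rparr>"

definition Bil :: "('k, 'c) ring_scheme \<Rightarrow> ('k, 'a, 'm) module_scheme \<Rightarrow> ('k, 'b, 'n) module_scheme
    \<Rightarrow> ('k, 'a \<times> 'b \<Rightarrow> 'k) module"
  where "Bil k U V = (ring.func_space k (carrier U \<times> carrier V))
    \<lparr>carrier := {f \<in> carrier U \<times> carrier V \<rightarrow>\<^sub>E carrier k.
      (\<forall>v \<in> carrier V. (\<lambda>u. f (u, v)) \<in> module_hom k U (self_module k)) \<and>
      (\<forall>u \<in> carrier U. (\<lambda>v. f (u, v)) \<in> module_hom k V (self_module k))}\<rparr>"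

definition cube :: "('k, 'a, 'm) module_scheme \<Rightarrow> ('k, 'a \<times> 'a \<times> 'a) module"
  where "cube V = direct_sum V (direct_sum V V)"

definition Z2 :: "('k, 'c) ring_scheme \<Rightarrow> ('k, 'a) trias
    \<Rightarrow> (('a \<times> 'a \<Rightarrow> 'k) \<times> ('a \<times> 'a \<Rightarrow> 'k) \<times> ('a \<times> 'a \<Rightarrow> 'k)) set"
  where "Z2 k L = {(fl, fr, fm). (fl, fr, fm) \<in> carrier (cube (Bil k L L)) \<and>
    (\<forall>x \<in> carrier L. \<forall>y \<in> carrier L. \<forall>z \<in> carrier L.
        fl (x \<turnstile>\<^bsub>L\<^esub> y, z) = fl (x, y \<turnstile>\<^bsub>L\<^esub> z)
      \<and> fr (x \<stileturn>\<^bsub>L\<^esub> y, z) = fr (x, y \<stileturn>\<^bsub>L\<^esub> z)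
      \<and> fl (x \<stileturn>\<^bsub>L\<^esub> y, z) = fl (x, y \<turnstile>\<^bsub>L\<^esub> z)
      \<and> fr (x \<stileturn>\<^bsub>L\<^esub> y, z) = fr (x, y \<turnstile>\<^bsub>L\<^esub> z)
      \<and> fr (x \<turnstile>\<^bsub>L\<^esub> y, z) = fl (x, y \<stileturn>\<^bsub>L\<^esub> z)
      \<and> fl (x \<perp>\<^bsub>L\<^esub> y, z) = fl (x, y \<turnstile>\<^bsub>L\<^esub> z)
      \<and> fr (x \<stileturn>\<^bsub>L\<^esub> y, z) = fr (x, y \<perp>\<^bsub>L\<^esub> z)
      \<and> fm (x \<turnstile>\<^bsub>L\<^esub> y, z) = fl (x, y \<perp>\<^bsub>L\<^esub> z)
      \<and> fr (x \<perp>\<^bsub>L\<^esub> y, z) = fm (x, y \<stileturn>\<^bsub>L\<^esub> z)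
      \<and> fm (x \<stileturn>\<^bsub>L\<^esub> y, z) = fm (x, y \<turnstile>\<^bsub>L\<^esub> z)
      \<and> fm (x \<perp>\<^bsub>L\<^esub> y, z) = fm (x, y \<perp>\<^bsub>L\<^esub> z))}"

definition B2 :: "('k, 'c) ring_scheme \<Rightarrow> ('k, 'a) trias
    \<Rightarrow> (('a \<times> 'a \<Rightarrow> 'k) \<times> ('a \<times> 'a \<Rightarrow> 'k) \<times> ('a \<times> 'a \<Rightarrow> 'k)) set"
  where "B2 k L = {(fl, fr, fm). (fl, fr, fm) \<in> carrier (cube (Bil k L L)) \<and>
    (\<exists>\<epsilon> \<in> module_hom k L (self_module k). \<forall>x \<in> carrier L. \<forall>y \<in> carrier L.
        fl (x, y) = \<ominus>\<^bsub>k\<^esub> \<epsilon> (x \<turnstile>\<^bsub>L\<^esub> y)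
      \<and> fr (x, y) = \<ominus>\<^bsub>k\<^esub> \<epsilon> (x \<stileturn>\<^bsub>L\<^esub> y)
      \<and> fm (x, y) = \<ominus>\<^bsub>k\<^esub> \<epsilon> (x \<perp>\<^bsub>L\<^esub> y))}"

definition H2 :: "('k, 'c) ring_scheme \<Rightarrow> ('k, 'a) trias
    \<Rightarrow> ('k, (('a \<times> 'a \<Rightarrow> 'k) \<times> ('a \<times> 'a \<Rightarrow> 'k) \<times> ('a \<times> 'a \<Rightarrow> 'k)) set) module"
  where "H2 k L = vs_quot ((cube (Bil k L L))\<lparr>carrier := Z2 k L\<rparr>) (B2 k L)"

abbreviation abelianization ::
  "('k, 'c) ring_scheme \<Rightarrow> ('k, 'a) trias \<Rightarrow> ('k, 'a set) module"
  where "abelianization k L \<equiv> vs_quot L (derived k L)"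

definition delta_target :: "('k, 'c) ring_scheme \<Rightarrow> ('k, 'a) trias \<Rightarrow> 'a set
    \<Rightarrow> ('k, (('a set \<times> 'a \<Rightarrow> 'k) \<times> ('a \<times> 'a set \<Rightarrow> 'k)) \<times> (('a set \<times> 'a \<Rightarrow> 'k) \<times> ('a \<times> 'a set \<Rightarrow> 'k))
          \<times> (('a set \<times> 'a \<Rightarrow> 'k) \<times> ('a \<times> 'a set \<Rightarrow> 'k))) module"
  where "delta_target k L Z = cube (direct_sum
    (Bil k (abelianization k L) (L\<lparr>carrier := Z\<rparr>)) (Bil k (L\<lparr>carrier := Z\<rparr>) (abelianization k L)))"

text \<open>Well-definedness on cosets is not part of the definitions: \<open>the_elem\<close> extracts the common
  value of all representatives, both of \<open>x + L'\<close> here and of a cohomology class in \<open>delta\<close>.\<close>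

definition restr :: "('k, 'c) ring_scheme \<Rightarrow> ('k, 'a) trias \<Rightarrow> 'a set \<Rightarrow> ('a \<times> 'a \<Rightarrow> 'k)
    \<Rightarrow> ('a set \<times> 'a \<Rightarrow> 'k) \<times> ('a \<times> 'a set \<Rightarrow> 'k)"
  where "restr k L Z f =
    ((\<lambda>(A, z) \<in> carrier (abelianization k L) \<times> Z. the_elem ((\<lambda>x. f (x, z)) ` A)),
     (\<lambda>(z, A) \<in> Z \<times> carrier (abelianization k L). the_elem ((\<lambda>x. f (z, x)) ` A)))"

definition delta where
  "delta k L Z c = the_elem ((\<lambda>(fl, fr, fm). (restr k L Z fl, restr k L Z fr, restr k L Z fm)) ` c)"


section \<open>Independence of the carrier type, and existence of covers\<close>

definition trias_copy :: "('a \<Rightarrow> 'b) \<Rightarrow> ('k, 'a, 'm) trias_scheme \<Rightarrow> ('k, 'b) trias"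
  where "trias_copy i A = (let g = inv_into (carrier A) i in
    \<lparr>carrier = i ` carrier A, mult = (\<lambda>x y. i \<zero>\<^bsub>A\<^esub>), one = i \<zero>\<^bsub>A\<^esub>, zero = i \<zero>\<^bsub>A\<^esub>,
     add = (\<lambda>x y. i (g x \<oplus>\<^bsub>A\<^esub> g y)), smult = (\<lambda>c x. i (c \<odot>\<^bsub>A\<^esub> g x)),
     tprod = (\<lambda>p x y. i (tprod A p (g x) (g y)))\<rparr>)"

lemma trias_copy:
  assumes "triassociative k A" "inj_on i (carrier A)"
  shows "triassociative k (trias_copy i A)"
    and "i \<in> trias_hom k A (trias_copy i A)"
    and "inv_into (carrier A) i \<in> trias_hom k (trias_copy i A) A"
proof -
  interpret A: triassociative k A by fact
  let ?B = "trias_copy i A"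
  have [simp]: "inv_into (carrier A) i (i x) = x" if "x \<in> carrier A" for x
    using that assms(2) by simp
  have c [simp]: "carrier ?B = i ` carrier A" "\<zero>\<^bsub>?B\<^esub> = i \<zero>\<^bsub>A\<^esub>"
    by (simp_all add: trias_copy_def Let_def)
  have a [simp]: "i x \<oplus>\<^bsub>?B\<^esub> i y = i (x \<oplus>\<^bsub>A\<^esub> y)" if "x \<in> carrier A" "y \<in> carrier A" for x y
    using that by (simp add: trias_copy_def Let_def)
  have s [simp]: "c \<odot>\<^bsub>?B\<^esub> i x = i (c \<odot>\<^bsub>A\<^esub> x)" if "x \<in> carrier A" for c x
    using that by (simp add: trias_copy_def Let_def)
  have t [simp]: "tprod ?B p (i x) (i y) = i (tprod A p x y)"
    if "x \<in> carrier A" "y \<in> carrier A" for p x y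
    using that by (simp add: trias_copy_def Let_def)
  have ab: "abelian_group ?B"
  proof (rule abelian_groupI)
    fix x assume "x \<in> carrier ?B"
    then obtain u where u: "u \<in> carrier A" "x = i u" by auto
    have "i (\<ominus>\<^bsub>A\<^esub> u) \<in> carrier ?B" "i (\<ominus>\<^bsub>A\<^esub> u) \<oplus>\<^bsub>?B\<^esub> x = \<zero>\<^bsub>?B\<^esub>"
      using u by (auto simp: A.M.l_neg)
    then show "\<exists>y\<in>carrier ?B. y \<oplus>\<^bsub>?B\<^esub> x = \<zero>\<^bsub>?B\<^esub>" by blast
    fix y assume "y \<in> carrier ?B"
    then show "x \<oplus>\<^bsub>?B\<^esub> y = y \<oplus>\<^bsub>?B\<^esub> x"
      using u by (auto simp: A.M.a_comm[of u])
  qed (auto simp: A.M.a_assoc)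
  have mod: "module k ?B"
    by (rule moduleI[OF _ ab]) (auto simp: A.smult_l_distr A.smult_r_distr A.smult_assoc1 A.R.is_cring)
  have "vectorspace k ?B"
    by (intro vectorspace.intro mod A.field_axioms)
  then show "triassociative k ?B"
  proof (intro triassociative.intro triassociative_axioms.intro, goal_cases)
    case (7 x y z)
    then obtain u v w where "x = i u" "y = i v" "z = i w"
      "u \<in> carrier A" "v \<in> carrier A" "w \<in> carrier A" by auto
    then show ?case using A.trias_axioms[of u v w] by (auto simp: A.tprod_closed)
  qed (auto simp: A.tprod_closed A.tprod_add_left A.tprod_add_right A.tprod_smult_left
        A.tprod_smult_right)
  show "i \<in> trias_hom k A ?B"
    by (auto simp: trias_hom_def module_hom_def)
  show "inv_into (carrier A) i \<in> trias_hom k ?B A"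
    by (auto simp: trias_hom_def module_hom_def A.tprod_closed)
qed

inductive_set gen_alg :: "('k, 'c) ring_scheme \<Rightarrow> ('k, 'a, 'm) trias_scheme \<Rightarrow> 'a set \<Rightarrow> 'a set"
  for k and A and S where
    gen: "s \<in> S \<Longrightarrow> s \<in> gen_alg k A S"
  | zero: "\<zero>\<^bsub>A\<^esub> \<in> gen_alg k A S"
  | add: "x \<in> gen_alg k A S \<Longrightarrow> y \<in> gen_alg k A S \<Longrightarrow> x \<oplus>\<^bsub>A\<^esub> y \<in> gen_alg k A S"
  | smult: "c \<in> carrier k \<Longrightarrow> x \<in> gen_alg k A S \<Longrightarrow> c \<odot>\<^bsub>A\<^esub> x \<in> gen_alg k A S"
  | prod: "x \<in> gen_alg k A S \<Longrightarrow> y \<in> gen_alg k A S \<Longrightarrow> tprod A p x y \<in> gen_alg k A S"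

lemma gen_alg_triassociative:
  assumes "triassociative k A" "S \<subseteq> carrier A"
  shows "gen_alg k A S \<subseteq> carrier A" "subspace k (gen_alg k A S) A"
    and "triassociative k (A\<lparr>carrier := gen_alg k A S\<rparr>)"
proof -
  interpret A: triassociative k A by fact
  show sub: "gen_alg k A S \<subseteq> carrier A"
  proof
    fix x assume "x \<in> gen_alg k A S"
    then show "x \<in> carrier A"
      by induction (use assms(2) A.tprod_closed in auto)
  qed
  have sm: "submodule k (gen_alg k A S) A"
    by (intro submodule.intro A.module_axioms sub) (auto intro: gen_alg.intros)
  show "subspace k (gen_alg k A S) A"
    by (intro subspace.intro sm A.vectorspace_axioms)
  have "vectorspace k (A\<lparr>carrier := gen_alg k A S\<rparr>)"
    by (intro vectorspace.intro A.field_axioms A.submodule_is_module sm)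
  then show "triassociative k (A\<lparr>carrier := gen_alg k A S\<rparr>)"
  proof (intro triassociative.intro triassociative_axioms.intro, goal_cases)
    case (7 x y z)
    then show ?case using A.trias_axioms[of x y z] sub by auto
  qed (use sub in \<open>auto simp: A.tprod_add_left A.tprod_add_right A.tprod_smult_left
        A.tprod_smult_right subset_iff intro: gen_alg.intros\<close>)
qed

fun teval :: "('k, 'b, 'm) trias_scheme \<Rightarrow> ('a \<Rightarrow> 'b) \<Rightarrow> ('k, 'a) tterm \<Rightarrow> 'b" where
  "teval A \<sigma> (Gen x) = \<sigma> x"
| "teval A \<sigma> Zero = \<zero>\<^bsub>A\<^esub>"
| "teval A \<sigma> (Add s t) = teval A \<sigma> s \<oplus>\<^bsub>A\<^esub> teval A \<sigma> t"
| "teval A \<sigma> (Smult c t) = c \<odot>\<^bsub>A\<^esub> teval A \<sigma> t"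
| "teval A \<sigma> (Prod p s t) = tprod A p (teval A \<sigma> s) (teval A \<sigma> t)"

lemma gen_alg_teval: "v \<in> gen_alg k A (\<sigma> ` X) \<Longrightarrow> \<exists>t. teval A \<sigma> t = v"
proof (induction rule: gen_alg.induct)
  case (gen s) then show ?case by (metis image_iff teval.simps(1))
next
  case zero then show ?case by (metis teval.simps(2))
next
  case (add x y) then show ?case by (metis teval.simps(3))
next
  case (smult c x) then show ?case by (metis teval.simps(4))
next
  case (prod x y p) then show ?case by (metis teval.simps(5))
qed

lemma gen_alg_inj:
  fixes A :: "('k, 'b, 'm) trias_scheme" and \<sigma> :: "'a \<Rightarrow> 'b"
  obtains i :: "'b \<Rightarrow> ('k, 'a) tterm" where "inj_on i (gen_alg k A (\<sigma> ` X))"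
proof
  show "inj_on (\<lambda>v. SOME t. teval A \<sigma> t = v) (gen_alg k A (\<sigma> ` X))"
    by (rule inj_on_inverseI[of _ "teval A \<sigma>"]) (metis (mono_tags, lifting) gen_alg_teval someI_ex)
qed


lemma trias_homD:
  assumes "h \<in> trias_hom k A B"
  shows "x \<in> carrier A \<Longrightarrow> h x \<in> carrier B"
    and "x \<in> carrier A \<Longrightarrow> y \<in> carrier A \<Longrightarrow> h (x \<oplus>\<^bsub>A\<^esub> y) = h x \<oplus>\<^bsub>B\<^esub> h y"
    and "c \<in> carrier k \<Longrightarrow> x \<in> carrier A \<Longrightarrow> h (c \<odot>\<^bsub>A\<^esub> x) = c \<odot>\<^bsub>B\<^esub> h x"
    and "x \<in> carrier A \<Longrightarrow> y \<in> carrier A \<Longrightarrow> h (tprod A p x y) = tprod B p (h x) (h y)"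
  using assms by (auto simp: trias_hom_def module_hom_def)

lemma trias_homI:
  assumes "\<And>x. x \<in> carrier A \<Longrightarrow> h x \<in> carrier B"
    and "\<And>x y. x \<in> carrier A \<Longrightarrow> y \<in> carrier A \<Longrightarrow> h (x \<oplus>\<^bsub>A\<^esub> y) = h x \<oplus>\<^bsub>B\<^esub> h y"
    and "\<And>c x. c \<in> carrier k \<Longrightarrow> x \<in> carrier A \<Longrightarrow> h (c \<odot>\<^bsub>A\<^esub> x) = c \<odot>\<^bsub>B\<^esub> h x"
    and "\<And>p x y. x \<in> carrier A \<Longrightarrow> y \<in> carrier A \<Longrightarrow> h (tprod A p x y) = tprod B p (h x) (h y)"
  shows "h \<in> trias_hom k A B"
  using assms by (auto simp: trias_hom_def module_hom_def)

lemma trias_hom_zero: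
  assumes "triassociative k A" "triassociative k B" "h \<in> trias_hom k A B"
  shows "h \<zero>\<^bsub>A\<^esub> = \<zero>\<^bsub>B\<^esub>"
proof -
  interpret A: triassociative k A by fact
  interpret B: triassociative k B by fact
  interpret mod_hom k A B h
    by (intro mod_hom.intro mod_hom_axioms.intro A.module_axioms B.module_axioms)
      (use assms(3) in \<open>simp add: trias_hom_def\<close>)
  show ?thesis by (rule f0_is_0)
qed

lemma trias_hom_minus:
  assumes "triassociative k A" "triassociative k B" "h \<in> trias_hom k A B"
    and "x \<in> carrier A" "y \<in> carrier A"
  shows "h (x \<ominus>\<^bsub>A\<^esub> y) = h x \<ominus>\<^bsub>B\<^esub> h y"
proof -
  interpret A: triassociative k A by fact
  interpret B: triassociative k B by fact
  interpret mod_hom k A B h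
    by (intro mod_hom.intro mod_hom_axioms.intro A.module_axioms B.module_axioms)
      (use assms(3) in \<open>simp add: trias_hom_def\<close>)
  show ?thesis using assms(4,5) by (rule f_minus)
qed

lemma trias_hom_comp:
  "h \<in> trias_hom k A B \<Longrightarrow> g \<in> trias_hom k B C \<Longrightarrow> (\<lambda>x. g (h x)) \<in> trias_hom k A C"
  by (auto simp: trias_hom_def module_hom_def Pi_iff)

lemma trias_hom_restrict:
  assumes "triassociative k A" "h \<in> trias_hom k A B"
  shows "restrict h (carrier A) \<in> trias_hom k A B"
proof -
  interpret A: triassociative k A by fact
  show ?thesis using trias_homD[OF assms(2)] by (intro trias_homI) (auto simp: A.tprod_closed)
qed

lemma trias_hom_eq_on_gen:
  assumes A: "triassociative k A" and B: "triassociative k B" and S: "S \<subseteq> carrier A"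
    and g: "g \<in> trias_hom k A B" and h: "h \<in> trias_hom k A B"
    and eq: "\<And>x. x \<in> S \<Longrightarrow> g x = h x" and v: "v \<in> gen_alg k A S"
  shows "g v = h v"
proof -
  note sub = gen_alg_triassociative(1)[OF A S]
  show ?thesis
    using v
  proof induction
    case zero then show ?case
      using trias_hom_zero[OF A B g] trias_hom_zero[OF A B h] by simp
  qed (use sub trias_homD[OF g] trias_homD[OF h] eq in \<open>auto simp: subset_iff\<close>)
qed

lemma free_onD:
  fixes A :: "('k, ('k, 'f) tterm) trias" and F :: "('k, 'f) trias"
  assumes "free_on k F X" "triassociative k A" "\<phi> \<in> X \<rightarrow> carrier A"
  shows "\<exists>h. h \<in> trias_hom k F A \<and> (\<forall>x \<in> X. h x = \<phi> x)"
    and "\<lbrakk>g \<in> extensional (carrier F); g \<in> trias_hom k F A; \<forall>x \<in> X. g x = \<phi> x;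
      h \<in> extensional (carrier F); h \<in> trias_hom k F A; \<forall>x \<in> X. h x = \<phi> x\<rbrakk> \<Longrightarrow> g = h"
proof -
  have *: "\<exists>!h. h \<in> extensional (carrier F) \<and> h \<in> trias_hom k F A \<and> (\<forall>x \<in> X. h x = \<phi> x)"
    using assms unfolding free_on_def by simp
  show "\<exists>h. h \<in> trias_hom k F A \<and> (\<forall>x \<in> X. h x = \<phi> x)"
    using ex1_implies_ex[OF *] by blast
  show "g = h" if "g \<in> extensional (carrier F)" "g \<in> trias_hom k F A" "\<forall>x \<in> X. g x = \<phi> x"
      "h \<in> extensional (carrier F)" "h \<in> trias_hom k F A" "\<forall>x \<in> X. h x = \<phi> x"
    using the1_equality[OF *, of g] the1_equality[OF *, of h] that by simp
qed

lemma free_on_gen: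
  assumes F: "free_on k F X"
  shows "gen_alg k F X = carrier F"
proof -
  have T: "triassociative k F" and X: "X \<subseteq> carrier F" using F by (auto simp: free_on_def)
  let ?G = "F\<lparr>carrier := gen_alg k F X\<rparr>"
  have G: "triassociative k ?G" and sub: "gen_alg k F X \<subseteq> carrier F"
    using gen_alg_triassociative[OF T X] by auto
  let ?Gen = "Gen :: _ \<Rightarrow> ('a, 'c) tterm"
  have iF: "inj_on ?Gen (carrier F)" and iG: "inj_on ?Gen (carrier ?G)"
    by (auto simp: inj_on_def)
  note cF = trias_copy[OF T iF] and cG = trias_copy[OF G iG]
  have "?Gen \<in> X \<rightarrow> carrier (trias_copy ?Gen ?G)"
    by (auto simp: trias_copy_def Let_def intro: gen_alg.gen)
  then obtain h where h: "h \<in> trias_hom k F (trias_copy ?Gen ?G)" "\<forall>x \<in> X. h x = Gen x"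
    using free_onD(1)[OF F cG(1)] by blast
  define g where "g = (\<lambda>x. inv_into (carrier ?G) ?Gen (h x))"
  have g: "g \<in> trias_hom k F ?G" unfolding g_def by (rule trias_hom_comp[OF h(1) cG(3)])
  have g': "g \<in> trias_hom k F F"
    using trias_homD[OF g] sub by (intro trias_homI) auto
  have gX: "g x = x" if "x \<in> X" for x
    using that h(2) iG by (simp add: g_def gen_alg.gen)
  define g1 where "g1 = restrict (\<lambda>x. ?Gen (g x)) (carrier F)"
  define g2 where "g2 = restrict ?Gen (carrier F)"
  have g12: "g1 \<in> trias_hom k F (trias_copy ?Gen F)" "g2 \<in> trias_hom k F (trias_copy ?Gen F)"
    unfolding g1_def g2_def by (intro trias_hom_restrict T trias_hom_comp[OF g'] cF)+
  have gen: "?Gen \<in> X \<rightarrow> carrier (trias_copy ?Gen F)"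
    using X by (auto simp: trias_copy_def Let_def)
  have "g1 \<in> extensional (carrier F)" "g2 \<in> extensional (carrier F)"
    "\<forall>x \<in> X. g1 x = Gen x" "\<forall>x \<in> X. g2 x = Gen x"
    using X gX by (auto simp: g1_def g2_def)
  then have "g1 = g2"
    using g12 by (intro free_onD(2)[OF F cF(1) gen])
  then have eq: "g x = x" if "x \<in> carrier F" for x
    using that unfolding g1_def g2_def by (metis restrict_apply' tterm.inject(1))
  have "x \<in> gen_alg k F X" if "x \<in> carrier F" for x
    using trias_homD(1)[OF g that] eq[OF that] by simp
  then show ?thesis using sub by blast
qed

lemma free_on_extend:
  fixes F :: "('k, 'f) trias" and A :: "('k, 'b) trias"
  assumes F: "free_on k F X" and A: "triassociative k A" and \<phi>: "\<phi> \<in> X \<rightarrow> carrier A"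
  shows "\<exists>!h. h \<in> extensional (carrier F) \<and> h \<in> trias_hom k F A \<and> (\<forall>x \<in> X. h x = \<phi> x)"
proof -
  have T: "triassociative k F" and X: "X \<subseteq> carrier F" using F by (auto simp: free_on_def)
  let ?S = "\<phi> ` X"
  have S: "?S \<subseteq> carrier A" using \<phi> by auto
  let ?G = "A\<lparr>carrier := gen_alg k A ?S\<rparr>"
  have G: "triassociative k ?G" and sub: "gen_alg k A ?S \<subseteq> carrier A"
    using gen_alg_triassociative[OF A S] by auto
  obtain i :: "'b \<Rightarrow> ('k, 'f) tterm" where i: "inj_on i (gen_alg k A ?S)"
    by (rule gen_alg_inj)
  then have i': "inj_on i (carrier ?G)" by simp
  note c = trias_copy[OF G i']
  have "(\<lambda>x. i (\<phi> x)) \<in> X \<rightarrow> carrier (trias_copy i ?G)"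
    by (auto simp: trias_copy_def Let_def intro: gen_alg.gen)
  then obtain h where h: "h \<in> trias_hom k F (trias_copy i ?G)" "\<forall>x \<in> X. h x = i (\<phi> x)"
    using free_onD(1)[OF F c(1)] by blast
  define g where "g = (\<lambda>x. inv_into (carrier ?G) i (h x))"
  have g: "g \<in> trias_hom k F ?G" unfolding g_def by (rule trias_hom_comp[OF h(1) c(3)])
  have g': "g \<in> trias_hom k F A"
    using trias_homD[OF g] sub by (intro trias_homI) auto
  have gX: "g x = \<phi> x" if "x \<in> X" for x
    using that h(2) i by (simp add: g_def gen_alg.gen)
  show ?thesis
  proof (rule ex1I[of _ "restrict g (carrier F)"], intro conjI)
    show "restrict g (carrier F) \<in> trias_hom k F A"
      by (rule trias_hom_restrict[OF T g'])
    show "\<forall>x\<in>X. restrict g (carrier F) x = \<phi> x"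
      using X gX by auto
  next
    fix f assume f: "f \<in> extensional (carrier F) \<and> f \<in> trias_hom k F A \<and> (\<forall>x\<in>X. f x = \<phi> x)"
    have "f v = g v" if "v \<in> carrier F" for v
      by (rule trias_hom_eq_on_gen[OF T A X]) (use f g' gX that free_on_gen[OF F] in auto)
    then show "f = restrict g (carrier F)"
      using f by (auto simp: extensional_def)
  qed simp
qed

lemma Zstar_subset:
  fixes L :: "('k, 'a) trias" and E :: "('k, 'b) trias"
  assumes ext: "central_extension k E \<omega> L"
  shows "Zstar k L \<subseteq> \<omega> ` center E"
proof
  have E: "triassociative k E" and L: "triassociative k L" and \<omega>: "\<omega> \<in> trias_hom k E L"
    and surj: "\<omega> ` carrier E = carrier L" and ker: "a_kernel E L \<omega> \<subseteq> center E"
    using ext by (auto simp: central_extension_def)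
  interpret E: triassociative k E by fact
  interpret L: triassociative k L by fact
  define \<sigma> where "\<sigma> = inv_into (carrier E) \<omega>"
  have \<sigma>: "\<sigma> y \<in> carrier E" "\<omega> (\<sigma> y) = y" if "y \<in> carrier L" for y
    using that surj unfolding \<sigma>_def by (auto intro: inv_into_into f_inv_into_f)
  let ?S = "\<sigma> ` carrier L"
  have S: "?S \<subseteq> carrier E" using \<sigma> by auto
  let ?G = "E\<lparr>carrier := gen_alg k E ?S\<rparr>"
  have G: "triassociative k ?G" and sub: "gen_alg k E ?S \<subseteq> carrier E"
    using gen_alg_triassociative[OF E S] by auto
  obtain i :: "'b \<Rightarrow> ('k, 'a) tterm" where i: "inj_on i (gen_alg k E ?S)"
    by (rule gen_alg_inj)
  then have i': "inj_on i (carrier ?G)" by simp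
  note c = trias_copy[OF G i']
  let ?B = "trias_copy i ?G" and ?g = "inv_into (gen_alg k E ?S) i"
  have c3: "?g \<in> trias_hom k ?B ?G" using c(3) by simp
  have gi: "?g (i x) = x" if "x \<in> gen_alg k E ?S" for x using that i by simp
  have carB: "carrier ?B = i ` gen_alg k E ?S" by (simp add: trias_copy_def Let_def)
  have \<omega>G: "\<omega> \<in> trias_hom k ?G L"
    using trias_homD[OF \<omega>] by (intro trias_homI) (auto simp: subsetD[OF sub])
  have hom: "(\<lambda>x. \<omega> (?g x)) \<in> trias_hom k ?B L" by (rule trias_hom_comp[OF c3 \<omega>G])
  have im: "(\<lambda>x. \<omega> (?g x)) ` carrier ?B = carrier L"
  proof (intro equalityI subsetI)
    fix y assume y: "y \<in> carrier L"
    have "\<sigma> y \<in> gen_alg k E ?S" using y by (auto intro: gen_alg.gen)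
    then have "y = \<omega> (?g (i (\<sigma> y)))" "i (\<sigma> y) \<in> carrier ?B"
      using y \<sigma> by (auto simp: gi carB)
    then show "y \<in> (\<lambda>x. \<omega> (?g x)) ` carrier ?B" by blast
  qed (use trias_homD(1)[OF hom] in auto)
  have zB: "\<zero>\<^bsub>?B\<^esub> = i \<zero>\<^bsub>E\<^esub>" by (simp add: trias_copy_def Let_def)
  have tB: "tprod ?B p x y = i (tprod E p (?g x) (?g y))" for p x y
    by (simp add: trias_copy_def Let_def)
  have "a_kernel ?B L (\<lambda>x. \<omega> (?g x)) \<subseteq> center ?B"
  proof
    fix b assume "b \<in> a_kernel ?B L (\<lambda>x. \<omega> (?g x))"
    then obtain x where x: "x \<in> gen_alg k E ?S" "b = i x" "\<omega> x = \<zero>\<^bsub>L\<^esub>"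
      by (auto simp: a_kernel_def kernel_def carB gi)
    then have "x \<in> center E" using sub ker by (auto simp: a_kernel_def kernel_def)
    then show "b \<in> center ?B"
      using x sub by (auto simp: center_def carB tB zB gi subset_iff)
  qed
  then have extB: "central_extension k ?B (\<lambda>x. \<omega> (?g x)) L"
    using c(1) L hom im by (auto simp: central_extension_def)
  fix z assume "z \<in> Zstar k L"
  then have "z \<in> (\<lambda>x. \<omega> (?g x)) ` center ?B"
    using extB unfolding Zstar_def by blast
  then obtain x where x: "x \<in> gen_alg k E ?S" "i x \<in> center ?B" "z = \<omega> x"
    by (auto simp: center_def carB gi)
  have 0: "tprod E p x y = \<zero>\<^bsub>E\<^esub> \<and> tprod E p y x = \<zero>\<^bsub>E\<^esub>" if "y \<in> gen_alg k E ?S" for p y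
  proof -
    have "i (tprod E p x y) = i \<zero>\<^bsub>E\<^esub>" "i (tprod E p y x) = i \<zero>\<^bsub>E\<^esub>"
      using x(1,2) that by (auto simp: center_def carB tB zB gi)
    then show ?thesis
      using i x(1) that by (metis gen_alg.prod gen_alg.zero inj_onD)
  qed
  have "x \<in> center E"
    unfolding center_def
  proof (intro CollectI conjI allI ballI)
    show xE: "x \<in> carrier E" using x sub by auto
    fix p e assume e: "e \<in> carrier E"
    define g where "g = \<sigma> (\<omega> e)"
    have g: "g \<in> gen_alg k E ?S" "g \<in> carrier E" "\<omega> g = \<omega> e"
      using e \<sigma> trias_homD(1)[OF \<omega> e] by (auto simp: g_def intro: gen_alg.gen)
    define d where "d = e \<ominus>\<^bsub>E\<^esub> g"
    have dc: "d \<in> carrier E" using e g by (simp add: d_def)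
    have "\<omega> d = \<zero>\<^bsub>L\<^esub>"
      using trias_hom_minus[OF E L \<omega> e g(2)] g(3) trias_homD(1)[OF \<omega> e]
      by (simp add: d_def a_minus_def L.M.r_neg)
    then have d: "d \<in> center E" using dc ker by (auto simp: a_kernel_def kernel_def)
    have eq: "e = g \<oplus>\<^bsub>E\<^esub> d"
      using e g(2) by (simp add: d_def a_minus_def E.M.a_lcomm E.M.r_neg)
    show "tprod E p x e = \<zero>\<^bsub>E\<^esub>" "tprod E p e x = \<zero>\<^bsub>E\<^esub>"
      unfolding eq using 0[OF g(1)] d xE g(2) dc
      by (auto simp: center_def E.tprod_add_left E.tprod_add_right)
  qed
  then show "z \<in> \<omega> ` center E" using x(3) by blast
qed


lemma (in triassociative) subspaceI:
  assumes "W \<subseteq> carrier L" "\<zero> \<in> W" "\<And>v w. v \<in> W \<Longrightarrow> w \<in> W \<Longrightarrow> v \<oplus> w \<in> W"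
    and "\<And>c v. c \<in> carrier k \<Longrightarrow> v \<in> W \<Longrightarrow> c \<odot> v \<in> W"
  shows "subspace k W L"
  using assms by (intro subspace.intro submodule.intro vectorspace_axioms module_axioms)

lemma subspaceD:
  assumes "subspace k W L"
  shows "W \<subseteq> carrier L" "\<zero>\<^bsub>L\<^esub> \<in> W" "v \<in> W \<Longrightarrow> w \<in> W \<Longrightarrow> v \<oplus>\<^bsub>L\<^esub> w \<in> W"
    and "c \<in> carrier k \<Longrightarrow> v \<in> W \<Longrightarrow> c \<odot>\<^bsub>L\<^esub> v \<in> W"
  using assms by (auto simp: subspace_def submodule_def)

lemma (in triassociative) span_least:
  assumes "subspace k W L" "S \<subseteq> W"
  shows "span S \<subseteq> W"
  using assms by (intro span_is_subset) (auto simp: subspace_def)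

lemma (in triassociative) span_subspace: "S \<subseteq> carrier L \<Longrightarrow> subspace k (span S) L"
  by (rule span_is_subspace)

lemma (in triassociative) set_add_eq_sum: "A <+> B = submodule_sum A B"
  by (auto simp: set_add_def' submodule_sum_def)

lemma (in triassociative) sprod_carrier:
  "{tprod L p x y |x y. x \<in> carrier L \<and> y \<in> carrier L} \<subseteq> carrier L"
  using tprod_closed by auto

lemma (in triassociative) derived_subspace: "subspace k (derived k L) L"
  unfolding derived_def lozenge_def set_add_eq_sum sprod_def
  by (intro sum_is_subspace span_subspace sprod_carrier)

lemma (in triassociative) derived_prod:
  assumes "x \<in> carrier L" "y \<in> carrier L"
  shows "tprod L p x y \<in> derived k L"
proof -
  let ?S = "\<lambda>p. sprod k L p (carrier L) (carrier L)"
  have sub: "subspace k (?S p) L" for p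
    unfolding sprod_def by (intro span_subspace sprod_carrier)
  have z: "\<zero> \<in> ?S p" "?S p \<subseteq> carrier L" for p using subspaceD[OF sub] by auto
  have t: "tprod L p x y \<in> ?S p"
    unfolding sprod_def using in_own_span[OF sprod_carrier] assms by blast
  have tc: "tprod L p x y \<in> carrier L" using assms by (rule tprod_closed)
  have add: "a \<oplus> b \<in> A <+> B" if "a \<in> A" "b \<in> B" for a b A B
    using that by (auto simp: set_add_def')
  show ?thesis
  proof (cases p)
    case Vdash
    have "tprod L p x y \<oplus> \<zero> \<oplus> \<zero> \<in> derived k L"
      unfolding derived_def lozenge_def using t z(1) unfolding Vdash by (intro add)
    then show ?thesis using tc by simp
  next
    case Dashv
    have "\<zero> \<oplus> tprod L p x y \<oplus> \<zero> \<in> derived k L"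
      unfolding derived_def lozenge_def using t z(1) unfolding Dashv by (intro add)
    then show ?thesis using tc by simp
  next
    case Perp
    have "\<zero> \<oplus> \<zero> \<oplus> tprod L p x y \<in> derived k L"
      unfolding derived_def lozenge_def using t z(1) unfolding Perp by (intro add)
    then show ?thesis using tc by simp
  qed
qed

lemma (in triassociative) derived_least:
  assumes W: "subspace k W L"
    and prod: "\<And>p x y. x \<in> carrier L \<Longrightarrow> y \<in> carrier L \<Longrightarrow> tprod L p x y \<in> W"
  shows "derived k L \<subseteq> W"
proof -
  have "sprod k L p (carrier L) (carrier L) \<subseteq> W" for p
    unfolding sprod_def using prod by (intro span_least W) auto
  then show ?thesis
    unfolding derived_def lozenge_def set_add_def' using subspaceD(3)[OF W] by blast
qed

lemma (in triassociative) subspace_abelian_subgroup: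
  assumes W: "subspace k W L"
  shows "abelian_subgroup W L"
proof (intro abelian_subgroupI3 additive_subgroup.intro group.subgroupI[OF M.a_group])
  note w = subspaceD[OF W]
  show "W \<subseteq> carrier (add_monoid L)" "W \<noteq> {}" using w by auto
  show "abelian_group L" by (rule M.abelian_group_axioms)
  fix a assume a: "a \<in> W"
  then have "\<ominus> a = (\<ominus>\<^bsub>k\<^esub> \<one>\<^bsub>k\<^esub>) \<odot> a" using w smult_minus_1 by auto
  also have "\<dots> \<in> W" using a w by auto
  finally show "inv\<^bsub>add_monoid L\<^esub> a \<in> W" by (simp add: a_inv_def)
  fix b assume "b \<in> W"
  then show "a \<otimes>\<^bsub>add_monoid L\<^esub> b \<in> W" using a w by auto
qed

lemma (in triassociative) trias_quot_simps:
  assumes I: "trias_ideal k L I"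
  shows "carrier (trias_quot L I) = (\<lambda>x. I +> x) ` carrier L"
    and "\<zero>\<^bsub>trias_quot L I\<^esub> = I"
    and "\<lbrakk>x \<in> carrier L; y \<in> carrier L\<rbrakk> \<Longrightarrow> (I +> x) \<oplus>\<^bsub>trias_quot L I\<^esub> (I +> y) = I +> (x \<oplus> y)"
    and "\<lbrakk>c \<in> carrier k; x \<in> carrier L\<rbrakk> \<Longrightarrow> c \<odot>\<^bsub>trias_quot L I\<^esub> (I +> x) = I +> (c \<odot> x)"
    and "\<lbrakk>x \<in> carrier L; y \<in> carrier L\<rbrakk>
      \<Longrightarrow> tprod (trias_quot L I) p (I +> x) (I +> y) = I +> tprod L p x y"
    and "\<lbrakk>x \<in> carrier L; y \<in> carrier L\<rbrakk> \<Longrightarrow> I +> x = I +> y \<longleftrightarrow> x \<ominus> y \<in> I"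
    and "x \<in> carrier L \<Longrightarrow> x \<in> I +> x"
proof -
  have sub: "subspace k I L" and id: "\<And>p x i. x \<in> carrier L \<Longrightarrow> i \<in> I \<Longrightarrow> tprod L p x i \<in> I"
    "\<And>p x i. x \<in> carrier L \<Longrightarrow> i \<in> I \<Longrightarrow> tprod L p i x \<in> I"
    using I by (auto simp: trias_ideal_def)
  note s = subspaceD[OF sub]
  interpret I: abelian_subgroup I L by (rule subspace_abelian_subgroup[OF sub])
  have mem: "y \<in> I +> x \<longleftrightarrow> (\<exists>i\<in>I. y = i \<oplus> x)" for x y
    by (auto simp: a_r_coset_def')
  have eqI: "I +> y = I +> x" if "y \<in> I +> x" "x \<in> carrier L" for x y
    using M.a_repr_independence[OF that I.a_subgroup] by simp
  show "carrier (trias_quot L I) = (\<lambda>x. I +> x) ` carrier L"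
    by (auto simp: trias_quot_def A_RCOSETS_def')
  show "\<zero>\<^bsub>trias_quot L I\<^esub> = I" by (simp add: trias_quot_def)
  show self: "x \<in> I +> x" if "x \<in> carrier L" for x using that by (rule I.a_rcos_self)
  show "(I +> x) \<oplus>\<^bsub>trias_quot L I\<^esub> (I +> y) = I +> (x \<oplus> y)"
    if "x \<in> carrier L" "y \<in> carrier L"
    using that by (simp add: trias_quot_def I.a_rcos_sum)
  show "c \<odot>\<^bsub>trias_quot L I\<^esub> (I +> x) = I +> (c \<odot> x)" if c: "c \<in> carrier k" and x: "x \<in> carrier L"
  proof -
    have "I +> (c \<odot> y) = I +> (c \<odot> x)" if y: "y \<in> I +> x" for y
    proof -
      obtain i where i: "i \<in> I" "y = i \<oplus> x" using y unfolding mem by blast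
      have "i \<in> carrier L" using i s(1) by blast
      then have "c \<odot> y = (c \<odot> i) \<oplus> (c \<odot> x)" using i c x by (simp add: smult_r_distr)
      moreover have "c \<odot> i \<in> I" using c i by (intro s(4))
      ultimately have "c \<odot> y \<in> I +> (c \<odot> x)" unfolding mem by blast
      then show ?thesis by (rule eqI) (use c x in simp)
    qed
    then have "(\<Union>y\<in>I +> x. I +> (c \<odot> y)) = (\<Union>y\<in>I +> x. I +> (c \<odot> x))"
      by (intro SUP_cong refl)
    also have "\<dots> = I +> (c \<odot> x)" using self[OF x] by (intro UN_constant_eq) auto
    finally show ?thesis by (simp add: trias_quot_def)
  qed
  show "tprod (trias_quot L I) p (I +> x) (I +> y) = I +> tprod L p x y"
    if x: "x \<in> carrier L" and y: "y \<in> carrier L"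
  proof -
    have "I +> tprod L p u v = I +> tprod L p x y" if uv: "u \<in> I +> x" "v \<in> I +> y" for u v
    proof -
      obtain i j where i: "i \<in> I" "u = i \<oplus> x" and j: "j \<in> I" "v = j \<oplus> y"
        using uv unfolding mem by blast
      have c: "i \<in> carrier L" "j \<in> carrier L" using i j s(1) by auto
      have "tprod L p u v = (tprod L p i v \<oplus> tprod L p x j) \<oplus> tprod L p x y"
      proof -
        have v: "v \<in> carrier L" using c y j by simp
        have "tprod L p u v = tprod L p i v \<oplus> tprod L p x v"
          using c x v by (simp add: i(2) tprod_add_left)
        also have "tprod L p x v = tprod L p x j \<oplus> tprod L p x y"
          using c x y by (simp add: j(2) tprod_add_right)
        finally show ?thesis using c x y v by (simp add: tprod_closed M.a_assoc)
      qed
      moreover have "tprod L p i v \<oplus> tprod L p x j \<in> I" using c x y i j by (intro s(3) id) simp_all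
      ultimately have "tprod L p u v \<in> I +> tprod L p x y" unfolding mem by blast
      then show ?thesis by (rule eqI) (use x y in \<open>rule tprod_closed\<close>)
    qed
    then have "(\<Union>u\<in>I +> x. \<Union>v\<in>I +> y. I +> tprod L p u v) =
        (\<Union>u\<in>I +> x. \<Union>v\<in>I +> y. I +> tprod L p x y)"
      by (intro SUP_cong refl)
    also have "\<dots> = I +> tprod L p x y"
      using self[OF x] self[OF y] by blast
    finally show ?thesis by (simp add: trias_quot_def)
  qed
  show "I +> x = I +> y \<longleftrightarrow> x \<ominus> y \<in> I" if x: "x \<in> carrier L" and y: "y \<in> carrier L"
  proof
    assume "I +> x = I +> y"
    then have "x \<in> I +> y" using self[OF x] by simp
    then obtain i where i: "i \<in> I" "x = i \<oplus> y" unfolding mem by blast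
    then have "x \<ominus> y = i" using y s(1) by (simp add: subset_iff a_minus_def M.a_assoc M.r_neg)
    then show "x \<ominus> y \<in> I" using i by simp
  next
    assume "x \<ominus> y \<in> I"
    moreover have "x = (x \<ominus> y) \<oplus> y" using x y by (simp add: a_minus_def M.a_assoc M.l_neg)
    ultimately have "x \<in> I +> y" unfolding mem by blast
    then show "I +> x = I +> y" using y by (rule eqI)
  qed
qed

lemma trias_iso_quot_iff:
  assumes K: "triassociative k K" and L: "triassociative k L" and M: "trias_ideal k K M"
  shows "trias_iso k (trias_quot K M) L \<longleftrightarrow>
    (\<exists>q \<in> trias_hom k K L. q ` carrier K = carrier L \<and> a_kernel K L q = M)" (is "?lhs \<longleftrightarrow> ?rhs")
proof -
  interpret K: triassociative k K by fact
  interpret L: triassociative k L by fact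
  note Q = K.trias_quot_simps[OF M]
  have Mc: "M \<subseteq> carrier K" using M by (auto simp: trias_ideal_def dest: subspaceD)
  have p: "(\<lambda>x. M +>\<^bsub>K\<^esub> x) \<in> trias_hom k K (trias_quot K M)"
    by (rule trias_homI) (auto simp: Q(1,3-5))
  show ?thesis
  proof
    assume ?lhs
    then obtain h where h: "h \<in> trias_hom k (trias_quot K M) L"
      "bij_betw h (carrier (trias_quot K M)) (carrier L)" by (auto simp: trias_iso_def)
    let ?q = "\<lambda>x. h (M +>\<^bsub>K\<^esub> x)"
    have q: "?q \<in> trias_hom k K L" by (rule trias_hom_comp[OF p h(1)])
    have surj: "?q ` carrier K = carrier L"
      using h(2) by (simp add: bij_betw_def Q(1) image_image)
    have z: "h (M +>\<^bsub>K\<^esub> \<zero>\<^bsub>K\<^esub>) = \<zero>\<^bsub>L\<^esub>" using trias_hom_zero[OF K L q] .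
    have inj: "h (M +>\<^bsub>K\<^esub> x) = h (M +>\<^bsub>K\<^esub> y) \<longleftrightarrow> M +>\<^bsub>K\<^esub> x = M +>\<^bsub>K\<^esub> y"
      if "x \<in> carrier K" "y \<in> carrier K" for x y
      using that h(2) by (auto simp: bij_betw_def Q(1) inj_on_def)
    have "a_kernel K L ?q = M"
    proof -
      have "?q x = \<zero>\<^bsub>L\<^esub> \<longleftrightarrow> x \<in> M" if x: "x \<in> carrier K" for x
      proof -
        have "x \<ominus>\<^bsub>K\<^esub> \<zero>\<^bsub>K\<^esub> = (x \<ominus>\<^bsub>K\<^esub> \<zero>\<^bsub>K\<^esub>) \<oplus>\<^bsub>K\<^esub> \<zero>\<^bsub>K\<^esub>"
          by (rule K.M.r_zero[symmetric]) (use x in simp)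
        also have "\<dots> = x"
          using x K.M.l_neg[OF K.M.zero_closed]
          by (simp only: a_minus_def K.M.a_assoc K.M.a_inv_closed K.M.zero_closed K.M.r_zero)
        finally have "x \<ominus>\<^bsub>K\<^esub> \<zero>\<^bsub>K\<^esub> = x" .
        then show ?thesis
          using inj[OF that K.M.zero_closed] Q(6)[OF that K.M.zero_closed] z by simp
      qed
      then show ?thesis using Mc by (auto simp: a_kernel_def kernel_def)
    qed
    then show ?rhs using q surj by (intro bexI[of _ ?q] conjI)
  next
    assume ?rhs
    then obtain q where q: "q \<in> trias_hom k K L" and surj: "q ` carrier K = carrier L"
      and ker: "a_kernel K L q = M" by blast
    have eq: "M +>\<^bsub>K\<^esub> x = M +>\<^bsub>K\<^esub> y \<longleftrightarrow> q x = q y" if "x \<in> carrier K" "y \<in> carrier K" for x y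
    proof -
      have "M +>\<^bsub>K\<^esub> x = M +>\<^bsub>K\<^esub> y \<longleftrightarrow> q x \<ominus>\<^bsub>L\<^esub> q y = \<zero>\<^bsub>L\<^esub>"
        using that Q(6)[OF that] ker trias_hom_minus[OF K L q that]
        by (auto simp: a_kernel_def kernel_def)
      also have "\<dots> \<longleftrightarrow> q x = q y"
      proof
        assume 0: "q x \<ominus>\<^bsub>L\<^esub> q y = \<zero>\<^bsub>L\<^esub>"
        have "q x = (q x \<ominus>\<^bsub>L\<^esub> q y) \<oplus>\<^bsub>L\<^esub> q y"
          using trias_homD(1)[OF q] that by (simp add: a_minus_def L.M.a_assoc L.M.l_neg)
        then show "q x = q y" using trias_homD(1)[OF q] that by (simp add: 0)
      qed (use trias_homD(1)[OF q] that in \<open>simp add: a_minus_def L.M.r_neg\<close>)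
      finally show ?thesis .
    qed
    define h where "h = (\<lambda>A. q (SOME x. x \<in> carrier K \<and> M +>\<^bsub>K\<^esub> x = A))"
    have h: "h (M +>\<^bsub>K\<^esub> x) = q x" if x: "x \<in> carrier K" for x
    proof -
      let ?y = "SOME y. y \<in> carrier K \<and> M +>\<^bsub>K\<^esub> y = M +>\<^bsub>K\<^esub> x"
      have "?y \<in> carrier K \<and> M +>\<^bsub>K\<^esub> ?y = M +>\<^bsub>K\<^esub> x" using x by (rule_tac someI[of _ x]) auto
      then show ?thesis using eq[of ?y x] x by (simp add: h_def)
    qed
    have "h \<in> trias_hom k (trias_quot K M) L"
      by (rule trias_homI) (use trias_homD[OF q] in \<open>auto simp: Q(1,3-5) h K.tprod_closed\<close>)
    moreover have "bij_betw h (carrier (trias_quot K M)) (carrier L)"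
      using surj by (auto simp: bij_betw_def inj_on_def Q(1) h eq image_image cong: image_cong)
    ultimately show ?lhs by (auto simp: trias_iso_def)
  qed
qed


lemma trias_hom_derived:
  assumes A: "triassociative k A" and B: "triassociative k B" and h: "h \<in> trias_hom k A B"
  shows "h ` derived k A \<subseteq> derived k B"
proof -
  interpret A: triassociative k A by fact
  interpret B: triassociative k B by fact
  note d = subspaceD[OF B.derived_subspace]
  have "subspace k {x \<in> carrier A. h x \<in> derived k B} A"
    by (rule A.subspaceI) (use trias_homD[OF h] trias_hom_zero[OF A B h] d(2-) in auto)
  then have "derived k A \<subseteq> {x \<in> carrier A. h x \<in> derived k B}"
    by (rule A.derived_least)
      (use trias_homD[OF h] B.derived_prod A.tprod_closed in auto)
  then show ?thesis by auto
qed

lemma defining_pair_iff: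
  assumes L: "triassociative k L"
  shows "defining_pair k L K M \<longleftrightarrow> triassociative k K \<and> trias_ideal k K M \<and>
    (\<exists>q \<in> trias_hom k K L. q ` carrier K = carrier L \<and> a_kernel K L q = M) \<and>
    M \<subseteq> center K \<inter> derived k K"
  by (simp add: defining_pair_def trias_iso_quot_iff[OF _ L] cong: conj_cong)

lemma defining_pair_generated:
  assumes L: "triassociative k L" and K: "triassociative k K" and q: "q \<in> trias_hom k K L"
    and M: "a_kernel K L q \<subseteq> center K \<inter> derived k K"
    and W: "subspace k W K" and surj: "q ` W = carrier L" and U: "U \<subseteq> W" "q ` U = carrier L"
    and prod: "\<And>p x y. x \<in> U \<Longrightarrow> y \<in> U \<Longrightarrow> tprod K p x y \<in> W"
  shows "W = carrier K"
proof -
  interpret K: triassociative k K by fact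
  interpret L: triassociative k L by fact
  note w = subspaceD[OF W]
  have dec: "\<exists>u \<in> U. \<exists>m \<in> a_kernel K L q. x = u \<oplus>\<^bsub>K\<^esub> m" if x: "x \<in> carrier K" for x
  proof -
    obtain u where u: "u \<in> U" "q u = q x"
      using U(2) trias_homD(1)[OF q x] by (metis image_iff)
    have uc: "u \<in> carrier K" using u U(1) w(1) by blast
    have "q (x \<ominus>\<^bsub>K\<^esub> u) = \<zero>\<^bsub>L\<^esub>"
      using trias_hom_minus[OF K L q x uc] u(2) trias_homD(1)[OF q x]
      by (simp add: a_minus_def L.M.r_neg)
    then have "x \<ominus>\<^bsub>K\<^esub> u \<in> a_kernel K L q" using x uc by (auto simp: a_kernel_def kernel_def)
    moreover have "x = u \<oplus>\<^bsub>K\<^esub> (x \<ominus>\<^bsub>K\<^esub> u)"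
    proof -
      have "x = (x \<ominus>\<^bsub>K\<^esub> u) \<oplus>\<^bsub>K\<^esub> u" using x uc by (simp add: a_minus_def K.M.a_assoc K.M.l_neg)
      also have "\<dots> = u \<oplus>\<^bsub>K\<^esub> (x \<ominus>\<^bsub>K\<^esub> u)" by (rule K.M.a_comm) (use x uc in simp_all)
      finally show ?thesis .
    qed
    ultimately show ?thesis using u(1) by blast
  qed
  have "derived k K \<subseteq> W"
  proof (rule K.derived_least[OF W])
    fix p x y assume x: "x \<in> carrier K" and y: "y \<in> carrier K"
    obtain u m where u: "u \<in> U" "m \<in> a_kernel K L q" "x = u \<oplus>\<^bsub>K\<^esub> m" using dec[OF x] by blast
    obtain v n where v: "v \<in> U" "n \<in> a_kernel K L q" "y = v \<oplus>\<^bsub>K\<^esub> n" using dec[OF y] by blast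
    have c: "u \<in> carrier K" "v \<in> carrier K" using u v U(1) w(1) by auto
    have mn: "m \<in> center K" "n \<in> center K" using u v M by auto
    then have mc: "m \<in> carrier K" "n \<in> carrier K" by (auto simp: center_def)
    have "tprod K p x y = tprod K p u y \<oplus>\<^bsub>K\<^esub> tprod K p m y"
      unfolding u(3) using c mc y by (simp add: K.tprod_add_left)
    also have "\<dots> = tprod K p u y"
      using mn c y by (simp add: center_def K.tprod_closed)
    also have "\<dots> = tprod K p u v \<oplus>\<^bsub>K\<^esub> tprod K p u n"
      unfolding v(3) using c mc by (simp add: K.tprod_add_right)
    also have "\<dots> = tprod K p u v"
      using mn c by (simp add: center_def K.tprod_closed)
    finally show "tprod K p x y \<in> W" using prod u v by simp
  qed
  then have MW: "a_kernel K L q \<subseteq> W" using M by blast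
  have "carrier K \<subseteq> W"
  proof
    fix x assume "x \<in> carrier K"
    then obtain u m where "u \<in> U" "m \<in> a_kernel K L q" "x = u \<oplus>\<^bsub>K\<^esub> m" using dec by blast
    then show "x \<in> W" using w(3) MW U(1) by blast
  qed
  then show ?thesis using w(1) by blast
qed

lemma trias_copy_defining_pair:
  assumes L: "triassociative k L" and def: "defining_pair k L K M" and i: "inj_on i (carrier K)"
  shows "defining_pair k L (trias_copy i K) (i ` M)"
proof -
  have K: "triassociative k K" and id: "trias_ideal k K M" and M: "M \<subseteq> center K \<inter> derived k K"
    using def by (auto simp: defining_pair_def)
  obtain q where q: "q \<in> trias_hom k K L" "q ` carrier K = carrier L" "a_kernel K L q = M"
    using def defining_pair_iff[OF L] by metis
  interpret K: triassociative k K by fact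
  note c = trias_copy[OF K i]
  let ?B = "trias_copy i K" and ?g = "inv_into (carrier K) i"
  interpret B: triassociative k ?B by (rule c(1))
  have Mc: "M \<subseteq> carrier K" using M by (auto simp: center_def)
  have gi: "?g (i x) = x" if "x \<in> carrier K" for x using i that by simp
  have car: "carrier ?B = i ` carrier K" and z: "\<zero>\<^bsub>?B\<^esub> = i \<zero>\<^bsub>K\<^esub>"
    by (simp_all add: trias_copy_def Let_def)
  have sub: "subspace k M K" and idl: "\<And>p x m. x \<in> carrier K \<Longrightarrow> m \<in> M \<Longrightarrow>
    tprod K p x m \<in> M \<and> tprod K p m x \<in> M"
    using id by (auto simp: trias_ideal_def)
  note m = subspaceD[OF sub]
  note ci = trias_homD[OF c(2)]
  have "subspace k (i ` M) ?B"
  proof (rule B.subspaceI)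
    show "i ` M \<subseteq> carrier ?B" using Mc car by auto
    show "\<zero>\<^bsub>?B\<^esub> \<in> i ` M" using z m(2) by auto
    show "v \<oplus>\<^bsub>?B\<^esub> w \<in> i ` M" if vw: "v \<in> i ` M" "w \<in> i ` M" for v w
    proof -
      obtain x y where x: "x \<in> M" "v = i x" and y: "y \<in> M" "w = i y" using vw by blast
      then have "v \<oplus>\<^bsub>?B\<^esub> w = i (x \<oplus>\<^bsub>K\<^esub> y)"
        using ci(2)[OF subsetD[OF Mc x(1)] subsetD[OF Mc y(1)]] by simp
      then show ?thesis using m(3) x(1) y(1) by blast
    qed
    show "a \<odot>\<^bsub>?B\<^esub> v \<in> i ` M" if a: "a \<in> carrier k" and v: "v \<in> i ` M" for a v
    proof -
      obtain x where x: "x \<in> M" "v = i x" using v by blast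
      then have "a \<odot>\<^bsub>?B\<^esub> v = i (a \<odot>\<^bsub>K\<^esub> x)"
        using ci(3)[OF a subsetD[OF Mc x(1)]] by simp
      then show ?thesis using m(4) x(1) a by blast
    qed
  qed
  moreover have "tprod ?B p x y \<in> i ` M \<and> tprod ?B p y x \<in> i ` M"
    if xy: "x \<in> carrier ?B" "y \<in> i ` M" for p x y
  proof -
    obtain u v where u: "u \<in> carrier K" "x = i u" and v: "v \<in> M" "y = i v"
      using xy car by blast
    then have "tprod ?B p x y = i (tprod K p u v)" "tprod ?B p y x = i (tprod K p v u)"
      using ci(4)[OF u(1) subsetD[OF Mc v(1)], of p] ci(4)[OF subsetD[OF Mc v(1)] u(1), of p]
      by simp_all
    then show ?thesis using idl[OF u(1) v(1)] by blast
  qed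
  ultimately have idB: "trias_ideal k ?B (i ` M)" by (auto simp: trias_ideal_def)
  have cen: "i ` M \<subseteq> center ?B"
  proof
    fix y assume "y \<in> i ` M"
    then obtain v where v: "v \<in> M" "y = i v" by blast
    have vc: "v \<in> center K" "v \<in> carrier K" using v M Mc by auto
    have "tprod ?B p y x = \<zero>\<^bsub>?B\<^esub> \<and> tprod ?B p x y = \<zero>\<^bsub>?B\<^esub>" if x: "x \<in> carrier ?B" for p x
    proof -
      obtain u where u: "u \<in> carrier K" "x = i u" using x car by blast
      then have "tprod ?B p x y = i (tprod K p u v)" "tprod ?B p y x = i (tprod K p v u)"
        using ci(4)[OF u(1) vc(2), of p] ci(4)[OF vc(2) u(1), of p] v(2) by simp_all
      then show ?thesis using vc u z by (simp add: center_def)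
    qed
    then show "y \<in> center ?B" using vc v car by (auto simp: center_def)
  qed
  have der: "i ` M \<subseteq> derived k ?B" using M trias_hom_derived[OF K c(1) c(2)] by blast
  have hom: "(\<lambda>x. q (?g x)) \<in> trias_hom k ?B L" by (rule trias_hom_comp[OF c(3) q(1)])
  have img: "(\<lambda>x. q (?g x)) ` carrier ?B = carrier L"
    using q(2) by (simp add: car image_image gi cong: image_cong)
  have "a_kernel ?B L (\<lambda>x. q (?g x)) = i ` M"
    unfolding q(3)[symmetric] by (auto simp: a_kernel_def kernel_def car gi)
  then show ?thesis
    using c(1) idB cen der hom img by (auto simp: defining_pair_iff[OF L])
qed

lemma trias_copy_dim:
  assumes K: "triassociative k K" and i: "inj_on i (carrier K)"
    and fd: "vectorspace.fin_dim k (trias_copy i K)"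
  shows "vectorspace.fin_dim k K \<and> vectorspace.dim k K = vectorspace.dim k (trias_copy i K)"
proof -
  note c = trias_copy[OF K i]
  interpret K: triassociative k K by fact
  interpret B: triassociative k "trias_copy i K" by (rule c(1))
  let ?g = "inv_into (carrier K) i"
  have car: "carrier (trias_copy i K) = i ` carrier K" by (simp add: trias_copy_def Let_def)
  interpret g: linear_map k "trias_copy i K" K ?g
    by (intro linear_map.intro mod_hom.intro mod_hom_axioms.intro B.vectorspace_axioms
        K.vectorspace_axioms K.module_axioms B.module_axioms)
      (use c(3) in \<open>simp add: trias_hom_def\<close>)
  have surj: "?g ` carrier (trias_copy i K) = carrier K"
    using i by (simp add: car image_image cong: image_cong)
  have "inj_on ?g (carrier (trias_copy i K))"
    unfolding car by (rule inj_on_inv_into) simp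
  then show ?thesis
    using g.dim_eq[OF fd _ surj] g.rank_nullity_main(2)[OF fd surj] by simp
qed

lemma cover_maximal:
  fixes K' :: "('k, 'd) trias" and L :: "('k, 'a) trias"
  assumes L: "triassociative k L" and cov: "cover k L K M" and def: "defining_pair k L K' M'"
  shows "vectorspace.fin_dim k K' \<and> vectorspace.dim k K' \<le> vectorspace.dim k K"
proof -
  have K': "triassociative k K'" using def by (simp add: defining_pair_def)
  obtain q where q: "q \<in> trias_hom k K' L" "q ` carrier K' = carrier L" "a_kernel K' L q = M'"
    and M': "M' \<subseteq> center K' \<inter> derived k K'"
    using def defining_pair_iff[OF L] by metis
  define \<sigma> where "\<sigma> = inv_into (carrier K') q"
  have \<sigma>: "\<sigma> y \<in> carrier K'" "q (\<sigma> y) = y" if "y \<in> carrier L" for y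
    using that q(2) unfolding \<sigma>_def by (auto intro: inv_into_into f_inv_into_f)
  let ?S = "\<sigma> ` carrier L"
  have S: "?S \<subseteq> carrier K'" using \<sigma> by auto
  note g = gen_alg_triassociative[OF K' S]
  have im: "q ` gen_alg k K' ?S = carrier L"
  proof (intro equalityI subsetI)
    fix y assume y: "y \<in> carrier L"
    then have "\<sigma> y \<in> gen_alg k K' ?S" by (auto intro: gen_alg.gen)
    then show "y \<in> q ` gen_alg k K' ?S" using \<sigma>(2)[OF y] by force
  qed (use g(1) trias_homD(1)[OF q(1)] in auto)
  have "gen_alg k K' ?S = carrier K'"
    by (rule defining_pair_generated[OF L K' q(1) _ g(2) im order_refl im])
      (use q(3) M' in \<open>auto intro: gen_alg.prod\<close>)
  moreover obtain i :: "'d \<Rightarrow> ('k, 'a) tterm" where "inj_on i (gen_alg k K' ?S)"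
    by (rule gen_alg_inj)
  ultimately have i: "inj_on i (carrier K')" by simp
  have "defining_pair k L (trias_copy i K') (i ` M')"
    by (rule trias_copy_defining_pair[OF L def i])
  then have "vectorspace.fin_dim k (trias_copy i K')"
    "vectorspace.dim k (trias_copy i K') \<le> vectorspace.dim k K"
    using cov by (auto simp: cover_def)
  then show ?thesis using trias_copy_dim[OF K' i] by simp
qed

lemma (in triassociative) tprod_zero:
  assumes "x \<in> carrier L"
  shows "tprod L p x \<zero> = \<zero>" "tprod L p \<zero> x = \<zero>"
proof -
  show "tprod L p x \<zero> = \<zero>"
    using tprod_smult_right[OF R.zero_closed assms M.zero_closed, of p] assms
    by (simp add: tprod_closed)
  show "tprod L p \<zero> x = \<zero>"
    using tprod_smult_left[OF R.zero_closed M.zero_closed assms, of p] assms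
    by (simp add: tprod_closed)
qed

lemma trias_quot_triassociative:
  assumes L: "triassociative k L" and I: "trias_ideal k L I"
  shows "triassociative k (trias_quot L I)"
proof -
  interpret L: triassociative k L by fact
  note Q = L.trias_quot_simps[OF I]
  have I0: "I +>\<^bsub>L\<^esub> \<zero>\<^bsub>L\<^esub> = I"
    using I by (intro L.M.a_coset_add_zero) (auto simp: trias_ideal_def dest: subspaceD)
  let ?Q = "trias_quot L I"
  have ab: "abelian_group ?Q"
  proof (rule abelian_groupI)
    have "I +>\<^bsub>L\<^esub> \<zero>\<^bsub>L\<^esub> \<in> carrier ?Q" by (simp add: Q(1))
    then show "\<zero>\<^bsub>?Q\<^esub> \<in> carrier ?Q" by (simp add: Q(2) I0)
    fix A assume "A \<in> carrier ?Q"
    then obtain x where x: "x \<in> carrier L" "A = I +>\<^bsub>L\<^esub> x" by (auto simp: Q(1))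
    have "\<zero>\<^bsub>?Q\<^esub> = I +>\<^bsub>L\<^esub> \<zero>\<^bsub>L\<^esub>" by (simp add: Q(2) I0)
    then show "\<zero>\<^bsub>?Q\<^esub> \<oplus>\<^bsub>?Q\<^esub> A = A" using x by (simp add: Q(3))
    have "(I +>\<^bsub>L\<^esub> (\<ominus>\<^bsub>L\<^esub> x)) \<oplus>\<^bsub>?Q\<^esub> A = \<zero>\<^bsub>?Q\<^esub>"
      using x by (simp add: Q(2,3) I0 L.M.l_neg)
    then show "\<exists>B\<in>carrier ?Q. B \<oplus>\<^bsub>?Q\<^esub> A = \<zero>\<^bsub>?Q\<^esub>" using x by (auto simp: Q(1))
    fix B assume "B \<in> carrier ?Q"
    then obtain y where y: "y \<in> carrier L" "B = I +>\<^bsub>L\<^esub> y" by (auto simp: Q(1))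
    show "A \<oplus>\<^bsub>?Q\<^esub> B = B \<oplus>\<^bsub>?Q\<^esub> A"
      using x y by (simp add: Q(3) L.M.a_comm[of x y])
  qed (auto simp: Q(1,3) L.M.a_assoc)
  have "module k ?Q"
    by (rule moduleI[OF _ ab])
      (auto simp: Q(1,3,4) L.smult_l_distr L.smult_r_distr L.smult_assoc1 L.R.is_cring)
  then have "vectorspace k ?Q"
    by (intro vectorspace.intro L.field_axioms)
  then show ?thesis
  proof (intro triassociative.intro triassociative_axioms.intro, goal_cases)
    case (7 A B C)
    then obtain x y z where "A = I +>\<^bsub>L\<^esub> x" "B = I +>\<^bsub>L\<^esub> y" "C = I +>\<^bsub>L\<^esub> z"
      "x \<in> carrier L" "y \<in> carrier L" "z \<in> carrier L" by (auto simp: Q(1))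
    then show ?case using L.trias_axioms[of x y z] by (auto simp: Q(5) L.tprod_closed)
  qed (auto simp: Q(1,3-5) L.tprod_closed L.tprod_add_left L.tprod_add_right
      L.tprod_smult_left L.tprod_smult_right)
qed

lemma defining_pair_bound:
  assumes L: "triassociative k L" and def: "defining_pair k L K M"
    and B: "finite B" "B \<subseteq> carrier L" "module.span k L B = carrier L"
  shows "vectorspace.fin_dim k K \<and>
    vectorspace.dim k K \<le> card B + card ({Vdash, Dashv, Perp} \<times> B \<times> B)"
proof -
  have K: "triassociative k K" using def by (simp add: defining_pair_def)
  obtain q where q: "q \<in> trias_hom k K L" "q ` carrier K = carrier L" "a_kernel K L q = M"
    and M: "M \<subseteq> center K \<inter> derived k K"
    using def defining_pair_iff[OF L] by metis
  interpret K: triassociative k K by fact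
  interpret L: triassociative k L by fact
  define \<sigma> where "\<sigma> = inv_into (carrier K) q"
  have \<sigma>: "\<sigma> y \<in> carrier K" "q (\<sigma> y) = y" if "y \<in> carrier L" for y
    using that q(2) unfolding \<sigma>_def by (auto intro: inv_into_into f_inv_into_f)
  let ?S = "\<sigma> ` B" and ?I = "{Vdash, Dashv, Perp} \<times> B \<times> B"
  let ?P = "(\<lambda>(p, b, c). tprod K p (\<sigma> b) (\<sigma> c)) ` ?I"
  let ?U = "K.span ?S" and ?W = "K.span (?S \<union> ?P)"
  have Sc: "?S \<subseteq> carrier K" using \<sigma> B(2) by auto
  have Pc: "?P \<subseteq> carrier K" using \<sigma> B(2) by (auto intro!: K.tprod_closed)
  then have SP: "?S \<union> ?P \<subseteq> carrier K" using Sc by blast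
  have U: "subspace k ?U K" and W: "subspace k ?W K"
    using K.span_subspace[OF Sc] K.span_subspace[OF SP] by simp_all
  note u = subspaceD[OF U] and w = subspaceD[OF W]
  have SU: "?S \<subseteq> ?U" and SPW: "?S \<union> ?P \<subseteq> ?W"
    using K.in_own_span[OF Sc] K.in_own_span[OF SP] by auto
  have UW: "?U \<subseteq> ?W" by (rule K.span_least[OF W]) (use SPW in blast)
  have "subspace k (q ` ?U) L"
  proof (rule L.subspaceI)
    show "q ` ?U \<subseteq> carrier L" using u(1) trias_homD(1)[OF q(1)] by blast
    show "\<zero>\<^bsub>L\<^esub> \<in> q ` ?U" using trias_hom_zero[OF K L q(1)] u(2) by force
    show "x \<oplus>\<^bsub>L\<^esub> y \<in> q ` ?U" if xy: "x \<in> q ` ?U" "y \<in> q ` ?U" for x y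
    proof -
      obtain a b where a: "a \<in> ?U" "x = q a" and b: "b \<in> ?U" "y = q b" using xy by blast
      then have "x \<oplus>\<^bsub>L\<^esub> y = q (a \<oplus>\<^bsub>K\<^esub> b)"
        using trias_homD(2)[OF q(1) subsetD[OF u(1) a(1)] subsetD[OF u(1) b(1)]] by simp
      then show ?thesis using u(3)[OF a(1) b(1)] by blast
    qed
    show "c \<odot>\<^bsub>L\<^esub> x \<in> q ` ?U" if c: "c \<in> carrier k" and x: "x \<in> q ` ?U" for c x
    proof -
      obtain a where a: "a \<in> ?U" "x = q a" using x by blast
      then have "c \<odot>\<^bsub>L\<^esub> x = q (c \<odot>\<^bsub>K\<^esub> a)"
        using trias_homD(3)[OF q(1) c subsetD[OF u(1) a(1)]] by simp
      then show ?thesis using u(4)[OF c a(1)] by blast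
    qed
  qed
  moreover have "B \<subseteq> q ` ?U"
  proof
    fix b assume b: "b \<in> B"
    then have "q (\<sigma> b) \<in> q ` ?U" using SU by blast
    then show "b \<in> q ` ?U" using \<sigma>(2) b B(2) by auto
  qed
  ultimately have "L.span B \<subseteq> q ` ?U" by (rule L.span_least)
  then have qU: "q ` ?U = carrier L" using B(3) u(1) trias_homD(1)[OF q(1)] by blast
  have qW: "q ` ?W = carrier L" using qU UW w(1) trias_homD(1)[OF q(1)] by blast
  have 1: "tprod K p x s \<in> ?W" if s: "s \<in> ?S" and x: "x \<in> ?U" for p x s
  proof -
    have sc: "s \<in> carrier K" using s Sc by blast
    have "subspace k {x \<in> carrier K. tprod K p x s \<in> ?W} K"
      by (rule K.subspaceI)
        (use sc w(2-) in \<open>auto simp: K.tprod_add_left K.tprod_smult_left K.tprod_zero\<close>)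
    moreover have "?S \<subseteq> {x \<in> carrier K. tprod K p x s \<in> ?W}"
    proof
      fix t assume t: "t \<in> ?S"
      obtain b c where bc: "b \<in> B" "t = \<sigma> b" "c \<in> B" "s = \<sigma> c" using s t by blast
      have "tprod K p t s \<in> ?P"
        by (rule image_eqI[of _ _ "(p, b, c)"]) (cases p; simp add: bc)+
      then show "t \<in> {x \<in> carrier K. tprod K p x s \<in> ?W}" using SPW t Sc by blast
    qed
    ultimately have "?U \<subseteq> {x \<in> carrier K. tprod K p x s \<in> ?W}" by (rule K.span_least)
    then show ?thesis using x by blast
  qed
  have prod: "tprod K p x y \<in> ?W" if x: "x \<in> ?U" and y: "y \<in> ?U" for p x y
  proof -
    have xc: "x \<in> carrier K" using x u(1) by blast
    have "subspace k {y \<in> carrier K. tprod K p x y \<in> ?W} K"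
      by (rule K.subspaceI)
        (use xc w(2-) in \<open>auto simp: K.tprod_add_right K.tprod_smult_right K.tprod_zero\<close>)
    moreover have "?S \<subseteq> {y \<in> carrier K. tprod K p x y \<in> ?W}"
      using 1[OF _ x] Sc by blast
    ultimately have "?U \<subseteq> {y \<in> carrier K. tprod K p x y \<in> ?W}" by (rule K.span_least)
    then show ?thesis using y by blast
  qed
  have gen: "?W = carrier K"
    by (rule defining_pair_generated[OF L K q(1) _ W qW UW qU prod]) (use q(3) M in auto)
  have fin: "finite (?S \<union> ?P)" using B(1) by simp
  have "card (?S \<union> ?P) \<le> card ?S + card ?P" by (rule card_Un_le)
  also have "\<dots> \<le> card B + card ?I"
    using B(1) by (intro add_mono card_image_le) auto
  finally have "card (?S \<union> ?P) \<le> card B + card ?I" .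
  moreover have "K.fin_dim"
    unfolding K.fin_dim_def using fin SP gen by (intro exI[of _ "?S \<union> ?P"] conjI)
  ultimately show ?thesis
    using K.gen_ge_dim[OF fin SP gen] by linarith
qed

lemma cover_exists:
  fixes L :: "('k, 'a) trias"
  assumes L: "triassociative k L" and fd: "vectorspace.fin_dim k L"
  shows "\<exists>(K :: ('k, ('k, 'a) tterm) trias) M. cover k L K M"
proof -
  interpret L: triassociative k L by fact
  obtain B where B: "finite B" "B \<subseteq> carrier L" "L.span B = carrier L"
    using fd unfolding L.fin_dim_def by blast
  have "trias_ideal k L {\<zero>\<^bsub>L\<^esub>}"
    unfolding trias_ideal_def by (intro conjI L.subspaceI) (auto simp: L.tprod_zero)
  moreover have "(\<lambda>x. x) \<in> trias_hom k L L" by (rule trias_homI) auto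
  moreover have "a_kernel L L (\<lambda>x. x) = {\<zero>\<^bsub>L\<^esub>}" by (auto simp: a_kernel_def kernel_def)
  moreover have "\<zero>\<^bsub>L\<^esub> \<in> center L \<inter> derived k L"
    using subspaceD(2)[OF L.derived_subspace] by (simp add: center_def L.tprod_zero)
  ultimately have def: "defining_pair k L L {\<zero>\<^bsub>L\<^esub>}"
    unfolding defining_pair_iff[OF L] using L by (intro conjI bexI[of _ "\<lambda>x. x"]) auto
  let ?Gen = "Gen :: 'a \<Rightarrow> ('k, 'a) tterm"
  define P where "P n \<longleftrightarrow> (\<exists>(K :: ('k, ('k, 'a) tterm) trias) M.
    defining_pair k L K M \<and> vectorspace.dim k K = n)" for n
  let ?N = "card B + card ({Vdash, Dashv, Perp} \<times> B \<times> B)"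
  have "defining_pair k L (trias_copy ?Gen L) (?Gen ` {\<zero>\<^bsub>L\<^esub>})"
    by (rule trias_copy_defining_pair[OF L def]) (simp add: inj_on_def)
  then have "P (vectorspace.dim k (trias_copy ?Gen L))" unfolding P_def by blast
  then have ex: "\<exists>n. P n" by blast
  have bound: "n \<le> ?N" if n: "P n" for n
  proof -
    obtain K :: "('k, ('k, 'a) tterm) trias" and M
      where "defining_pair k L K M" "vectorspace.dim k K = n"
      using n unfolding P_def by blast
    then show ?thesis using defining_pair_bound[OF L _ B, of K M] by simp
  qed
  define n where "n = Greatest P"
  have "P n" unfolding n_def using ex bound by (rule GreatestI_ex_nat)
  have le: "m \<le> n" if "P m" for m
    unfolding n_def using that bound by (rule Greatest_le_nat)
  from \<open>P n\<close> obtain K :: "('k, ('k, 'a) tterm) trias" and M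
    where K: "defining_pair k L K M" "vectorspace.dim k K = n"
    unfolding P_def by blast
  have "cover k L K M"
    unfolding cover_def
  proof (intro conjI allI impI)
    show "vectorspace.fin_dim k K" using defining_pair_bound[OF L K(1) B] by simp
    fix K' :: "('k, ('k, 'a) tterm) trias" and M'
    assume K': "defining_pair k L K' M'"
    show "vectorspace.fin_dim k K'" using defining_pair_bound[OF L K' B] by simp
    have "P (vectorspace.dim k K')" using K' unfolding P_def by blast
    then show "vectorspace.dim k K' \<le> vectorspace.dim k K" using le K(2) by simp
  qed (rule K(1))
  then show ?thesis by blast
qed

end

theory Submission
  imports Defs
begin

text \<open>Write \<open>[F, R] = F \<lozenge> R + R \<lozenge> F\<close>. Since \<open>Z\<close> is central, \<open>[F, T] \<subseteq> R \<inter> F'\<close>, and conditions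
  (1), (2) and (4) all say that \<open>[F, T] = [F, R]\<close>. For (2) this is the computation of the kernel
  of \<open>\<beta>\<close>. For (4), freeness gives a map from \<open>F / [F, R]\<close> to every central extension of \<open>L\<close>, so
  \<open>Z\<^sup>*(L)\<close> is the image of the center of \<open>F / [F, R]\<close>. For (1), a cocycle is the same as a
  central extension of \<open>L\<close> by the ground field, which is handled as in (4); conversely, a linear form on \<open>F\<close>
  that kills \<open>[F, R]\<close> but not \<open>[F, T]\<close> produces, with a linear section of \<open>\<pi>\<close>, a cocycle
  that does not vanish on \<open>L \<times> Z\<close> and \<open>Z \<times> L\<close>.

  For (3), the multiplier of a cover is isomorphic to \<open>(R \<inter> F') / [F, R]\<close>, and the sequence
  \<open>M(L) \<rightarrow> M(L/Z) \<rightarrow> L' \<inter> Z \<rightarrow> 0\<close> is exact. Hence \<open>M(L)\<close> always maps onto the quotient of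
  \<open>M(L/Z)\<close> by a copy of \<open>L' \<inter> Z\<close>, and by finite dimension the two are isomorphic only if \<open>\<beta>\<close> is
  injective.\<close>

section \<open>Quotients, complements, linear forms and dimension for spaces that may be
  infinite-dimensional\<close>

section \<open>Linear algebra\<close>

text \<open>A free algebra on a non-empty set is infinite-dimensional, so complements and linear
  forms on \<open>F\<close> do not come from finite bases; Zorn's lemma supplies them in
  \<open>relative_complement\<close>. As \<open>R\<close> lies in \<open>T\<close>, the bracket of
  \<open>R\<close> always lies in that of \<open>T\<close>, and each condition is compared with the
  single inclusion \<open>bracket k F T \<subseteq> bracket k F R\<close>. Modulo the bracket of
  \<open>R\<close>, a product in \<open>F\<close> depends only on the images of its factors in
  \<open>L\<close>. This is why central extensions and cocycles, which see only \<open>L\<close>,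
  can detect the inclusion.

  Condition (3) is the delicate one. A cover is characterised by its maximal dimension, so its
  multiplier is linked to \<open>hopf k F R\<close> only by comparing dimensions, and both the
  identification \<open>\<theta>\<close> and the splitting \<open>s\<close> are arbitrary. The
  argument therefore treats every choice of them at once. It also needs \<open>hopf k F R\<close> to
  be finite-dimensional, which its definition does not show and which is derived from the maximality
  of the cover.\<close>

definition trias_of ::
  "('k, 'a, 'm) module_scheme \<Rightarrow> (tri \<Rightarrow> 'a \<Rightarrow> 'a \<Rightarrow> 'a) \<Rightarrow> ('k, 'a) trias"
  where "trias_of V t = \<lparr>carrier = carrier V, mult = mult V, one = one V, zero = zero V,
    add = add V, smult = smult V, tprod = t\<rparr>"

lemma trias_of_simps [simp]:
  "carrier (trias_of V t) = carrier V" "zero (trias_of V t) = zero V"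
  "add (trias_of V t) = add V" "smult (trias_of V t) = smult V" "tprod (trias_of V t) = t"
  by (simp_all add: trias_of_def)

text \<open>The two records agree in all fields, but they have different types, so the module axioms
  are unfolded down to the operations.\<close>

lemma module_trias_of: "module k (trias_of V t) \<longleftrightarrow> module k V"
  by (simp add: module_def module_axioms_def abelian_group_def abelian_monoid_def
      abelian_group_axioms_def comm_group_def group_def group_axioms_def comm_monoid_def
      comm_monoid_axioms_def monoid_def Units_def)

lemma vectorspace_trias_of: "vectorspace k (trias_of V t) \<longleftrightarrow> vectorspace k V"
  by (simp add: vectorspace_def module_trias_of)

lemma vs_subspaceI:
  assumes "vectorspace k V" "W \<subseteq> carrier V" "\<zero>\<^bsub>V\<^esub> \<in> W"
    "\<And>v w. v \<in> W \<Longrightarrow> w \<in> W \<Longrightarrow> v \<oplus>\<^bsub>V\<^esub> w \<in> W"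
    "\<And>c v. c \<in> carrier k \<Longrightarrow> v \<in> W \<Longrightarrow> c \<odot>\<^bsub>V\<^esub> v \<in> W"
  shows "subspace k W V"
  using assms by (simp add: subspace_def submodule_def vectorspace_def)

text \<open>Vector space quotients are not built a second time: all facts are read off from the
  quotient of an algebra by an ideal.\<close>

lemma vs_quot:
  assumes V: "vectorspace k V" and W: "subspace k W V"
  shows "vectorspace k (vs_quot V W)"
    and "carrier (vs_quot V W) = (\<lambda>x. W +>\<^bsub>V\<^esub> x) ` carrier V"
    and "\<zero>\<^bsub>vs_quot V W\<^esub> = W"
    and "\<lbrakk>x \<in> carrier V; y \<in> carrier V\<rbrakk>
      \<Longrightarrow> (W +>\<^bsub>V\<^esub> x) \<oplus>\<^bsub>vs_quot V W\<^esub> (W +>\<^bsub>V\<^esub> y) = W +>\<^bsub>V\<^esub> (x \<oplus>\<^bsub>V\<^esub> y)"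
    and "\<lbrakk>c \<in> carrier k; x \<in> carrier V\<rbrakk>
      \<Longrightarrow> c \<odot>\<^bsub>vs_quot V W\<^esub> (W +>\<^bsub>V\<^esub> x) = W +>\<^bsub>V\<^esub> (c \<odot>\<^bsub>V\<^esub> x)"
    and "\<lbrakk>x \<in> carrier V; y \<in> carrier V\<rbrakk>
      \<Longrightarrow> W +>\<^bsub>V\<^esub> x = W +>\<^bsub>V\<^esub> y \<longleftrightarrow> x \<ominus>\<^bsub>V\<^esub> y \<in> W"
    and "x \<in> carrier V \<Longrightarrow> x \<in> W +>\<^bsub>V\<^esub> x"
proof -
  interpret V: vectorspace k V by fact
  note w = subspaceD[OF W]
  \<comment> \<open>With zero products every subspace is an ideal.\<close>
  let ?V = "trias_of V (\<lambda>_ _ _. \<zero>\<^bsub>V\<^esub>)"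
  have V': "vectorspace k ?V" by (simp add: vectorspace_trias_of V)
  have T: "triassociative k ?V"
    by (intro triassociative.intro V' triassociative_axioms.intro) auto
  have I: "trias_ideal k ?V W"
    unfolding trias_ideal_def using w by (auto intro!: vs_subspaceI[OF V'])
  have cos: "W +>\<^bsub>?V\<^esub> x = W +>\<^bsub>V\<^esub> x" for x by (simp add: a_r_coset_def')
  \<comment> \<open>The algebra quotient is the vector space quotient with a product attached, so
    its facts can be transported field by field.\<close>
  have Q: "trias_quot ?V W = trias_of (vs_quot V W) (tprod (trias_quot ?V W))"
    by (simp add: trias_quot_def vs_quot_def trias_of_def A_RCOSETS_def' a_r_coset_def'
        set_add_def' fun_eq_iff)
  have F: "carrier (vs_quot V W) = carrier (trias_quot ?V W)"
    "\<zero>\<^bsub>vs_quot V W\<^esub> = \<zero>\<^bsub>trias_quot ?V W\<^esub>"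
    "add (vs_quot V W) = add (trias_quot ?V W)"
    "smult (vs_quot V W) = smult (trias_quot ?V W)"
    by (subst Q; simp)+
  note S = triassociative.trias_quot_simps[OF T I, unfolded cos, folded F]
  have "vectorspace k (trias_of (vs_quot V W) (tprod (trias_quot ?V W)))"
    using trias_quot_triassociative[OF T I] unfolding Q[symmetric] triassociative_def by blast
  then show "vectorspace k (vs_quot V W)" by (simp add: vectorspace_trias_of)
  show "carrier (vs_quot V W) = (\<lambda>x. W +>\<^bsub>V\<^esub> x) ` carrier V" using S(1) by simp
  show "\<zero>\<^bsub>vs_quot V W\<^esub> = W" by (rule S(2))
  show "(W +>\<^bsub>V\<^esub> x) \<oplus>\<^bsub>vs_quot V W\<^esub> (W +>\<^bsub>V\<^esub> y) = W +>\<^bsub>V\<^esub> (x \<oplus>\<^bsub>V\<^esub> y)"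
    if "x \<in> carrier V" "y \<in> carrier V" using S(3)[of x y] that by simp
  show "c \<odot>\<^bsub>vs_quot V W\<^esub> (W +>\<^bsub>V\<^esub> x) = W +>\<^bsub>V\<^esub> (c \<odot>\<^bsub>V\<^esub> x)"
    if "c \<in> carrier k" "x \<in> carrier V" using S(4)[of c x] that by simp
  show "W +>\<^bsub>V\<^esub> x = W +>\<^bsub>V\<^esub> y \<longleftrightarrow> x \<ominus>\<^bsub>V\<^esub> y \<in> W" if "x \<in> carrier V" "y \<in> carrier V"
  proof -
    \<comment> \<open>Negation is not a field of the record but is defined from addition, so its
      agreement in both records is a separate fact.\<close>
    have "\<ominus>\<^bsub>?V\<^esub> y = \<ominus>\<^bsub>V\<^esub> y" by (simp add: a_inv_def m_inv_def)
    then show ?thesis using S(6)[of x y] that by (simp add: a_minus_def)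
  qed
  show "x \<in> W +>\<^bsub>V\<^esub> x" if "x \<in> carrier V" using S(7)[of x] that by simp
qed

lemma linear_mapI:
  "\<lbrakk>vectorspace k V; vectorspace k W; f \<in> module_hom k V W\<rbrakk> \<Longrightarrow> linear_map k V W f"
  by (simp add: linear_map_def mod_hom_def mod_hom_axioms_def vectorspace_def)

lemma module_homD:
  assumes "f \<in> module_hom k V W"
  shows "x \<in> carrier V \<Longrightarrow> f x \<in> carrier W"
    and "x \<in> carrier V \<Longrightarrow> y \<in> carrier V \<Longrightarrow> f (x \<oplus>\<^bsub>V\<^esub> y) = f x \<oplus>\<^bsub>W\<^esub> f y"
    and "c \<in> carrier k \<Longrightarrow> x \<in> carrier V \<Longrightarrow> f (c \<odot>\<^bsub>V\<^esub> x) = c \<odot>\<^bsub>W\<^esub> f x"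
  using assms by (auto simp: module_hom_def)

lemma module_homI:
  assumes "\<And>x. x \<in> carrier V \<Longrightarrow> f x \<in> carrier W"
    and "\<And>x y. x \<in> carrier V \<Longrightarrow> y \<in> carrier V \<Longrightarrow> f (x \<oplus>\<^bsub>V\<^esub> y) = f x \<oplus>\<^bsub>W\<^esub> f y"
    and "\<And>c x. c \<in> carrier k \<Longrightarrow> x \<in> carrier V \<Longrightarrow> f (c \<odot>\<^bsub>V\<^esub> x) = c \<odot>\<^bsub>W\<^esub> f x"
  shows "f \<in> module_hom k V W"
  using assms by (auto simp: module_hom_def)

lemma module_hom_comp:
  "f \<in> module_hom k U V \<Longrightarrow> g \<in> module_hom k V W \<Longrightarrow> (\<lambda>x. g (f x)) \<in> module_hom k U W"
  by (auto simp: module_hom_def Pi_iff)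

lemma module_hom_eq_iff:
  assumes V: "vectorspace k V" and W: "vectorspace k W" and f: "f \<in> module_hom k V W"
    and x: "x \<in> carrier V" "y \<in> carrier V"
  shows "f x = f y \<longleftrightarrow> f (x \<ominus>\<^bsub>V\<^esub> y) = \<zero>\<^bsub>W\<^esub>"
proof -
  interpret W: vectorspace k W by fact
  interpret linear_map k V W f by (rule linear_mapI[OF V W f])
  have "f x = (f x \<ominus>\<^bsub>W\<^esub> f y) \<oplus>\<^bsub>W\<^esub> f y"
    using x by (simp add: a_minus_def W.M.a_assoc W.M.l_neg)
  then have "f x = f y" if "f x \<ominus>\<^bsub>W\<^esub> f y = \<zero>\<^bsub>W\<^esub>"
    using x by (simp add: that)
  moreover have "f y \<ominus>\<^bsub>W\<^esub> f y = \<zero>\<^bsub>W\<^esub>" using x by (simp add: a_minus_def W.M.r_neg)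
  ultimately show ?thesis using x by auto
qed

lemma vs_quot_proj:
  assumes V: "vectorspace k V" and W: "subspace k W V"
  shows "(\<lambda>x. W +>\<^bsub>V\<^esub> x) \<in> module_hom k V (vs_quot V W)"
  by (rule module_homI) (auto simp: vs_quot[OF V W])

text \<open>The image of a coset is a singleton, which is what gives \<open>the_elem\<close> a
  meaning in \<open>delta\<close>, \<open>nat_surj\<close> and every induced map below.\<close>

lemma quot_image:
  assumes V: "vectorspace k V" and W: "vectorspace k W" and A: "subspace k A V"
    and f: "f \<in> module_hom k V W" and A0: "\<And>a. a \<in> A \<Longrightarrow> f a = \<zero>\<^bsub>W\<^esub>" and x: "x \<in> carrier V"
  shows "f ` (A +>\<^bsub>V\<^esub> x) = {f x}"
proof -
  interpret linear_map k V W f by (rule linear_mapI[OF V W f])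
  have "f (a \<oplus>\<^bsub>V\<^esub> x) = f x" if "a \<in> A" for a
    using that x subspaceD(1)[OF A] A0[OF that] by (simp add: subset_iff)
  moreover have "x \<in> A +>\<^bsub>V\<^esub> x" by (rule vs_quot(7)[OF V A x])
  ultimately show ?thesis by (auto simp: a_r_coset_def')
qed

lemma quot_lift:
  assumes V: "vectorspace k V" and W: "vectorspace k W" and A: "subspace k A V"
    and f: "f \<in> module_hom k V W" and A0: "\<And>a. a \<in> A \<Longrightarrow> f a = \<zero>\<^bsub>W\<^esub>"
  shows "(\<lambda>C. the_elem (f ` C)) \<in> module_hom k (vs_quot V A) W"
    and "x \<in> carrier V \<Longrightarrow> the_elem (f ` (A +>\<^bsub>V\<^esub> x)) = f x"
proof -
  interpret V: vectorspace k V by fact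
  have *: "the_elem (f ` (A +>\<^bsub>V\<^esub> x)) = f x" if "x \<in> carrier V" for x
    using quot_image[OF V W A f A0 that] by simp
  then show "x \<in> carrier V \<Longrightarrow> the_elem (f ` (A +>\<^bsub>V\<^esub> x)) = f x" .
  show "(\<lambda>C. the_elem (f ` C)) \<in> module_hom k (vs_quot V A) W"
    by (rule module_homI) (auto simp: vs_quot[OF V A] * module_homD[OF f])
qed

text \<open>Zorn's lemma for the subspaces between \<open>A\<close> and \<open>U\<close> that meet
  \<open>D\<close> only inside \<open>A\<close>. With \<open>A\<close> zero and \<open>U\<close> the
  whole space it yields an ordinary complement of \<open>D\<close>; the relative form is needed for
  linear forms vanishing on \<open>A\<close> and for the defining pair built from
  \<open>F\<close>.\<close>

lemma relative_complement:
  assumes V: "vectorspace k V" and A: "subspace k A V" and D: "subspace k D V"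
    and U: "subspace k U V" and AU: "A \<subseteq> U"
  obtains S where "subspace k S V" "A \<subseteq> S" "S \<subseteq> U" "S \<inter> D \<subseteq> A"
    "\<And>u. u \<in> U \<Longrightarrow> \<exists>s\<in>S. \<exists>d\<in>D. u = s \<oplus>\<^bsub>V\<^esub> d"
proof -
  interpret vectorspace k V by fact
  define \<A> where "\<A> = {S. subspace k S V \<and> A \<subseteq> S \<and> S \<subseteq> U \<and> S \<inter> D \<subseteq> A}"
  have "\<exists>M\<in>\<A>. \<forall>X\<in>\<A>. M \<subseteq> X \<longrightarrow> X = M"
  proof (rule subset_Zorn_nonempty)
    show "\<A> \<noteq> {}" using A AU by (auto simp: \<A>_def)
    fix C assume C: "C \<noteq> {}" "subset.chain \<A> C"
    have sub: "subspace k S V" if "S \<in> C" for S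
      using C(2) that by (auto simp: subset.chain_def \<A>_def)
    have "subspace k (\<Union>C) V"
    proof (rule vs_subspaceI[OF V])
      show "\<Union>C \<subseteq> carrier V" using sub subspaceD(1) by blast
      show "\<zero>\<^bsub>V\<^esub> \<in> \<Union>C" using sub subspaceD(2) C(1) by blast
      fix v w assume "v \<in> \<Union>C" "w \<in> \<Union>C"
      then obtain S S' where S: "S \<in> C" "v \<in> S" "S' \<in> C" "w \<in> S'" by blast
      then have "S \<subseteq> S' \<or> S' \<subseteq> S" using subset.chain_total[OF C(2)] by blast
      then have "v \<oplus>\<^bsub>V\<^esub> w \<in> S \<or> v \<oplus>\<^bsub>V\<^esub> w \<in> S'"
        using S subspaceD(3)[OF sub] by blast
      then show "v \<oplus>\<^bsub>V\<^esub> w \<in> \<Union>C" using S by blast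
    next
      fix c v assume "c \<in> carrier k" "v \<in> \<Union>C"
      then show "c \<odot>\<^bsub>V\<^esub> v \<in> \<Union>C" using subspaceD(4)[OF sub] by blast
    qed
    moreover have m: "A \<subseteq> S \<and> S \<subseteq> U \<and> S \<inter> D \<subseteq> A" if "S \<in> C" for S
      using C(2) that by (auto simp: subset.chain_def \<A>_def)
    moreover obtain S where "S \<in> C" using C(1) by blast
    then have "A \<subseteq> \<Union>C" using m by blast
    moreover have "\<Union>C \<subseteq> U" "\<Union>C \<inter> D \<subseteq> A" using m by blast+
    ultimately show "\<Union>C \<in> \<A>" by (simp add: \<A>_def)
  qed
  then obtain S where "S \<in> \<A>" and m: "\<forall>X\<in>\<A>. S \<subseteq> X \<longrightarrow> X = S" by blast
  then have S: "subspace k S V" "A \<subseteq> S" "S \<subseteq> U" "S \<inter> D \<subseteq> A" by (auto simp: \<A>_def)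
  have max: "X = S" if X: "subspace k X V" "S \<subseteq> X" "X \<subseteq> U" "X \<inter> D \<subseteq> A" for X
  proof -
    have "A \<subseteq> X" using S(2) X(2) by (rule subset_trans)
    then have "X \<in> \<A>" using X by (simp add: \<A>_def)
    then show ?thesis using m X(2) by simp
  qed
  note s = subspaceD[OF S(1)] and d = subspaceD[OF D] and u = subspaceD[OF U]
  have "\<exists>s\<in>S. \<exists>d\<in>D. x = s \<oplus>\<^bsub>V\<^esub> d" if x: "x \<in> U" for x
  proof (rule ccontr)
    assume no: "\<not> ?thesis"
    have xc: "x \<in> carrier V" using x u(1) by blast
    \<comment> \<open>If \<open>x\<close> cannot be decomposed, \<open>S\<close> enlarged by the
      line through \<open>x\<close> is a proper competitor, so by maximality it must meet
      \<open>D\<close> outside \<open>A\<close>.\<close>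
    define X where "X = {y \<oplus>\<^bsub>V\<^esub> c \<odot>\<^bsub>V\<^esub> x |y c. y \<in> S \<and> c \<in> carrier k}"
    have SX: "S \<subseteq> X"
    proof
      fix y assume "y \<in> S"
      moreover from this have "y = y \<oplus>\<^bsub>V\<^esub> \<zero>\<^bsub>k\<^esub> \<odot>\<^bsub>V\<^esub> x" using s(1) xc by auto
      ultimately show "y \<in> X" unfolding X_def by blast
    qed
    have "x = \<zero>\<^bsub>V\<^esub> \<oplus>\<^bsub>V\<^esub> \<one>\<^bsub>k\<^esub> \<odot>\<^bsub>V\<^esub> x" using xc by simp
    then have xX: "x \<in> X" unfolding X_def using s(2) by blast
    have X: "subspace k X V"
    proof (rule vs_subspaceI[OF V])
      show "X \<subseteq> carrier V" using s(1) xc by (auto simp: X_def)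
      show "\<zero>\<^bsub>V\<^esub> \<in> X" using SX s(2) by blast
    next
      fix v w assume "v \<in> X" "w \<in> X"
      then obtain y a z b where yz: "y \<in> S" "z \<in> S" "a \<in> carrier k" "b \<in> carrier k"
        and vw: "v = y \<oplus>\<^bsub>V\<^esub> a \<odot>\<^bsub>V\<^esub> x" "w = z \<oplus>\<^bsub>V\<^esub> b \<odot>\<^bsub>V\<^esub> x" by (auto simp: X_def)
      have c: "y \<in> carrier V" "z \<in> carrier V" using yz s(1) by auto
      have "v \<oplus>\<^bsub>V\<^esub> w = (y \<oplus>\<^bsub>V\<^esub> z) \<oplus>\<^bsub>V\<^esub> (a \<oplus>\<^bsub>k\<^esub> b) \<odot>\<^bsub>V\<^esub> x"
        using c yz xc by (simp add: vw smult_l_distr module.M.a_ac)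
      then show "v \<oplus>\<^bsub>V\<^esub> w \<in> X" unfolding X_def using yz s(3) by blast
    next
      fix c v assume c: "c \<in> carrier k" and "v \<in> X"
      then obtain y a where y: "y \<in> S" "a \<in> carrier k" "v = y \<oplus>\<^bsub>V\<^esub> a \<odot>\<^bsub>V\<^esub> x"
        by (auto simp: X_def)
      then have "c \<odot>\<^bsub>V\<^esub> v = c \<odot>\<^bsub>V\<^esub> y \<oplus>\<^bsub>V\<^esub> (c \<otimes>\<^bsub>k\<^esub> a) \<odot>\<^bsub>V\<^esub> x"
        using c xc subsetD[OF s(1) y(1)] by (simp add: smult_r_distr smult_assoc1)
      then show "c \<odot>\<^bsub>V\<^esub> v \<in> X" unfolding X_def using y c s(4) by blast
    qed
    have "X \<subseteq> U" using S(3) x u(3,4) by (auto simp: X_def)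
    moreover have "x \<notin> S"
    proof
      assume "x \<in> S"
      moreover have "x = x \<oplus>\<^bsub>V\<^esub> \<zero>\<^bsub>V\<^esub>" using xc by simp
      ultimately show False using no d(2) by blast
    qed
    ultimately have "\<not> X \<inter> D \<subseteq> A" using max[OF X SX] xX by blast
    then obtain y c where y: "y \<in> S" "c \<in> carrier k"
      and yD: "y \<oplus>\<^bsub>V\<^esub> c \<odot>\<^bsub>V\<^esub> x \<in> D" "y \<oplus>\<^bsub>V\<^esub> c \<odot>\<^bsub>V\<^esub> x \<notin> A" unfolding X_def by blast
    have yc: "y \<in> carrier V" using y s(1) by blast
    \<comment> \<open>For \<open>c\<close> zero the element would be \<open>y\<close> itself, in
      \<open>S \<inter> D\<close> and hence in \<open>A\<close>.\<close>
    have "c \<noteq> \<zero>\<^bsub>k\<^esub>" using yD y S(4) yc xc by auto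
    then have ci: "c \<in> Units k" using y by (simp add: field_Units)
    let ?c = "inv\<^bsub>k\<^esub> c"
    have cc: "?c \<in> carrier k" "?c \<otimes>\<^bsub>k\<^esub> c = \<one>\<^bsub>k\<^esub>" using ci by auto
    \<comment> \<open>Solving the element of \<open>D\<close> for \<open>x\<close> exhibits the
      decomposition that was assumed not to exist.\<close>
    have "x = (\<ominus>\<^bsub>k\<^esub> ?c) \<odot>\<^bsub>V\<^esub> y \<oplus>\<^bsub>V\<^esub> ?c \<odot>\<^bsub>V\<^esub> (y \<oplus>\<^bsub>V\<^esub> c \<odot>\<^bsub>V\<^esub> x)"
    proof -
      have "?c \<odot>\<^bsub>V\<^esub> (y \<oplus>\<^bsub>V\<^esub> c \<odot>\<^bsub>V\<^esub> x) = ?c \<odot>\<^bsub>V\<^esub> y \<oplus>\<^bsub>V\<^esub> x"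
        using cc yc xc y by (simp add: smult_r_distr smult_assoc1[symmetric])
      moreover have "(\<ominus>\<^bsub>k\<^esub> ?c) \<odot>\<^bsub>V\<^esub> y = \<ominus>\<^bsub>V\<^esub> (?c \<odot>\<^bsub>V\<^esub> y)"
        using cc yc by (simp add: smult_l_minus)
      ultimately show ?thesis using cc yc xc by (simp add: module.M.r_neg1)
    qed
    moreover have "(\<ominus>\<^bsub>k\<^esub> ?c) \<odot>\<^bsub>V\<^esub> y \<in> S" "?c \<odot>\<^bsub>V\<^esub> (y \<oplus>\<^bsub>V\<^esub> c \<odot>\<^bsub>V\<^esub> x) \<in> D"
      using cc y yD s(4) d(4) by simp_all
    ultimately show False using no by blast
  qed
  with S that show thesis by blast
qed

lemma zero_subspace: "vectorspace k V \<Longrightarrow> subspace k {\<zero>\<^bsub>V\<^esub>} V"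
proof -
  assume V: "vectorspace k V"
  interpret V: vectorspace k V by fact
  show ?thesis by (rule vs_subspaceI[OF V]) auto
qed

lemma full_subspace: "vectorspace k V \<Longrightarrow> subspace k (carrier V) V"
proof -
  assume V: "vectorspace k V"
  interpret V: vectorspace k V by fact
  show ?thesis by (rule vs_subspaceI[OF V]) auto
qed

lemma kernel_subspace:
  assumes V: "vectorspace k V" and W: "vectorspace k W" and f: "f \<in> module_hom k V W"
  shows "subspace k {x \<in> carrier V. f x = \<zero>\<^bsub>W\<^esub>} V"
proof -
  interpret linear_map k V W f by (rule linear_mapI[OF V W f])
  show ?thesis by (rule vs_subspaceI[OF V]) auto
qed

lemma module_hom_zero:
  assumes V: "vectorspace k V" and W: "vectorspace k W" and f: "f \<in> module_hom k V W"
  shows "f \<zero>\<^bsub>V\<^esub> = \<zero>\<^bsub>W\<^esub>"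
proof -
  interpret linear_map k V W f by (rule linear_mapI[OF V W f])
  show ?thesis by simp
qed

lemma vs_quot_eq_zero:
  assumes V: "vectorspace k V" and W: "subspace k W V" and x: "x \<in> carrier V"
  shows "W +>\<^bsub>V\<^esub> x = W \<longleftrightarrow> x \<in> W"
proof -
  interpret V: vectorspace k V by fact
  have "W +>\<^bsub>V\<^esub> \<zero>\<^bsub>V\<^esub> = W" using module_hom_zero[OF V vs_quot(1)[OF V W] vs_quot_proj[OF V W]]
    by (simp add: vs_quot(3)[OF V W])
  moreover have "\<ominus>\<^bsub>V\<^esub> \<zero>\<^bsub>V\<^esub> = \<zero>\<^bsub>V\<^esub>" by (rule V.M.minus_equality) auto
  then have "x \<ominus>\<^bsub>V\<^esub> \<zero>\<^bsub>V\<^esub> = x" unfolding a_minus_def using x by simp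
  ultimately show ?thesis using vs_quot(6)[OF V W x V.M.zero_closed] by simp
qed

text \<open>A complement of the kernel maps bijectively onto \<open>W\<close>, and the section is
  the inverse of that bijection.\<close>

lemma linear_section:
  assumes V: "vectorspace k V" and W: "vectorspace k W" and f: "f \<in> module_hom k V W"
    and surj: "f ` carrier V = carrier W"
  obtains s where "s \<in> module_hom k W V" "\<And>w. w \<in> carrier W \<Longrightarrow> f (s w) = w"
proof -
  interpret VS: vectorspace k V by fact
  interpret WS: vectorspace k W by fact
  interpret linear_map k V W f by (rule linear_mapI[OF V W f])
  let ?K = "{x \<in> carrier V. f x = \<zero>\<^bsub>W\<^esub>}"
  obtain S where S: "subspace k S V" "S \<inter> ?K \<subseteq> {\<zero>\<^bsub>V\<^esub>}"
    and dec: "\<And>u. u \<in> carrier V \<Longrightarrow> \<exists>s\<in>S. \<exists>d\<in>?K. u = s \<oplus>\<^bsub>V\<^esub> d"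
    by (rule relative_complement[OF V zero_subspace[OF V] kernel_subspace[OF V W f]
          full_subspace[OF V]]) auto
  note sD = subspaceD[OF S(1)]
  have ex: "\<exists>s\<in>S. f s = w" if w: "w \<in> carrier W" for w
  proof -
    obtain v where v: "v \<in> carrier V" "w = f v" using surj w by blast
    obtain s d where "s \<in> S" "d \<in> ?K" "v = s \<oplus>\<^bsub>V\<^esub> d" using dec[OF v(1)] by blast
    then have "f s = w" using v sD(1) by auto
    then show ?thesis using \<open>s \<in> S\<close> by blast
  qed
  have inj: "s = t" if st: "s \<in> S" "t \<in> S" "f s = f t" for s t
  proof -
    have c: "s \<in> carrier V" "t \<in> carrier V" using st sD(1) by auto
    have "\<ominus>\<^bsub>V\<^esub> t = (\<ominus>\<^bsub>k\<^esub> \<one>\<^bsub>k\<^esub>) \<odot>\<^bsub>V\<^esub> t" using c VS.smult_minus_1 by simp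
    then have "s \<ominus>\<^bsub>V\<^esub> t \<in> S" using st sD(3,4) by (simp add: a_minus_def)
    moreover have "f (s \<ominus>\<^bsub>V\<^esub> t) = \<zero>\<^bsub>W\<^esub>" using module_hom_eq_iff[OF V W f c] st by simp
    ultimately have 0: "s \<ominus>\<^bsub>V\<^esub> t = \<zero>\<^bsub>V\<^esub>" using S(2) c by auto
    have "(s \<ominus>\<^bsub>V\<^esub> t) \<oplus>\<^bsub>V\<^esub> t = s" using c by (simp add: a_minus_def VS.M.a_assoc VS.M.l_neg)
    then show ?thesis using c by (simp add: 0)
  qed
  define s where "s w = (SOME s. s \<in> S \<and> f s = w)" for w
  have s: "s w \<in> S" "f (s w) = w" if "w \<in> carrier W" for w
    using someI_ex[of "\<lambda>s. s \<in> S \<and> f s = w"] ex[OF that] by (auto simp: s_def)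
  have sc: "s w \<in> carrier V" if "w \<in> carrier W" for w using s(1)[OF that] sD(1) by blast
  \<comment> \<open>The two sides of each linearity equation lie in \<open>S\<close> and have the
    same image, so injectivity on \<open>S\<close> identifies them.\<close>
  have "s \<in> module_hom k W V"
  proof (rule module_homI)
    show "s x \<in> carrier V" if "x \<in> carrier W" for x using sc[OF that] .
    show "s (x \<oplus>\<^bsub>W\<^esub> y) = s x \<oplus>\<^bsub>V\<^esub> s y" if "x \<in> carrier W" "y \<in> carrier W" for x y
      by (rule inj) (use that s sc sD(3) in auto)
    show "s (c \<odot>\<^bsub>W\<^esub> x) = c \<odot>\<^bsub>V\<^esub> s x" if "c \<in> carrier k" "x \<in> carrier W" for c x
      by (rule inj) (use that s sc sD(4) in auto)
  qed
  then show thesis using s(2) that by blast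
qed

lemma self_module_vectorspace:
  assumes "field k" shows "vectorspace k (self_module k)"
proof -
  interpret field k by fact
  have "module k (self_module k)"
  proof (rule moduleI)
    show "abelian_group (self_module k)"
    proof (rule abelian_groupI)
      fix x assume "x \<in> carrier (self_module k)"
      then have "\<ominus>\<^bsub>k\<^esub> x \<in> carrier (self_module k)" "\<ominus>\<^bsub>k\<^esub> x \<oplus>\<^bsub>self_module k\<^esub> x = \<zero>\<^bsub>self_module k\<^esub>"
        by (auto simp: self_module_def l_neg)
      then show "\<exists>y\<in>carrier (self_module k). y \<oplus>\<^bsub>self_module k\<^esub> x = \<zero>\<^bsub>self_module k\<^esub>" by blast
    qed (auto simp: self_module_def a_ac)
  qed (auto simp: self_module_def l_distr r_distr m_assoc is_cring)
  then show ?thesis by (intro vectorspace.intro assms)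
qed

text \<open>Take \<open>S\<close> containing \<open>A\<close> such that \<open>S\<close> and the
  line through \<open>t\<close> together span \<open>V\<close> and meet only inside
  \<open>A\<close>. Then \<open>V / S\<close> is a line spanned by the class of \<open>t\<close>,
  and a coordinate on this line is the required form.\<close>

lemma separating_functional:
  assumes V: "vectorspace k V" and A: "subspace k A V" and t: "t \<in> carrier V" "t \<notin> A"
  obtains \<mu> where "\<mu> \<in> module_hom k V (self_module k)" "\<And>a. a \<in> A \<Longrightarrow> \<mu> a = \<zero>\<^bsub>k\<^esub>" "\<mu> t \<noteq> \<zero>\<^bsub>k\<^esub>"
proof -
  interpret V: vectorspace k V by fact
  let ?k = "self_module k"
  have K: "vectorspace k ?k" by (rule self_module_vectorspace[OF V.field_axioms])
  have kt: "(\<lambda>c. c \<odot>\<^bsub>V\<^esub> t) \<in> module_hom k ?k V"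
    by (rule module_homI) (use t in \<open>auto simp: self_module_def V.smult_l_distr V.smult_assoc1\<close>)
  let ?D = "(\<lambda>c. c \<odot>\<^bsub>V\<^esub> t) ` carrier k"
  have D: "subspace k ?D V"
  proof -
    interpret l: linear_map k ?k V "\<lambda>c. c \<odot>\<^bsub>V\<^esub> t" by (rule linear_mapI[OF K V kt])
    show ?thesis using l.imT_is_subspace by (simp only: l.im_def) (simp add: self_module_def)
  qed
  obtain S where S: "subspace k S V" "A \<subseteq> S" "S \<inter> ?D \<subseteq> A"
    and dec: "\<And>u. u \<in> carrier V \<Longrightarrow> \<exists>s\<in>S. \<exists>d\<in>?D. u = s \<oplus>\<^bsub>V\<^esub> d"
    by (rule relative_complement[OF V A D full_subspace[OF V] subspaceD(1)[OF A]], rule that)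
  note P = vs_quot[OF V S(1)]
  let ?P = "vs_quot V S"
  interpret P: vectorspace k ?P by (rule P(1))
  note p = vs_quot_proj[OF V S(1)]
  have S0: "S +>\<^bsub>V\<^esub> x = S \<longleftrightarrow> x \<in> S" if "x \<in> carrier V" for x
    by (rule vs_quot_eq_zero[OF V S(1) that])
  have h: "(\<lambda>c. S +>\<^bsub>V\<^esub> (c \<odot>\<^bsub>V\<^esub> t)) \<in> module_hom k ?k ?P" (is "?h \<in> _")
    by (rule module_hom_comp[OF kt p])
  have surj: "?h ` carrier ?k = carrier ?P"
  proof
    show "?h ` carrier ?k \<subseteq> carrier ?P" using module_homD(1)[OF h] by blast
    show "carrier ?P \<subseteq> ?h ` carrier ?k"
    proof
      fix X assume "X \<in> carrier ?P"
      then obtain x where x: "x \<in> carrier V" "X = S +>\<^bsub>V\<^esub> x" by (auto simp: P(2))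
      obtain s c where s: "s \<in> S" "c \<in> carrier k" "x = s \<oplus>\<^bsub>V\<^esub> c \<odot>\<^bsub>V\<^esub> t" using dec[OF x(1)] by blast
      have sc: "s \<in> carrier V" using s subspaceD(1)[OF S(1)] by blast
      have "X = (S +>\<^bsub>V\<^esub> s) \<oplus>\<^bsub>?P\<^esub> ?h c" using s sc t x by (simp add: P(4))
      also have "S +>\<^bsub>V\<^esub> s = \<zero>\<^bsub>?P\<^esub>" using s sc S0 by (simp add: P(3))
      also have "\<dots> \<oplus>\<^bsub>?P\<^esub> ?h c = ?h c"
        using s module_homD(1)[OF h, of c] by (simp add: self_module_def)
      finally show "X \<in> ?h ` carrier ?k" using s by (auto simp: self_module_def)
    qed
  qed
  \<comment> \<open>The coordinate on \<open>V / S\<close> is a section of \<open>?h\<close>: since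
    \<open>?h\<close> recovers each coset from its coordinate, a non-zero coset has a non-zero
    coordinate.\<close>
  obtain s where s: "s \<in> module_hom k ?P ?k" "\<And>w. w \<in> carrier ?P \<Longrightarrow> ?h (s w) = w"
    by (rule linear_section[OF K P(1) h surj], rule that)
  let ?m = "\<lambda>x. s (S +>\<^bsub>V\<^esub> x)"
  have s0: "s S = \<zero>\<^bsub>k\<^esub>"
    using module_hom_zero[OF P(1) K s(1)] by (simp add: P(3) self_module_def)
  \<comment> \<open>\<open>S\<close> meets the line through \<open>t\<close> only inside
    \<open>A\<close>, so \<open>t \<notin> A\<close> forces \<open>t \<notin> S\<close>.\<close>
  have "t \<in> ?D" using t by (auto intro!: image_eqI[of _ _ "\<one>\<^bsub>k\<^esub>"])
  then have "t \<notin> S" using S(3) t(2) by blast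
  then have "S +>\<^bsub>V\<^esub> t \<noteq> S" using S0[OF t(1)] by simp
  moreover have "?h (?m t) = S +>\<^bsub>V\<^esub> t" using s(2) t(1) by (auto simp: P(2))
  moreover have "?h \<zero>\<^bsub>k\<^esub> = S" using S0[OF V.M.zero_closed] t subspaceD(2)[OF S(1)] by simp
  ultimately have "?m t \<noteq> \<zero>\<^bsub>k\<^esub>" by auto
  moreover have "?m a = \<zero>\<^bsub>k\<^esub>" if a: "a \<in> A" for a
  proof -
    have "a \<in> S" using a S(2) by blast
    moreover from this have "a \<in> carrier V" using subspaceD(1)[OF S(1)] by blast
    ultimately show ?thesis using S0[of a] s0 by simp
  qed
  ultimately show thesis using module_hom_comp[OF p s(1)] that by blast
qed

lemma inj_on_if_kernel_trivial:
  assumes V: "vectorspace k V" and W: "vectorspace k W" and f: "f \<in> module_hom k V W"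
    and ker: "\<And>x. x \<in> carrier V \<Longrightarrow> f x = \<zero>\<^bsub>W\<^esub> \<Longrightarrow> x = \<zero>\<^bsub>V\<^esub>"
  shows "inj_on f (carrier V)"
proof -
  interpret linear_map k V W f by (rule linear_mapI[OF V W f])
  show ?thesis by (rule Ke0_imp_inj) (use ker in \<open>auto simp: ker_def\<close>)
qed

lemma subspace_vectorspace:
  "vectorspace k V \<Longrightarrow> subspace k W V \<Longrightarrow> vectorspace k (V\<lparr>carrier := W\<rparr>)"
  by (rule vectorspace.subspace_is_vs)

text \<open>A non-zero kernel vector could be exchanged into a basis of \<open>V\<close>; the images
  of the remaining vectors would span \<open>W\<close>, giving it smaller dimension than
  \<open>V\<close>.\<close>

lemma surj_on_le_dim_imp_inj:
  assumes V: "vectorspace k V" and W: "vectorspace k W" and f: "f \<in> module_hom k V W"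
    and surj: "f ` carrier V = carrier W"
    and fd: "vectorspace.fin_dim k V" and le: "vectorspace.dim k V \<le> vectorspace.dim k W"
  shows "inj_on f (carrier V)"
proof (rule inj_on_if_kernel_trivial[OF V W f], rule ccontr)
  fix v assume v: "v \<in> carrier V" "f v = \<zero>\<^bsub>W\<^esub>" "v \<noteq> \<zero>\<^bsub>V\<^esub>"
  interpret VS: vectorspace k V by fact
  interpret WS: vectorspace k W by fact
  interpret linear_map k V W f by (rule linear_mapI[OF V W f])
  obtain B where B: "finite B" "VS.basis B" using VS.finite_basis_exists[OF fd] by blast
  have Bc: "B \<subseteq> carrier V" and Bs: "VS.span B = carrier V" using B(2) by (auto simp: VS.basis_def)
  have "VS.lin_indpt {}" using VS.finite_lin_indpt2[of "{}"] by simp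
  then have li: "VS.lin_indpt {v}"
    using VS.lin_dep_iff_in_span[of "{}" v] v by (simp add: VS.span_empty)
  \<comment> \<open>Steinitz exchange: \<open>v\<close> takes the place of a basis vector, so
    \<open>C\<close> has at most \<open>card B - 1\<close> elements.\<close>
  obtain C where C: "finite C" "C \<subseteq> carrier V" "int (card C) \<le> int (card B) - int (card {v})"
    and span: "VS.span ({v} \<union> C) = VS.span B"
    using VS.replacement[of "{v}" B] B(1) Bc Bs v(1) li by auto
  have fC: "f ` C \<subseteq> carrier W" using C(2) by auto
  have "subspace k {x \<in> carrier V. f x \<in> WS.span (f ` C)} V"
    using subspaceD(2-)[OF WS.span_is_subspace[OF fC]] by (intro vs_subspaceI[OF V]) auto
  moreover have "{v} \<union> C \<subseteq> {x \<in> carrier V. f x \<in> WS.span (f ` C)}"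
    using v C(2) WS.in_own_span[OF fC] subspaceD(2)[OF WS.span_is_subspace[OF fC]] by auto
  ultimately have "VS.span ({v} \<union> C) \<subseteq> {x \<in> carrier V. f x \<in> WS.span (f ` C)}"
    by (intro VS.span_is_subset) (auto simp: subspace_def)
  then have "f ` carrier V \<subseteq> WS.span (f ` C)" unfolding span Bs by auto
  then have "carrier W \<subseteq> WS.span (f ` C)" by (simp only: surj)
  then have "WS.span (f ` C) = carrier W"
    using subspaceD(1)[OF WS.span_is_subspace[OF fC]] by blast
  then have "WS.dim \<le> card (f ` C)" using C(1) fC by (intro WS.gen_ge_dim) auto
  also have "\<dots> \<le> card C" by (rule card_image_le[OF C(1)])
  also have "\<dots> < card B" using C(3) by simp
  also have "card B = VS.dim" using VS.dim_basis[OF B] by simp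
  finally show False using le by simp
qed

section \<open>Linear isomorphisms and the transport of finite dimension\<close>

lemma vs_isosD:
  assumes "h \<in> vs_isos k V W"
  shows "h \<in> module_hom k V W" "h ` carrier V = carrier W" "inj_on h (carrier V)"
  using assms by (auto simp: vs_isos_def bij_betw_def)

lemma vs_isosI:
  "\<lbrakk>h \<in> module_hom k V W; h ` carrier V = carrier W; inj_on h (carrier V)\<rbrakk> \<Longrightarrow> h \<in> vs_isos k V W"
  by (auto simp: vs_isos_def bij_betw_def)

lemma vs_isos_comp:
  assumes "f \<in> vs_isos k U V" "g \<in> vs_isos k V W"
  shows "(\<lambda>x. g (f x)) \<in> vs_isos k U W"
  using assms module_hom_comp[of f k U V g W] bij_betw_trans[of f _ _ g]
  by (auto simp: vs_isos_def comp_def)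

lemma vs_isos_inverse:
  assumes V: "vectorspace k V" and W: "vectorspace k W" and h: "h \<in> vs_isos k V W"
  obtains g where "g \<in> vs_isos k W V" "\<And>x. x \<in> carrier V \<Longrightarrow> g (h x) = x"
    "\<And>w. w \<in> carrier W \<Longrightarrow> h (g w) = w"
proof -
  note h' = vs_isosD[OF h]
  obtain g where g: "g \<in> module_hom k W V" "\<And>w. w \<in> carrier W \<Longrightarrow> h (g w) = w"
    by (rule linear_section[OF V W h'(1,2)], rule that)
  have gh: "g (h x) = x" if "x \<in> carrier V" for x
    using that h'(3) g module_homD(1)[OF h'(1)] module_homD(1)[OF g(1)] by (auto dest: inj_onD)
  have "g \<in> vs_isos k W V"
  proof (rule vs_isosI[OF g(1)])
    show "inj_on g (carrier W)" by (rule inj_on_inverseI[of _ h]) (rule g(2))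
    show "g ` carrier W = carrier V"
      using gh module_homD(1)[OF h'(1)] module_homD(1)[OF g(1)] by (auto simp: image_iff) metis
  qed
  then show thesis using gh g(2) that by blast
qed

lemma vs_isos_fin_dim:
  assumes V: "vectorspace k V" and W: "vectorspace k W" and h: "h \<in> vs_isos k V W"
    and fd: "vectorspace.fin_dim k V"
  shows "vectorspace.fin_dim k W" "vectorspace.dim k V = vectorspace.dim k W"
proof -
  note h' = vs_isosD[OF h]
  interpret linear_map k V W h by (rule linear_mapI[OF V W h'(1)])
  show "vectorspace.fin_dim k W" by (rule surj_fin_dim[OF fd h'(2)])
  show "vectorspace.dim k V = vectorspace.dim k W" by (rule dim_eq[OF fd h'(3,2)])
qed

lemma hom_restrict_carrier:
  "f \<in> module_hom k V W \<Longrightarrow> S \<subseteq> carrier V \<Longrightarrow> f \<in> module_hom k (V\<lparr>carrier := S\<rparr>) W"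
  by (simp add: module_hom_def Pi_iff subset_iff)

text \<open>A complement \<open>S\<close> identifies \<open>W\<close> with \<open>V / S\<close>,
  which is a linear image of the finite-dimensional space \<open>V\<close>.\<close>

lemma subspace_fin_dim:
  assumes V: "vectorspace k V" and W: "subspace k W V" and fd: "vectorspace.fin_dim k V"
  shows "vectorspace.fin_dim k (V\<lparr>carrier := W\<rparr>)"
proof -
  interpret V: vectorspace k V by fact
  let ?W = "V\<lparr>carrier := W\<rparr>"
  have W': "vectorspace k ?W" by (rule subspace_vectorspace[OF V W])
  note w = subspaceD[OF W]
  obtain S where S: "subspace k S V" "S \<inter> W \<subseteq> {\<zero>\<^bsub>V\<^esub>}"
    and dec: "\<And>u. u \<in> carrier V \<Longrightarrow> \<exists>s\<in>S. \<exists>d\<in>W. u = s \<oplus>\<^bsub>V\<^esub> d"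
    by (rule relative_complement[OF V zero_subspace[OF V] W full_subspace[OF V]]) auto
  note Q = vs_quot[OF V S(1)]
  let ?Q = "vs_quot V S"
  interpret Q: vectorspace k ?Q by (rule Q(1))
  note p = vs_quot_proj[OF V S(1)]
  interpret p: linear_map k V ?Q "\<lambda>x. S +>\<^bsub>V\<^esub> x" by (rule linear_mapI[OF V Q(1) p])
  have S0: "S +>\<^bsub>V\<^esub> x = S \<longleftrightarrow> x \<in> S" if "x \<in> carrier V" for x
    by (rule vs_quot_eq_zero[OF V S(1) that])
  have i: "(\<lambda>x. S +>\<^bsub>V\<^esub> x) \<in> vs_isos k ?W ?Q"
  proof (rule vs_isosI)
    show *: "(\<lambda>x. S +>\<^bsub>V\<^esub> x) \<in> module_hom k ?W ?Q" by (rule hom_restrict_carrier[OF p w(1)])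
    show "inj_on (\<lambda>x. S +>\<^bsub>V\<^esub> x) (carrier ?W)"
      by (rule inj_on_if_kernel_trivial[OF W' Q(1) *]) (use S0 S(2) w(1) in \<open>auto simp: Q(3)\<close>)
    show "(\<lambda>x. S +>\<^bsub>V\<^esub> x) ` carrier ?W = carrier ?Q"
    proof
      show "(\<lambda>x. S +>\<^bsub>V\<^esub> x) ` carrier ?W \<subseteq> carrier ?Q" using module_homD(1)[OF *] by blast
      show "carrier ?Q \<subseteq> (\<lambda>x. S +>\<^bsub>V\<^esub> x) ` carrier ?W"
      proof
        fix X assume "X \<in> carrier ?Q"
        then obtain x where x: "x \<in> carrier V" "X = S +>\<^bsub>V\<^esub> x" by (auto simp: Q(2))
        obtain s d where s: "s \<in> S" "d \<in> W" "x = s \<oplus>\<^bsub>V\<^esub> d" using dec[OF x(1)] by blast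
        have c: "s \<in> carrier V" "d \<in> carrier V" using s subspaceD(1)[OF S(1)] w(1) by auto
        have "X = (S +>\<^bsub>V\<^esub> s) \<oplus>\<^bsub>?Q\<^esub> (S +>\<^bsub>V\<^esub> d)" using s c x by simp
        also have "S +>\<^bsub>V\<^esub> s = \<zero>\<^bsub>?Q\<^esub>" using s c S0 by (simp add: Q(3))
        also have "\<dots> \<oplus>\<^bsub>?Q\<^esub> (S +>\<^bsub>V\<^esub> d) = S +>\<^bsub>V\<^esub> d" using p.f_im[OF c(2)] by simp
        finally show "X \<in> (\<lambda>x. S +>\<^bsub>V\<^esub> x) ` carrier ?W" using s by auto
      qed
    qed
  qed
  obtain g where "g \<in> vs_isos k ?Q ?W" by (rule vs_isos_inverse[OF W' Q(1) i], rule that)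
  moreover have "vectorspace.fin_dim k ?Q" by (rule p.surj_fin_dim[OF fd]) (simp add: Q(2))
  ultimately show ?thesis by (rule vs_isos_fin_dim(1)[OF Q(1) W'])
qed

section \<open>Brackets of ideals, and epimorphisms onto \<open>L\<close>\<close>

section \<open>Free presentations\<close>

context triassociative begin

lemma lozenge_subspace:
  assumes "S \<subseteq> carrier L" "T \<subseteq> carrier L"
  shows "subspace k (lozenge k L S T) L"
  unfolding lozenge_def set_add_eq_sum sprod_def
  by (intro sum_is_subspace span_subspace) (use assms in \<open>auto intro!: tprod_closed\<close>)

lemma lozenge_prod:
  assumes ST: "S \<subseteq> carrier L" "T \<subseteq> carrier L" and s: "s \<in> S" and t: "t \<in> T"
  shows "tprod L p s t \<in> lozenge k L S T"
proof -
  have gen: "{tprod L p s t |s t. s \<in> S \<and> t \<in> T} \<subseteq> carrier L" for p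
    using ST by (auto intro!: tprod_closed)
  have z: "\<zero> \<in> sprod k L p S T" for p
    using subspaceD(2)[OF span_subspace[OF gen]] by (simp add: sprod_def)
  have m: "tprod L p s t \<in> sprod k L p S T"
    unfolding sprod_def using in_own_span[OF gen] s t by blast
  have c: "tprod L p s t \<in> carrier L" using ST s t by (intro tprod_closed) auto
  have add: "a \<oplus> b \<in> A <+> B" if "a \<in> A" "b \<in> B" for a b A B
    using that by (auto simp: set_add_def')
  \<comment> \<open>The summands belonging to the other two products are taken to be zero.\<close>
  show ?thesis
  proof (cases p)
    case Vdash
    have "tprod L p s t \<oplus> \<zero> \<oplus> \<zero> \<in> lozenge k L S T"
      unfolding lozenge_def using m z unfolding Vdash by (intro add)
    then show ?thesis using c by simp
  next
    case Dashv
    have "\<zero> \<oplus> tprod L p s t \<oplus> \<zero> \<in> lozenge k L S T"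
      unfolding lozenge_def using m z unfolding Dashv by (intro add)
    then show ?thesis using c by simp
  next
    case Perp
    have "\<zero> \<oplus> \<zero> \<oplus> tprod L p s t \<in> lozenge k L S T"
      unfolding lozenge_def using m z unfolding Perp by (intro add)
    then show ?thesis using c by simp
  qed
qed

text \<open>With \<open>lozenge_subspace\<close> and \<open>lozenge_prod\<close> this describes the
  lozenge as the smallest subspace containing the products; the sum of three spans need not be
  unfolded again.\<close>

lemma lozenge_least:
  assumes W: "subspace k W L" and "\<And>p s t. s \<in> S \<Longrightarrow> t \<in> T \<Longrightarrow> tprod L p s t \<in> W"
  shows "lozenge k L S T \<subseteq> W"
proof -
  have "sprod k L p S T \<subseteq> W" for p
    unfolding sprod_def using assms(2) by (intro span_least W) auto
  then show ?thesis
    unfolding lozenge_def set_add_def' using subspaceD(3)[OF W] by blast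
qed

lemma ideal_carrier: "trias_ideal k L I \<Longrightarrow> I \<subseteq> carrier L"
  by (auto simp: trias_ideal_def dest: subspaceD)

end

text \<open>Restricts the record to \<open>trias\<close> without extension fields, the type on which
  \<open>bracket\<close>, \<open>hopf\<close>, \<open>Z2\<close> and \<open>Zstar\<close> are
  defined.\<close>

locale trias_algebra = triassociative k L
  for k :: "('k, 'c) ring_scheme" and L :: "('k, 'a) trias" (structure)
begin

lemma bracket_subspace:
  assumes "S \<subseteq> carrier L" shows "subspace k (bracket k L S) L"
  unfolding bracket_def set_add_eq_sum by (intro sum_is_subspace lozenge_subspace assms order_refl)

lemma bracket_prod:
  assumes S: "S \<subseteq> carrier L" and x: "x \<in> carrier L" and s: "s \<in> S"
  shows "tprod L p x s \<in> bracket k L S" "tprod L p s x \<in> bracket k L S"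
proof -
  have c: "tprod L p x s \<in> carrier L" "tprod L p s x \<in> carrier L"
    using S x s by (auto intro: tprod_closed)
  have z: "\<zero> \<in> lozenge k L (carrier L) S" "\<zero> \<in> lozenge k L S (carrier L)"
    using subspaceD(2)[OF lozenge_subspace[OF _ S]] subspaceD(2)[OF lozenge_subspace[OF S]] by auto
  have "tprod L p x s \<oplus> \<zero> \<in> bracket k L S"
    unfolding bracket_def set_add_def' using lozenge_prod[OF order_refl S x s] z(2) by blast
  then show "tprod L p x s \<in> bracket k L S" using c by simp
  have "\<zero> \<oplus> tprod L p s x \<in> bracket k L S"
    unfolding bracket_def set_add_def' using lozenge_prod[OF S order_refl s x] z(1) by blast
  then show "tprod L p s x \<in> bracket k L S" using c by simp
qed

lemma bracket_least:
  assumes W: "subspace k W L"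
    and "\<And>p x s. x \<in> carrier L \<Longrightarrow> s \<in> S \<Longrightarrow> tprod L p x s \<in> W \<and> tprod L p s x \<in> W"
  shows "bracket k L S \<subseteq> W"
proof -
  have "lozenge k L (carrier L) S \<subseteq> W" "lozenge k L S (carrier L) \<subseteq> W"
    by (rule lozenge_least[OF W]; use assms(2) in blast)+
  then show ?thesis unfolding bracket_def set_add_def' using subspaceD(3)[OF W] by blast
qed

lemma bracket_ideal_subset: "trias_ideal k L I \<Longrightarrow> bracket k L I \<subseteq> I"
  by (rule bracket_least) (simp_all add: trias_ideal_def)

lemma bracket_derived_subset: "S \<subseteq> carrier L \<Longrightarrow> bracket k L S \<subseteq> derived k L"
  by (rule bracket_least[OF derived_subspace]) (simp add: derived_prod subset_iff)

text \<open>Since the bracket lies in \<open>I\<close>, a product with one of its elements is a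
  product with an element of \<open>I\<close>.\<close>

lemma bracket_ideal:
  assumes I: "trias_ideal k L I"
  shows "trias_ideal k L (bracket k L I)"
  unfolding trias_ideal_def
  using bracket_subspace[OF ideal_carrier[OF I]] bracket_prod[OF ideal_carrier[OF I]]
    subsetD[OF bracket_ideal_subset[OF I]] by simp

lemma bracket_mono:
  assumes "S \<subseteq> T" "T \<subseteq> carrier L" shows "bracket k L S \<subseteq> bracket k L T"
proof (rule bracket_least[OF bracket_subspace[OF assms(2)]])
  fix p x s assume "x \<in> carrier L" "s \<in> S"
  then show "tprod L p x s \<in> bracket k L T \<and> tprod L p s x \<in> bracket k L T"
    using bracket_prod[OF assms(2)] assms(1) by (simp add: subset_iff)
qed

lemma Int_derived_subspace:
  "subspace k I L \<Longrightarrow> subspace k (I \<inter> derived k L) L"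
  using subspaceD[of k I L] subspaceD[OF derived_subspace]
  by (intro vs_subspaceI vectorspace_axioms) auto

lemma hopf:
  assumes I: "trias_ideal k L I"
  shows "vectorspace k (L\<lparr>carrier := I \<inter> derived k L\<rparr>)"
    and "subspace k (bracket k L I) (L\<lparr>carrier := I \<inter> derived k L\<rparr>)"
    and "vectorspace k (hopf k L I)"
    and "carrier (hopf k L I) = (\<lambda>x. bracket k L I +> x) ` (I \<inter> derived k L)"
    and "\<zero>\<^bsub>hopf k L I\<^esub> = bracket k L I"
    and "(\<lambda>x. bracket k L I +> x) \<in> module_hom k (L\<lparr>carrier := I \<inter> derived k L\<rparr>) (hopf k L I)"
    and "x \<in> carrier L \<Longrightarrow> bracket k L I +> x = bracket k L I \<longleftrightarrow> x \<in> bracket k L I"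
proof -
  let ?V = "L\<lparr>carrier := I \<inter> derived k L\<rparr>" and ?B = "bracket k L I"
  have sI: "subspace k I L" using I by (simp add: trias_ideal_def)
  show V: "vectorspace k ?V"
    by (rule subspace_vectorspace[OF vectorspace_axioms Int_derived_subspace[OF sI]])
  note B = bracket_subspace[OF ideal_carrier[OF I]]
  show B': "subspace k ?B ?V"
    by (rule vs_subspaceI[OF V])
      (use subspaceD[OF B] bracket_ideal_subset[OF I] bracket_derived_subset[OF ideal_carrier[OF I]]
        in auto)
  \<comment> \<open>Cosets depend only on addition, so they are the same in the smaller carrier
    \<open>I \<inter> derived k L\<close> as in \<open>L\<close>.\<close>
  have cos: "?B +>\<^bsub>?V\<^esub> x = ?B +> x" for x by (simp add: a_r_coset_def')
  note Q = vs_quot[OF V B', unfolded cos, folded hopf_def] vs_quot_proj[OF V B', unfolded cos, folded hopf_def]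
  show "vectorspace k (hopf k L I)" by (rule Q(1))
  show "carrier (hopf k L I) = (\<lambda>x. ?B +> x) ` (I \<inter> derived k L)" using Q(2) by simp
  show "\<zero>\<^bsub>hopf k L I\<^esub> = ?B" by (rule Q(3))
  show "(\<lambda>x. ?B +> x) \<in> module_hom k ?V (hopf k L I)" by (rule Q(8))
  show "x \<in> carrier L \<Longrightarrow> ?B +> x = ?B \<longleftrightarrow> x \<in> ?B" by (rule vs_quot_eq_zero[OF vectorspace_axioms B])
qed

lemma hopf_image:
  assumes I: "trias_ideal k L I" and W: "vectorspace k W"
    and f: "f \<in> module_hom k (L\<lparr>carrier := I \<inter> derived k L\<rparr>) W"
    and f0: "\<And>b. b \<in> bracket k L I \<Longrightarrow> f b = \<zero>\<^bsub>W\<^esub>" and x: "x \<in> I \<inter> derived k L"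
  shows "f ` (bracket k L I +> x) = {f x}"
  using quot_image[OF hopf(1)[OF I] W hopf(2)[OF I] f f0] x by (simp add: a_r_coset_def')

end

text \<open>Freeness is left out of the locale and added only where a lift is constructed. This
  allows the same results to be applied to the non-free extensions \<open>F / S\<close> of
  \<open>L\<close>, besides the presentations of \<open>L\<close> and \<open>L / Z\<close> by
  \<open>F\<close>.\<close>

locale trias_epi = F: trias_algebra k F + L: trias_algebra k L
  for k :: "('k, 'c) ring_scheme" and F :: "('k, 'f) trias" and L :: "('k, 'a) trias" +
  fixes \<pi> :: "'f \<Rightarrow> 'a"
  assumes hom: "\<pi> \<in> trias_hom k F L" and surj: "\<pi> ` carrier F = carrier L"
begin

abbreviation "R \<equiv> a_kernel F L \<pi>"

lemma linear: "\<pi> \<in> module_hom k F L"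
  using hom by (simp add: trias_hom_def)

lemma R_iff: "x \<in> R \<longleftrightarrow> x \<in> carrier F \<and> \<pi> x = \<zero>\<^bsub>L\<^esub>"
  by (simp add: a_kernel_def kernel_def)

lemma \<pi>_zero: "\<pi> \<zero>\<^bsub>F\<^esub> = \<zero>\<^bsub>L\<^esub>"
  by (rule trias_hom_zero[OF F.triassociative_axioms L.triassociative_axioms hom])

lemma preimage_ideal:
  assumes "trias_ideal k L I" shows "trias_ideal k F {x \<in> carrier F. \<pi> x \<in> I}"
  unfolding trias_ideal_def
proof (intro conjI allI ballI)
  have I: "subspace k I L" using assms by (simp add: trias_ideal_def)
  show "subspace k {x \<in> carrier F. \<pi> x \<in> I} F"
    by (rule F.subspaceI) (use subspaceD[OF I] trias_homD[OF hom] \<pi>_zero in auto)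
qed (use assms trias_homD[OF hom] F.tprod_closed in \<open>auto simp: trias_ideal_def\<close>)

lemma R_ideal: "trias_ideal k F R"
proof -
  have "trias_ideal k L {\<zero>\<^bsub>L\<^esub>}"
    unfolding trias_ideal_def using zero_subspace[OF L.vectorspace_axioms] L.tprod_zero by simp
  then have "trias_ideal k F {x \<in> carrier F. \<pi> x \<in> {\<zero>\<^bsub>L\<^esub>}}" by (rule preimage_ideal)
  also have "{x \<in> carrier F. \<pi> x \<in> {\<zero>\<^bsub>L\<^esub>}} = R" using R_iff by auto
  finally show ?thesis .
qed

lemma diff_mem_R:
  assumes "x \<in> carrier F" "y \<in> carrier F" "\<pi> x = \<pi> y" shows "x \<ominus>\<^bsub>F\<^esub> y \<in> R"
  using assms module_hom_eq_iff[OF F.vectorspace_axioms L.vectorspace_axioms linear, of x y]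
  by (simp add: R_iff)

text \<open>The elements \<open>t\<close> and \<open>t'\<close> differ by an element of
  \<open>R\<close>, whose products with \<open>x\<close> lie in the bracket.\<close>

lemma bracket_congruence:
  assumes x: "x \<in> carrier F" and t: "t \<in> carrier F" "t' \<in> carrier F" and eq: "\<pi> t = \<pi> t'"
  shows "tprod F p x t \<in> bracket k F R \<longleftrightarrow> tprod F p x t' \<in> bracket k F R"
    and "tprod F p t x \<in> bracket k F R \<longleftrightarrow> tprod F p t' x \<in> bracket k F R"
proof -
  note Rc = F.ideal_carrier[OF R_ideal]
  note B = subspaceD[OF F.bracket_subspace[OF Rc]]
  have one: "(tprod F p x u \<in> bracket k F R \<longrightarrow> tprod F p x v \<in> bracket k F R) \<and>
      (tprod F p u x \<in> bracket k F R \<longrightarrow> tprod F p v x \<in> bracket k F R)"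
    if u: "u \<in> carrier F" "v \<in> carrier F" "\<pi> u = \<pi> v" for u v
  proof -
    let ?r = "v \<ominus>\<^bsub>F\<^esub> u"
    have r: "?r \<in> R" using diff_mem_R[OF u(2,1)] u(3) by simp
    then have rc: "?r \<in> carrier F" using Rc by blast
    have v: "v = ?r \<oplus>\<^bsub>F\<^esub> u" using u by (simp add: a_minus_def F.M.a_assoc F.M.l_neg)
    have "tprod F p x v = tprod F p x ?r \<oplus>\<^bsub>F\<^esub> tprod F p x u"
      using F.tprod_add_right[OF x rc u(1)] v by simp
    moreover have "tprod F p v x = tprod F p ?r x \<oplus>\<^bsub>F\<^esub> tprod F p u x"
      using F.tprod_add_left[OF rc u(1) x] v by simp
    ultimately show ?thesis using F.bracket_prod[OF Rc x r] B(3) by auto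
  qed
  show "tprod F p x t \<in> bracket k F R \<longleftrightarrow> tprod F p x t' \<in> bracket k F R"
    "tprod F p t x \<in> bracket k F R \<longleftrightarrow> tprod F p t' x \<in> bracket k F R"
    using one[OF t eq] one[OF t(2,1) eq[symmetric]] by auto
qed

end

text \<open>Each generator is sent to an arbitrary \<open>\<omega>\<close>-preimage of its image in
  \<open>L\<close>; the two maps to \<open>L\<close> then agree on \<open>X\<close>, which generates
  \<open>F\<close>. The type of \<open>E\<close> is arbitrary because of
  \<open>free_on_extend\<close>.\<close>

lemma free_lift:
  fixes F :: "('k, 'f) trias" and E :: "('k, 'b) trias" and L :: "('k, 'a) trias"
  assumes F: "free_on k F X" and E: "triassociative k E" and L: "triassociative k L"
    and \<pi>: "\<pi> \<in> trias_hom k F L" and \<omega>: "\<omega> \<in> trias_hom k E L" "\<omega> ` carrier E = carrier L"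
  obtains h where "h \<in> trias_hom k F E" "\<And>x. x \<in> carrier F \<Longrightarrow> \<omega> (h x) = \<pi> x"
proof -
  have FT: "triassociative k F" and X: "X \<subseteq> carrier F" using F by (auto simp: free_on_def)
  let ?\<phi> = "\<lambda>x. inv_into (carrier E) \<omega> (\<pi> x)"
  have \<phi>: "?\<phi> x \<in> carrier E" "\<omega> (?\<phi> x) = \<pi> x" if "x \<in> X" for x
    using trias_homD(1)[OF \<pi> subsetD[OF X that]] inv_into_into[of "\<pi> x" \<omega> "carrier E"]
      f_inv_into_f[of "\<pi> x" \<omega> "carrier E"] by (simp_all add: \<omega>(2))
  obtain h where h: "h \<in> trias_hom k F E" "\<And>x. x \<in> X \<Longrightarrow> h x = ?\<phi> x"
    using ex1_implies_ex[OF free_on_extend[OF F E, of ?\<phi>]] \<phi>(1) by auto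
  have "\<omega> (h x) = \<pi> x" if "x \<in> carrier F" for x
    by (rule trias_hom_eq_on_gen[OF FT L X trias_hom_comp[OF h(1) \<omega>(1)] \<pi>])
      (use that h(2) \<phi>(2) free_on_gen[OF F] in auto)
  then show thesis using h(1) that by blast
qed

lemma hom_bracket_zero:
  assumes F: "triassociative k F" and E: "triassociative k E" and h: "h \<in> trias_hom k F E"
    and S: "\<And>s. s \<in> S \<Longrightarrow> s \<in> carrier F \<and> h s \<in> center E" and b: "b \<in> bracket k F S"
  shows "h b = \<zero>\<^bsub>E\<^esub>"
proof -
  interpret F: trias_algebra k F by (rule trias_algebra.intro[OF F])
  interpret E: triassociative k E by fact
  have "bracket k F S \<subseteq> {x \<in> carrier F. h x = \<zero>\<^bsub>E\<^esub>}"
  proof (rule F.bracket_least)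
    show "subspace k {x \<in> carrier F. h x = \<zero>\<^bsub>E\<^esub>} F"
      by (rule kernel_subspace[OF F.vectorspace_axioms E.vectorspace_axioms])
        (use h in \<open>simp add: trias_hom_def\<close>)
    fix p x s assume "x \<in> carrier F" "s \<in> S"
    then show "tprod F p x s \<in> {x \<in> carrier F. h x = \<zero>\<^bsub>E\<^esub>} \<and>
        tprod F p s x \<in> {x \<in> carrier F. h x = \<zero>\<^bsub>E\<^esub>}"
      using S trias_homD[OF h] F.tprod_closed by (auto simp: center_def)
  qed
  then show ?thesis using b by blast
qed

section \<open>Quotients of \<open>F\<close> as central extensions of \<open>L\<close>\<close>

context trias_epi begin

lemma preimage:
  assumes "y \<in> carrier L" obtains x where "x \<in> carrier F" "\<pi> x = y"
proof -
  have "y \<in> \<pi> ` carrier F" using assms by (simp only: surj)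
  then show thesis using that by blast
qed

text \<open>The formula does not mention the ideal, so one map serves both \<open>F / [F, R]\<close>
  and the quotient \<open>F / S\<close> in the defining pair.\<close>

definition quot_proj :: "'f set \<Rightarrow> 'a"
  where "quot_proj C = the_elem (\<pi> ` C)"

lemma quot_proj_apply:
  assumes S: "trias_ideal k F S" "S \<subseteq> R" and x: "x \<in> carrier F"
  shows "quot_proj (S +>\<^bsub>F\<^esub> x) = \<pi> x"
proof -
  have "subspace k S F" using S(1) by (simp add: trias_ideal_def)
  then show ?thesis
    unfolding quot_proj_def
    by (rule quot_lift(2)[OF F.vectorspace_axioms L.vectorspace_axioms _ linear _ x])
      (use S(2) R_iff in blast)
qed

text \<open>That \<open>S\<close> contains the bracket of \<open>R\<close> says exactly that
  \<open>R / S\<close> annihilates the quotient. The smallest such \<open>S\<close> tests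
  \<open>Zstar\<close>; a larger one gives a defining pair.\<close>

lemma quot_central_extension:
  assumes S: "trias_ideal k F S" "bracket k F R \<subseteq> S" "S \<subseteq> R"
  shows "central_extension k (trias_quot F S) quot_proj L"
proof -
  let ?E = "trias_quot F S"
  note Q = F.trias_quot_simps[OF S(1)]
  note app = quot_proj_apply[OF S(1,3)]
  have "quot_proj \<in> trias_hom k ?E L"
    by (rule trias_homI) (use trias_homD[OF hom] in \<open>auto simp: Q(1,3-5) app F.tprod_closed\<close>)
  moreover have "quot_proj ` carrier ?E = carrier L"
    using surj by (simp add: Q(1) image_image app cong: image_cong)
  moreover have "a_kernel ?E L quot_proj \<subseteq> center ?E"
  proof
    fix C assume "C \<in> a_kernel ?E L quot_proj"
    then have C: "C \<in> carrier ?E" "quot_proj C = \<zero>\<^bsub>L\<^esub>" by (auto simp: a_kernel_def kernel_def)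
    then obtain x where xc: "x \<in> carrier F" and x: "C = S +>\<^bsub>F\<^esub> x" by (auto simp: Q(1))
    have xR: "x \<in> R" using C(2) xc app by (simp add: x R_iff)
    have "subspace k S F" using S(1) by (simp add: trias_ideal_def)
    then have z: "S +>\<^bsub>F\<^esub> b = S" if "b \<in> bracket k F R" for b
      using vs_quot_eq_zero[OF F.vectorspace_axioms, of S b] that S(2) F.ideal_carrier[OF S(1)] by blast
    show "C \<in> center ?E"
      using xc F.bracket_prod[OF F.ideal_carrier[OF R_ideal] _ xR]
      by (auto simp: center_def Q(1,2,5) x z)
  qed
  ultimately show ?thesis
    unfolding central_extension_def
    using trias_quot_triassociative[OF F.triassociative_axioms S(1)] L.triassociative_axioms by blast
qed

end

section \<open>The preimage \<open>T\<close> of a central ideal, and conditions (2) and (4)\<close>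

locale trias_epi_central = trias_epi k F L \<pi>
  for k :: "('k, 'c) ring_scheme" and F :: "('k, 'f) trias" and L :: "('k, 'a) trias" and \<pi> +
  fixes Z assumes Z: "central_ideal k L Z"
begin

abbreviation "T \<equiv> {x \<in> carrier F. \<pi> x \<in> Z}"

lemma Z_ideal: "trias_ideal k L Z" and Z_center: "Z \<subseteq> center L"
  using Z by (auto simp: central_ideal_def)

lemma T_ideal: "trias_ideal k F T"
  by (rule preimage_ideal[OF Z_ideal])

lemma T_carrier: "T \<subseteq> carrier F" by auto

lemma R_subset_T: "R \<subseteq> T"
  using R_iff Z_ideal subspaceD(2) by (auto simp: trias_ideal_def)

text \<open>Centrality of \<open>Z\<close> enters here: \<open>\<pi>\<close> sends a product with an
  element of \<open>T\<close> to a product with an element of \<open>Z\<close>, which is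
  zero.\<close>

lemma bracket_T_subset_R: "bracket k F T \<subseteq> R"
proof (rule F.bracket_least)
  show "subspace k R F" using R_ideal by (simp add: trias_ideal_def)
  fix p x t assume "x \<in> carrier F" "t \<in> T"
  then show "tprod F p x t \<in> R \<and> tprod F p t x \<in> R"
    using Z_center trias_homD[OF hom] F.tprod_closed by (auto simp: R_iff center_def subset_iff)
qed

lemma bracket_T_subset: "bracket k F T \<subseteq> R \<inter> derived k F"
  using bracket_T_subset_R F.bracket_derived_subset[OF T_carrier] by blast

lemma bracket_R_subset_T: "bracket k F R \<subseteq> bracket k F T"
  by (rule F.bracket_mono[OF R_subset_T T_carrier])

lemma beta_props:
  shows beta_hom: "beta k F T \<in> module_hom k (hopf k F R) (hopf k F T)"
    and beta_apply: "x \<in> R \<inter> derived k F \<Longrightarrow>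
      beta k F T (bracket k F R +>\<^bsub>F\<^esub> x) = bracket k F T +>\<^bsub>F\<^esub> x"
proof -
  note HR = F.hopf[OF R_ideal] and HT = F.hopf[OF T_ideal]
  let ?V = "F\<lparr>carrier := R \<inter> derived k F\<rparr>" and ?f = "\<lambda>x. bracket k F T +>\<^bsub>F\<^esub> x"
  have "?f \<in> module_hom k ((F\<lparr>carrier := T \<inter> derived k F\<rparr>)\<lparr>carrier := R \<inter> derived k F\<rparr>) (hopf k F T)"
    by (rule hom_restrict_carrier[OF HT(6)]) (use R_subset_T in auto)
  then have f: "?f \<in> module_hom k ?V (hopf k F T)" by simp
  have f0: "?f b = \<zero>\<^bsub>hopf k F T\<^esub>" if "b \<in> bracket k F R" for b
    using that bracket_R_subset_T HT(7)[of b] F.ideal_carrier[OF F.bracket_ideal[OF T_ideal]]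
    unfolding HT(5) by blast
  have img: "?f ` (bracket k F R +>\<^bsub>F\<^esub> x) = {?f x}" if "x \<in> R \<inter> derived k F" for x
    by (rule F.hopf_image[OF R_ideal HT(3) f f0 that])
  have *: "beta k F T (bracket k F R +>\<^bsub>F\<^esub> x) = bracket k F T +>\<^bsub>F\<^esub> x" if "x \<in> R \<inter> derived k F" for x
  proof -
    have "beta k F T (bracket k F R +>\<^bsub>F\<^esub> x) = \<Union>(?f ` (bracket k F R +>\<^bsub>F\<^esub> x))"
      by (simp only: beta_def)
    also have "\<dots> = ?f x" by (simp only: img[OF that] ccpo_Sup_singleton)
    finally show ?thesis .
  qed
  then show "x \<in> R \<inter> derived k F \<Longrightarrow>
      beta k F T (bracket k F R +>\<^bsub>F\<^esub> x) = bracket k F T +>\<^bsub>F\<^esub> x" .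
  \<comment> \<open>\<open>beta\<close> is defined by a union and \<open>quot_lift\<close> by
    \<open>the_elem\<close>. They agree on genuine cosets only, so linearity is transferred argument
    by argument.\<close>
  have eq: "beta k F T C = the_elem (?f ` C)" if "C \<in> carrier (hopf k F R)" for C
  proof -
    from that[unfolded HR(4)] obtain x
      where x: "x \<in> R \<inter> derived k F" "C = bracket k F R +>\<^bsub>F\<^esub> x" by (rule imageE)
    show ?thesis using *[OF x(1)] img[OF x(1)] by (simp only: x(2) the_elem_eq)
  qed
  have "(\<lambda>C. the_elem (?f ` C)) \<in> module_hom k (hopf k F R) (hopf k F T)"
    unfolding hopf_def[of k F R]
    by (rule quot_lift(1)[OF HR(1) HT(3) HR(2) f f0])
  then show "beta k F T \<in> module_hom k (hopf k F R) (hopf k F T)"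
  proof (intro module_homI)
    interpret H: vectorspace k "hopf k F R" by (rule HR(3))
    assume g: "(\<lambda>C. the_elem (?f ` C)) \<in> module_hom k (hopf k F R) (hopf k F T)"
    note g = module_homD[OF g]
    show "beta k F T A \<in> carrier (hopf k F T)" if "A \<in> carrier (hopf k F R)" for A
      using g(1)[OF that] eq[OF that] by simp
    show "beta k F T (A \<oplus>\<^bsub>hopf k F R\<^esub> B) = beta k F T A \<oplus>\<^bsub>hopf k F T\<^esub> beta k F T B"
      if "A \<in> carrier (hopf k F R)" "B \<in> carrier (hopf k F R)" for A B
      using g(2)[OF that] eq that H.M.add.m_closed[OF that] by simp
    show "beta k F T (c \<odot>\<^bsub>hopf k F R\<^esub> A) = c \<odot>\<^bsub>hopf k F T\<^esub> beta k F T A"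
      if "c \<in> carrier k" "A \<in> carrier (hopf k F R)" for c A
      using g(3)[OF that] eq that H.smult_closed[OF that] by simp
  qed
qed

text \<open>The kernel of \<open>beta\<close> consists of the classes of all of
  \<open>bracket k F T\<close>, because that bracket lies in \<open>R \<inter> F'\<close>, where
  representatives of the domain are taken.\<close>

lemma inj_beta_iff:
  "inj_on (beta k F T) (carrier (hopf k F R)) \<longleftrightarrow> bracket k F T \<subseteq> bracket k F R"
proof
  note HR = F.hopf[OF R_ideal] and HT = F.hopf[OF T_ideal]
  have Tc: "bracket k F T \<subseteq> carrier F" by (rule F.ideal_carrier[OF F.bracket_ideal[OF T_ideal]])
  {
    assume inj: "inj_on (beta k F T) (carrier (hopf k F R))"
    show "bracket k F T \<subseteq> bracket k F R"
    proof
      fix x assume x: "x \<in> bracket k F T"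
      let ?C = "bracket k F R +>\<^bsub>F\<^esub> x"
      have xR: "x \<in> R \<inter> derived k F" using x bracket_T_subset by blast
      have "beta k F T ?C = \<zero>\<^bsub>hopf k F T\<^esub>"
        using beta_apply[OF xR] HT(5) HT(7)[of x] x Tc by auto
      also have "\<dots> = beta k F T \<zero>\<^bsub>hopf k F R\<^esub>"
        by (rule module_hom_zero[OF HR(3) HT(3) beta_hom, symmetric])
      finally have "?C = \<zero>\<^bsub>hopf k F R\<^esub>"
      proof (rule inj_onD[OF inj])
        show "?C \<in> carrier (hopf k F R)" using xR by (auto simp: HR(4))
        interpret H: vectorspace k "hopf k F R" by (rule HR(3))
        show "\<zero>\<^bsub>hopf k F R\<^esub> \<in> carrier (hopf k F R)" by simp
      qed
      then show "x \<in> bracket k F R" using HR(5) HR(7)[of x] x Tc by auto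
    qed
  next
    assume sub: "bracket k F T \<subseteq> bracket k F R"
    show "inj_on (beta k F T) (carrier (hopf k F R))"
    proof (rule inj_on_if_kernel_trivial[OF HR(3) HT(3) beta_hom])
      fix C assume "C \<in> carrier (hopf k F R)" and 0: "beta k F T C = \<zero>\<^bsub>hopf k F T\<^esub>"
      then obtain x where x: "x \<in> R \<inter> derived k F" "C = bracket k F R +>\<^bsub>F\<^esub> x" by (auto simp: HR(4))
      have xc: "x \<in> carrier F" using x R_iff by blast
      have "x \<in> bracket k F T" using 0 beta_apply[OF x(1)] x(2) HT(5) HT(7)[OF xc] by simp
      then show "C = \<zero>\<^bsub>hopf k F R\<^esub>" using sub x(2) HR(5) HR(7)[OF xc] by auto
    qed
  }
qed

text \<open>The lift \<open>h\<close> maps \<open>R\<close> into the central kernel of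
  \<open>\<omega>\<close>, hence kills the bracket of \<open>R\<close> and by hypothesis that of
  \<open>T\<close>. So \<open>h t\<close> annihilates \<open>h F\<close>, and \<open>E\<close> is
  the sum of \<open>h F\<close> and central elements.\<close>

lemma central_extension_center:
  fixes E :: "('k, 'e) trias"
  assumes free: "free_on k F X" and sub: "bracket k F T \<subseteq> bracket k F R"
    and ext: "central_extension k E \<omega> L" and z: "z \<in> Z"
  shows "z \<in> \<omega> ` center E"
proof -
  have E: "triassociative k E" and \<omega>: "\<omega> \<in> trias_hom k E L" "\<omega> ` carrier E = carrier L"
    and ker: "a_kernel E L \<omega> \<subseteq> center E"
    using ext by (auto simp: central_extension_def)
  interpret E: triassociative k E by fact
  obtain h where h: "h \<in> trias_hom k F E" "\<And>x. x \<in> carrier F \<Longrightarrow> \<omega> (h x) = \<pi> x"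
    by (rule free_lift[OF free E L.triassociative_axioms hom \<omega>], rule that)
  have hR: "s \<in> carrier F \<and> h s \<in> center E" if "s \<in> R" for s
  proof -
    have s: "s \<in> carrier F" "\<pi> s = \<zero>\<^bsub>L\<^esub>" using that R_iff by blast+
    then have "h s \<in> a_kernel E L \<omega>"
      using h(2)[OF s(1)] trias_homD(1)[OF h(1) s(1)] by (simp add: a_kernel_def kernel_def)
    then show ?thesis using ker s(1) by blast
  qed
  have hB: "h b = \<zero>\<^bsub>E\<^esub>" if "b \<in> bracket k F R" for b
    by (rule hom_bracket_zero[OF F.triassociative_axioms E h(1) hR that])
  have zL: "z \<in> carrier L" using subsetD[OF Z_center z] by (simp add: center_def)
  obtain t where t: "t \<in> carrier F" "\<pi> t = z" by (rule preimage[OF zL])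
  then have tT: "t \<in> T" using z by simp
  have "h t \<in> center E"
    unfolding center_def
  proof (intro CollectI conjI allI ballI)
    show ht: "h t \<in> carrier E" using trias_homD(1)[OF h(1) t(1)] .
    fix p e assume e: "e \<in> carrier E"
    obtain y where y: "y \<in> carrier F" "\<pi> y = \<omega> e"
      by (rule preimage[OF trias_homD(1)[OF \<omega>(1) e]])
    have hy: "h y \<in> carrier E" using trias_homD(1)[OF h(1) y(1)] .
    \<comment> \<open>Elements of \<open>E\<close> with the same image in \<open>L\<close> differ by
      a kernel element, which contributes nothing to a product.\<close>
    let ?d = "e \<ominus>\<^bsub>E\<^esub> h y"
    have dc: "?d \<in> carrier E" using e hy by simp
    have "\<omega> ?d = \<zero>\<^bsub>L\<^esub>"
      using module_hom_eq_iff[OF E.vectorspace_axioms L.vectorspace_axioms _ e hy, of \<omega>] \<omega>(1) h(2)[OF y(1)] y(2)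
      by (simp add: trias_hom_def)
    then have d: "?d \<in> center E" using dc ker by (auto simp: a_kernel_def kernel_def)
    have eq: "e = ?d \<oplus>\<^bsub>E\<^esub> h y" using e hy by (simp add: a_minus_def E.M.a_assoc E.M.l_neg)
    have "h (tprod F p t y) = \<zero>\<^bsub>E\<^esub>" "h (tprod F p y t) = \<zero>\<^bsub>E\<^esub>"
      using F.bracket_prod[OF T_carrier y(1) tT] by (auto intro!: hB subsetD[OF sub])
    then have "tprod E p (h t) (h y) = \<zero>\<^bsub>E\<^esub>" "tprod E p (h y) (h t) = \<zero>\<^bsub>E\<^esub>"
      using trias_homD(4)[OF h(1)] t(1) y(1) by simp_all
    then have "tprod E p (h t) (?d \<oplus>\<^bsub>E\<^esub> h y) = \<zero>\<^bsub>E\<^esub>" "tprod E p (?d \<oplus>\<^bsub>E\<^esub> h y) (h t) = \<zero>\<^bsub>E\<^esub>"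
      using d ht hy dc by (simp_all add: E.tprod_add_left E.tprod_add_right center_def)
    then show "tprod E p (h t) e = \<zero>\<^bsub>E\<^esub>" "tprod E p e (h t) = \<zero>\<^bsub>E\<^esub>" using eq by simp_all
  qed
  moreover have "\<omega> (h t) = z" using h(2)[OF t(1)] t(2) by simp
  ultimately show ?thesis by blast
qed

lemma Zstar_iff:
  assumes F: "free_on k F X"
  shows "Z \<subseteq> Zstar k L \<longleftrightarrow> bracket k F T \<subseteq> bracket k F R"
proof
  let ?E = "trias_quot F (bracket k F R)"
  note Rc = F.ideal_carrier[OF R_ideal]
  note B = F.bracket_ideal[OF R_ideal]
  note Q = F.trias_quot_simps[OF B]
  have Z0: "bracket k F R +>\<^bsub>F\<^esub> b = \<zero>\<^bsub>?E\<^esub> \<longleftrightarrow> b \<in> bracket k F R" if "b \<in> carrier F" for b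
    using F.hopf(7)[OF R_ideal that] by (simp add: Q(2))
  assume "Z \<subseteq> Zstar k L"
  \<comment> \<open>The extension \<open>F / [F, R]\<close> lives on sets of elements of
    \<open>F\<close>, not on terms, so \<open>Zstar_subset\<close> is what makes it
    admissible.\<close>
  then have sub: "Z \<subseteq> quot_proj ` center ?E"
    using Zstar_subset[OF quot_central_extension[OF B order_refl F.bracket_ideal_subset[OF R_ideal]]] by blast
  show "bracket k F T \<subseteq> bracket k F R"
  proof (rule F.bracket_least[OF F.bracket_subspace[OF Rc]])
    fix p y t assume y: "y \<in> carrier F" and t: "t \<in> T"
    have "\<pi> t \<in> quot_proj ` center ?E" using t sub by blast
    then obtain C where C: "C \<in> center ?E" "\<pi> t = quot_proj C" by blast
    then obtain x where x: "x \<in> carrier F" "C = bracket k F R +>\<^bsub>F\<^esub> x" by (auto simp: center_def Q(1))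
    have eq: "\<pi> t = \<pi> x" using C(2) x quot_proj_apply[OF B F.bracket_ideal_subset[OF R_ideal]] by simp
    have "bracket k F R +>\<^bsub>F\<^esub> y \<in> carrier ?E" using y by (simp add: Q(1))
    then have "tprod ?E p C (bracket k F R +>\<^bsub>F\<^esub> y) = \<zero>\<^bsub>?E\<^esub>"
      "tprod ?E p (bracket k F R +>\<^bsub>F\<^esub> y) C = \<zero>\<^bsub>?E\<^esub>"
      using C(1) by (auto simp: center_def)
    then have "tprod F p x y \<in> bracket k F R" "tprod F p y x \<in> bracket k F R"
      using x y Q(5) Z0[OF F.tprod_closed] by auto
    \<comment> \<open>The representative \<open>x\<close> of the central coset need not be
      \<open>t\<close>; it has the same image in \<open>L\<close>, and this suffices modulo the
      bracket.\<close>
    then show "tprod F p y t \<in> bracket k F R \<and> tprod F p t y \<in> bracket k F R"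
      using bracket_congruence[OF y _ x(1) eq] t by auto
  qed
next
  assume sub: "bracket k F T \<subseteq> bracket k F R"
  show "Z \<subseteq> Zstar k L"
  proof
    fix z assume z: "z \<in> Z"
    have "z \<in> \<omega> ` center E" if "central_extension k E \<omega> L" for E :: "('k, ('k, 'a) tterm) trias" and \<omega>
      by (rule central_extension_center[OF F sub that z])
    then show "z \<in> Zstar k L" unfolding Zstar_def by blast
  qed
qed

end

section \<open>Restriction of cocycles to a central ideal, and the extension defined by a
  cocycle\<close>

section \<open>Cocycles\<close>

text \<open>Indexing the triple by \<open>tri\<close> lets one argument treat all three forms, in
  parallel with \<open>tprod\<close>.\<close>

fun coord :: "'x \<times> 'x \<times> 'x \<Rightarrow> tri \<Rightarrow> 'x" where
  "coord (a, b, c) Vdash = a"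
| "coord (a, b, c) Dashv = b"
| "coord (a, b, c) Perp = c"

lemma all_tri: "(\<forall>p. P p) \<longleftrightarrow> P Vdash \<and> P Dashv \<and> P Perp"
  by (metis tri.exhaust)

context trias_algebra begin

lemma Bil_simps:
  fixes U :: "('k, 'u, 'm1) module_scheme" and V :: "('k, 'v, 'm2) module_scheme"
  shows "\<zero>\<^bsub>Bil k U V\<^esub> = (\<lambda>_\<in>carrier U \<times> carrier V. \<zero>\<^bsub>k\<^esub>)"
    and "f \<oplus>\<^bsub>Bil k U V\<^esub> g = (\<lambda>v\<in>carrier U \<times> carrier V. f v \<oplus>\<^bsub>k\<^esub> g v)"
  by (simp_all add: Bil_def ring.func_space_def[OF R.ring_axioms])

lemma Bil_iff:
  fixes U :: "('k, 'u, 'm1) module_scheme" and V :: "('k, 'v, 'm2) module_scheme"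
  shows "f \<in> carrier (Bil k U V) \<longleftrightarrow> f \<in> carrier U \<times> carrier V \<rightarrow>\<^sub>E carrier k \<and>
    (\<forall>v \<in> carrier V. (\<lambda>u. f (u, v)) \<in> module_hom k U (self_module k)) \<and>
    (\<forall>u \<in> carrier U. (\<lambda>v. f (u, v)) \<in> module_hom k V (self_module k))"
  by (simp add: Bil_def)

lemma Bil_eval:
  assumes f: "f \<in> carrier (Bil k L L)" and x: "x \<in> carrier L" and y: "y \<in> carrier L"
  shows "f (x, y) \<in> carrier k" "x' \<in> carrier L \<Longrightarrow> f (x \<oplus> x', y) = f (x, y) \<oplus>\<^bsub>k\<^esub> f (x', y)"
    "y' \<in> carrier L \<Longrightarrow> f (x, y \<oplus> y') = f (x, y) \<oplus>\<^bsub>k\<^esub> f (x, y')"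
    "c \<in> carrier k \<Longrightarrow> f (c \<odot> x, y) = c \<otimes>\<^bsub>k\<^esub> f (x, y)"
    "c \<in> carrier k \<Longrightarrow> f (x, c \<odot> y) = c \<otimes>\<^bsub>k\<^esub> f (x, y)"
  using f x y by (auto simp: Bil_iff self_module_def module_hom_def PiE_def Pi_def)

lemma Bil_zero:
  assumes "f \<in> carrier (Bil k L L)" "x \<in> carrier L"
  shows "f (x, \<zero>) = \<zero>\<^bsub>k\<^esub>" "f (\<zero>, x) = \<zero>\<^bsub>k\<^esub>"
  using Bil_eval(5)[OF assms(1,2) M.zero_closed R.zero_closed]
    Bil_eval(4)[OF assms(1) M.zero_closed assms(2) R.zero_closed]
    Bil_eval(1)[OF assms(1,2) M.zero_closed] Bil_eval(1)[OF assms(1) M.zero_closed assms(2)]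
  by simp_all

lemma Z2_iff:
  "f \<in> Z2 k L \<longleftrightarrow> (\<forall>p. coord f p \<in> carrier (Bil k L L)) \<and>
    (\<forall>x \<in> carrier L. \<forall>y \<in> carrier L. \<forall>z \<in> carrier L.
        coord f Vdash (x \<turnstile> y, z) = coord f Vdash (x, y \<turnstile> z)
      \<and> coord f Dashv (x \<stileturn> y, z) = coord f Dashv (x, y \<stileturn> z)
      \<and> coord f Vdash (x \<stileturn> y, z) = coord f Vdash (x, y \<turnstile> z)
      \<and> coord f Dashv (x \<stileturn> y, z) = coord f Dashv (x, y \<turnstile> z)
      \<and> coord f Dashv (x \<turnstile> y, z) = coord f Vdash (x, y \<stileturn> z)
      \<and> coord f Vdash (x \<perp> y, z) = coord f Vdash (x, y \<turnstile> z)
      \<and> coord f Dashv (x \<stileturn> y, z) = coord f Dashv (x, y \<perp> z)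
      \<and> coord f Perp (x \<turnstile> y, z) = coord f Vdash (x, y \<perp> z)
      \<and> coord f Dashv (x \<perp> y, z) = coord f Perp (x, y \<stileturn> z)
      \<and> coord f Perp (x \<stileturn> y, z) = coord f Perp (x, y \<turnstile> z)
      \<and> coord f Perp (x \<perp> y, z) = coord f Perp (x, y \<perp> z))"
proof -
  obtain a b c where f: "f = (a, b, c)" by (cases f)
  show ?thesis by (simp add: f all_tri Z2_def cube_def direct_sum_def)
qed

lemma Z2_bilinear: "f \<in> Z2 k L \<Longrightarrow> coord f p \<in> carrier (Bil k L L)"
  by (simp add: Z2_iff)

text \<open>This makes \<open>delta\<close> well defined on \<open>L / L'\<close>. On each side of
  the eleven cocycle identities all nine combinations of a form with an inner product occur, so the
  bracket can always be moved onto the central element, where the inner product is zero.\<close>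

lemma cocycle_derived:
  assumes f: "f \<in> Z2 k L" and z: "z \<in> center L" and d: "d \<in> derived k L"
  shows "coord f p (d, z) = \<zero>\<^bsub>k\<^esub>" "coord f p (z, d) = \<zero>\<^bsub>k\<^esub>"
proof -
  have zc: "z \<in> carrier L" using z by (simp add: center_def)
  have z0: "tprod L q z x = \<zero>" "tprod L q x z = \<zero>" if "x \<in> carrier L" for q x
    using z that by (simp_all add: center_def)
  note b = Z2_bilinear[OF f]
  have "derived k L \<subseteq> {d \<in> carrier L. coord f p (d, z) = \<zero>\<^bsub>k\<^esub>}"
  proof (rule derived_least)
    show "subspace k {d \<in> carrier L. coord f p (d, z) = \<zero>\<^bsub>k\<^esub>} L"
      by (rule subspaceI) (use zc in \<open>auto simp: Bil_eval[OF b] Bil_zero[OF b]\<close>)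
    fix q x y assume xy: "x \<in> carrier L" "y \<in> carrier L"
    have "coord f p (tprod L q x y, z) = \<zero>\<^bsub>k\<^esub>"
      using f[unfolded Z2_iff, THEN conjunct2, rule_format, OF xy zc] z0 xy Bil_zero[OF b]
      by (cases p; cases q) simp_all
    then show "tprod L q x y \<in> {d \<in> carrier L. coord f p (d, z) = \<zero>\<^bsub>k\<^esub>}"
      using xy tprod_closed by simp
  qed
  then show "coord f p (d, z) = \<zero>\<^bsub>k\<^esub>" using d by blast
  have "derived k L \<subseteq> {d \<in> carrier L. coord f p (z, d) = \<zero>\<^bsub>k\<^esub>}"
  proof (rule derived_least)
    show "subspace k {d \<in> carrier L. coord f p (z, d) = \<zero>\<^bsub>k\<^esub>} L"
      by (rule subspaceI) (use zc in \<open>auto simp: Bil_eval[OF b] Bil_zero[OF b]\<close>)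
    fix q x y assume xy: "x \<in> carrier L" "y \<in> carrier L"
    \<comment> \<open>Which form and product appear after rebracketing depends on \<open>p\<close>
      and \<open>q\<close>, but any of them vanishes next to \<open>z\<close>.\<close>
    have "\<exists>p' q'. coord f p (z, tprod L q x y) = coord f p' (tprod L q' z x, y)"
      using f[unfolded Z2_iff, THEN conjunct2, rule_format, OF zc xy] by (cases p; cases q; metis)
    then have "coord f p (z, tprod L q x y) = \<zero>\<^bsub>k\<^esub>" using z0 xy Bil_zero[OF b] by auto
    then show "tprod L q x y \<in> {d \<in> carrier L. coord f p (z, d) = \<zero>\<^bsub>k\<^esub>}"
      using xy tprod_closed by simp
  qed
  then show "coord f p (z, d) = \<zero>\<^bsub>k\<^esub>" using d by blast
qed

lemma abelianization_carrier: "carrier (abelianization k L) = (\<lambda>x. derived k L +> x) ` carrier L"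
  by (rule vs_quot(2)[OF vectorspace_axioms derived_subspace])

lemma derived_coset:
  assumes "x \<in> carrier L"
  shows "derived k L +> x \<subseteq> carrier L" "x \<in> derived k L +> x"
  using assms vs_quot(7)[OF vectorspace_axioms derived_subspace assms] subspaceD(1)[OF derived_subspace]
  by (auto simp: a_r_coset_def')

text \<open>Only the values on \<open>L \<times> Z\<close> and \<open>Z \<times> L\<close> enter the
  images whose common element is extracted, so arbitrary functions may be compared.\<close>

lemma restr_cong:
  assumes "\<And>x z. x \<in> carrier L \<Longrightarrow> z \<in> Z \<Longrightarrow> g (x, z) = h (x, z) \<and> g (z, x) = h (z, x)"
  shows "restr k L Z g = restr k L Z h"
proof -
  have "(\<lambda>x. g (x, z)) ` A = (\<lambda>x. h (x, z)) ` A" "(\<lambda>x. g (z, x)) ` A = (\<lambda>x. h (z, x)) ` A"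
    if "A \<in> carrier (abelianization k L)" "z \<in> Z" for A z
    using that assms derived_coset(1) unfolding abelianization_carrier by (force intro!: image_cong)+
  then show ?thesis unfolding restr_def by (auto intro!: restrict_ext)
qed

lemma restr_eq_zero_iff:
  assumes Z: "Z \<subseteq> carrier L" and g: "g \<in> carrier (Bil k L L)"
    and g0: "\<And>d z. d \<in> derived k L \<Longrightarrow> z \<in> Z \<Longrightarrow> g (d, z) = \<zero>\<^bsub>k\<^esub> \<and> g (z, d) = \<zero>\<^bsub>k\<^esub>"
  shows "restr k L Z g = (\<zero>\<^bsub>Bil k (abelianization k L) (L\<lparr>carrier := Z\<rparr>)\<^esub>,
      \<zero>\<^bsub>Bil k (L\<lparr>carrier := Z\<rparr>) (abelianization k L)\<^esub>) \<longleftrightarrow>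
    (\<forall>x \<in> carrier L. \<forall>z \<in> Z. g (x, z) = \<zero>\<^bsub>k\<^esub> \<and> g (z, x) = \<zero>\<^bsub>k\<^esub>)" (is "?l = ?z \<longleftrightarrow> ?r")
proof -
  \<comment> \<open>Vanishing on \<open>L'\<close> makes \<open>g\<close> constant along each coset
    of \<open>L'\<close>, so \<open>the_elem\<close> returns the value at any
    representative.\<close>
  have val: "fst (restr k L Z g) (derived k L +> x, z) = g (x, z)"
    "snd (restr k L Z g) (z, derived k L +> x) = g (z, x)" if x: "x \<in> carrier L" and z: "z \<in> Z" for x z
  proof -
    have zc: "z \<in> carrier L" using z Z by blast
    have dc: "derived k L \<subseteq> carrier L" by (rule subspaceD(1)[OF derived_subspace])
    have A: "derived k L +> x \<in> carrier (abelianization k L)" using x by (simp add: abelianization_carrier)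
    have "g (u, z) = g (x, z) \<and> g (z, u) = g (z, x)" if u: "u \<in> derived k L +> x" for u
    proof -
      obtain d where d: "d \<in> derived k L" "u = d \<oplus> x" using u by (auto simp: a_r_coset_def')
      have "d \<in> carrier L" using d dc by blast
      then show ?thesis using d x zc g0[OF d(1) z] Bil_eval[OF g] by simp
    qed
    then have "(\<lambda>u. g (u, z)) ` (derived k L +> x) = (\<lambda>_. g (x, z)) ` (derived k L +> x)"
      "(\<lambda>u. g (z, u)) ` (derived k L +> x) = (\<lambda>_. g (z, x)) ` (derived k L +> x)"
      by (auto intro!: image_cong)
    then have "(\<lambda>u. g (u, z)) ` (derived k L +> x) = {g (x, z)}"
      "(\<lambda>u. g (z, u)) ` (derived k L +> x) = {g (z, x)}"
      by (simp_all only: image_constant[OF derived_coset(2)[OF x]])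
    then show "fst (restr k L Z g) (derived k L +> x, z) = g (x, z)"
      "snd (restr k L Z g) (z, derived k L +> x) = g (z, x)"
      using A z by (simp_all add: restr_def)
  qed
  show ?thesis
  proof
    assume eq: "?l = ?z"
    show ?r
    proof (intro ballI)
      fix x z assume x: "x \<in> carrier L" and z: "z \<in> Z"
      then have A: "derived k L +> x \<in> carrier (abelianization k L)" by (simp add: abelianization_carrier)
      show "g (x, z) = \<zero>\<^bsub>k\<^esub> \<and> g (z, x) = \<zero>\<^bsub>k\<^esub>"
        unfolding val(1)[OF x z, symmetric] val(2)[OF x z, symmetric] eq using A z by (simp add: Bil_simps)
    qed
  next
    assume r: ?r
    have "restr k L Z g = restr k L Z (\<lambda>_. \<zero>\<^bsub>k\<^esub>)" by (rule restr_cong) (use r in auto)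
    also have "\<dots> = ?z"
    proof -
      have "(\<lambda>x. \<zero>\<^bsub>k\<^esub>) ` A = {\<zero>\<^bsub>k\<^esub>}" if A: "A \<in> carrier (abelianization k L)" for A
      proof -
        obtain x where "x \<in> carrier L" "A = derived k L +> x" using A abelianization_carrier by (auto simp: image_iff)
        then have "x \<in> A" using derived_coset(2) by simp
        then show ?thesis by (rule image_constant)
      qed
      then show ?thesis unfolding restr_def Bil_simps by (intro arg_cong2[of _ _ _ _ Pair] restrict_ext) auto
    qed
    finally show "?l = ?z" .
  qed
qed

text \<open>A coboundary is evaluated through products with \<open>z\<close>, which are zero; hence
  \<open>delta\<close> does not depend on the representative of a class.\<close>

lemma B2_vanish:
  assumes b: "b \<in> B2 k L" and z: "z \<in> center L" and x: "x \<in> carrier L"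
  shows "coord b p (x, z) = \<zero>\<^bsub>k\<^esub>" "coord b p (z, x) = \<zero>\<^bsub>k\<^esub>"
proof -
  have zc: "z \<in> carrier L" using z by (simp add: center_def)
  obtain a c d where abc: "b = (a, c, d)" by (cases b)
  have "\<exists>e \<in> module_hom k L (self_module k). \<forall>x \<in> carrier L. \<forall>y \<in> carrier L.
      a (x, y) = \<ominus>\<^bsub>k\<^esub> e (x \<turnstile> y) \<and> c (x, y) = \<ominus>\<^bsub>k\<^esub> e (x \<stileturn> y) \<and> d (x, y) = \<ominus>\<^bsub>k\<^esub> e (x \<perp> y)"
    using b by (simp add: abc B2_def)
  then obtain e where e: "e \<in> module_hom k L (self_module k)"
    and v': "\<And>x y. \<lbrakk>x \<in> carrier L; y \<in> carrier L\<rbrakk> \<Longrightarrow>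
      a (x, y) = \<ominus>\<^bsub>k\<^esub> e (x \<turnstile> y) \<and> c (x, y) = \<ominus>\<^bsub>k\<^esub> e (x \<stileturn> y) \<and> d (x, y) = \<ominus>\<^bsub>k\<^esub> e (x \<perp> y)"
    by blast
  have v: "coord b p (x, y) = \<ominus>\<^bsub>k\<^esub> e (tprod L p x y)" if "x \<in> carrier L" "y \<in> carrier L" for x y p
    using v'[OF that] by (cases p) (simp_all add: abc)
  have "e \<zero> = \<zero>\<^bsub>k\<^esub>"
    using module_hom_zero[OF vectorspace_axioms self_module_vectorspace[OF field_axioms] e]
    by (simp add: self_module_def)
  then show "coord b p (x, z) = \<zero>\<^bsub>k\<^esub>" "coord b p (z, x) = \<zero>\<^bsub>k\<^esub>"
    using z x by (simp_all add: v zc center_def)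
qed

lemma delta_zero_iff:
  assumes Z: "central_ideal k L Z"
  shows "(\<forall>c \<in> carrier (H2 k L). delta k L Z c = \<zero>\<^bsub>delta_target k L Z\<^esub>) \<longleftrightarrow>
    (\<forall>f \<in> Z2 k L. \<forall>p. \<forall>x \<in> carrier L. \<forall>z \<in> Z.
      coord f p (x, z) = \<zero>\<^bsub>k\<^esub> \<and> coord f p (z, x) = \<zero>\<^bsub>k\<^esub>)"
proof -
  let ?C = "cube (Bil k L L)"
  have Zc: "Z \<subseteq> center L" using Z by (simp add: central_ideal_def)
  have Zc': "Z \<subseteq> carrier L" using Zc by (auto simp: center_def)
  \<comment> \<open>A class is a translate of \<open>B2 k L\<close>; it must be non-empty for the
    image under the restriction map to be a singleton rather than empty.\<close>
  have "\<exists>b. b \<in> B2 k L"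
  proof -
    let ?o = "\<lambda>_\<in>carrier L \<times> carrier L. \<zero>\<^bsub>k\<^esub>"
    have "?o \<in> carrier (Bil k L L)"
      by (auto simp: Bil_iff self_module_def module_hom_def)
    moreover have "(\<lambda>_. \<zero>\<^bsub>k\<^esub>) \<in> module_hom k L (self_module k)"
      by (auto simp: self_module_def module_hom_def)
    ultimately have "(?o, ?o, ?o) \<in> B2 k L"
      by (auto simp: B2_def cube_def direct_sum_def intro!: bexI[of _ "\<lambda>_. \<zero>\<^bsub>k\<^esub>"])
    then show ?thesis by blast
  qed
  then obtain b0 where b0: "b0 \<in> B2 k L" by blast
  define r where "r = (\<lambda>(fl, fr, fm). (restr k L Z fl, restr k L Z fr, restr k L Z fm))"
  have car: "carrier (H2 k L) = (\<lambda>f. (\<Union>b\<in>B2 k L. {b \<oplus>\<^bsub>?C\<^esub> f})) ` Z2 k L"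
    by (auto simp: H2_def vs_quot_def A_RCOSETS_def' a_r_coset_def')
  have r: "r (b \<oplus>\<^bsub>?C\<^esub> f) = r f" if b: "b \<in> B2 k L" and f: "f \<in> Z2 k L" for b f
  proof -
    have bf: "coord (b \<oplus>\<^bsub>?C\<^esub> f) p = coord b p \<oplus>\<^bsub>Bil k L L\<^esub> coord f p" for p
      by (cases b; cases f; cases p) (simp_all add: cube_def direct_sum_def)
    have "restr k L Z (coord (b \<oplus>\<^bsub>?C\<^esub> f) p) = restr k L Z (coord f p)" for p
    proof (rule restr_cong)
      fix x z assume x: "x \<in> carrier L" and z: "z \<in> Z"
      have zc: "z \<in> carrier L" "z \<in> center L" using z Zc Zc' by auto
      note e = Bil_eval(1)[OF Z2_bilinear[OF f, of p]]
      show "coord (b \<oplus>\<^bsub>?C\<^esub> f) p (x, z) = coord f p (x, z) \<and>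
          coord (b \<oplus>\<^bsub>?C\<^esub> f) p (z, x) = coord f p (z, x)"
        using B2_vanish[OF b zc(2) x, of p] e[OF x zc(1)] e[OF zc(1) x] x zc(1)
        by (simp add: bf Bil_simps)
    qed
    from this[of Vdash] this[of Dashv] this[of Perp] show ?thesis
      by (cases "b \<oplus>\<^bsub>?C\<^esub> f"; cases f) (simp add: r_def)
  qed
  have delta: "delta k L Z (\<Union>b\<in>B2 k L. {b \<oplus>\<^bsub>?C\<^esub> f}) = r f" if f: "f \<in> Z2 k L" for f
  proof -
    have "r ` (\<Union>b\<in>B2 k L. {b \<oplus>\<^bsub>?C\<^esub> f}) = (\<Union>b\<in>B2 k L. {r (b \<oplus>\<^bsub>?C\<^esub> f)})"
      by (simp only: image_UN image_insert image_empty)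
    also have "\<dots> = (\<Union>b\<in>B2 k L. {r f})" by (rule SUP_cong) (simp_all only: r[OF _ f])
    also have "\<dots> = {r f}" using b0 by blast
    finally show ?thesis unfolding delta_def r_def by simp
  qed
  have "r f = \<zero>\<^bsub>delta_target k L Z\<^esub> \<longleftrightarrow>
      (\<forall>p. \<forall>x \<in> carrier L. \<forall>z \<in> Z. coord f p (x, z) = \<zero>\<^bsub>k\<^esub> \<and> coord f p (z, x) = \<zero>\<^bsub>k\<^esub>)"
    if f: "f \<in> Z2 k L" for f
  proof -
    let ?z = "(\<zero>\<^bsub>Bil k (abelianization k L) (L\<lparr>carrier := Z\<rparr>)\<^esub>,
      \<zero>\<^bsub>Bil k (L\<lparr>carrier := Z\<rparr>) (abelianization k L)\<^esub>)"
    have "restr k L Z (coord f p) = ?z \<longleftrightarrow>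
        (\<forall>x \<in> carrier L. \<forall>z \<in> Z. coord f p (x, z) = \<zero>\<^bsub>k\<^esub> \<and> coord f p (z, x) = \<zero>\<^bsub>k\<^esub>)" for p
      by (rule restr_eq_zero_iff[OF Zc' Z2_bilinear[OF f]]) (use cocycle_derived[OF f] Zc in auto)
    note p = this
    have "r f = \<zero>\<^bsub>delta_target k L Z\<^esub> \<longleftrightarrow> (\<forall>p. restr k L Z (coord f p) = ?z)"
    proof -
      obtain a b c where f: "f = (a, b, c)" by (cases f)
      show ?thesis by (simp add: f all_tri r_def delta_target_def cube_def direct_sum_def)
    qed
    then show ?thesis using p by simp
  qed
  then show ?thesis unfolding car using delta by simp
qed

end

text \<open>The usual extension of \<open>L\<close> by the ground field with zero products: the
  field coordinates of the factors do not affect a product, and the cocycle is its field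
  coordinate.\<close>

definition cocycle_extension :: "('k, 'c) ring_scheme \<Rightarrow> ('k, 'a) trias
    \<Rightarrow> ('a \<times> 'a \<Rightarrow> 'k) \<times> ('a \<times> 'a \<Rightarrow> 'k) \<times> ('a \<times> 'a \<Rightarrow> 'k) \<Rightarrow> ('k, 'a \<times> 'k) trias"
  where "cocycle_extension k L f = trias_of (direct_sum L (self_module k))
    (\<lambda>p u v. (tprod L p (fst u) (fst v), coord f p (fst u, fst v)))"

text \<open>In the field coordinate the eleven axioms become the eleven cocycle identities. The
  kernel is central because the forms vanish when an argument is zero.\<close>

lemma (in trias_algebra) cocycle_extension:
  assumes f: "f \<in> Z2 k L"
  shows "central_extension k (cocycle_extension k L f) fst L"
proof -
  let ?E = "cocycle_extension k L f"
  have S: "carrier ?E = carrier L \<times> carrier k" "\<zero>\<^bsub>?E\<^esub> = (\<zero>, \<zero>\<^bsub>k\<^esub>)"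
    "u \<oplus>\<^bsub>?E\<^esub> v = (fst u \<oplus> fst v, snd u \<oplus>\<^bsub>k\<^esub> snd v)"
    "c \<odot>\<^bsub>?E\<^esub> u = (c \<odot> fst u, c \<otimes>\<^bsub>k\<^esub> snd u)"
    "tprod ?E p u v = (tprod L p (fst u) (fst v), coord f p (fst u, fst v))" for u v c p
    by (simp_all add: cocycle_extension_def direct_sum_def self_module_def)
  note b = Bil_eval[OF Z2_bilinear[OF f]]
  have "vectorspace k ?E"
    unfolding cocycle_extension_def vectorspace_trias_of
    by (rule direct_sum_is_vs[OF vectorspace_axioms self_module_vectorspace[OF field_axioms]])
  then have "triassociative k ?E"
  proof (intro triassociative.intro triassociative_axioms.intro, goal_cases)
    case (7 u v w)
    then have c: "fst u \<in> carrier L" "fst v \<in> carrier L" "fst w \<in> carrier L" by (auto simp: S)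
    show ?case
      using trias_axioms[OF c] f[unfolded Z2_iff, THEN conjunct2, rule_format, OF c] by (simp add: S) metis
  qed (auto simp: S b tprod_closed tprod_add_left tprod_add_right tprod_smult_left tprod_smult_right)
  moreover have "fst \<in> trias_hom k ?E L" by (rule trias_homI) (auto simp: S)
  moreover have "fst ` carrier ?E = carrier L" by (auto simp: S)
  moreover have "a_kernel ?E L fst \<subseteq> center ?E"
    by (auto simp: a_kernel_def kernel_def center_def S tprod_zero Bil_zero[OF Z2_bilinear[OF f]])
  ultimately show ?thesis by (simp add: central_extension_def triassociative_axioms)
qed

section \<open>From linear forms on \<open>F\<close> to cocycles on \<open>L\<close>\<close>

context trias_epi begin

text \<open>If a linear form \<open>\<mu>\<close> kills \<open>F \<lozenge> R + R \<lozenge> F\<close>, then \<open>\<mu> (u * v)\<close> depends only on the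
  images of \<open>u\<close> and \<open>v\<close> in \<open>L\<close>. The associativity laws of \<open>F\<close> therefore turn the defect of a
  linear section into a cocycle.\<close>

lemma functional_tprod_cong:
  assumes \<mu>: "\<mu> \<in> module_hom k F (self_module k)" and \<mu>0: "\<And>b. b \<in> bracket k F R \<Longrightarrow> \<mu> b = \<zero>\<^bsub>k\<^esub>"
    and c: "u \<in> carrier F" "u' \<in> carrier F" "v \<in> carrier F" "v' \<in> carrier F"
    and eq: "\<pi> u = \<pi> u'" "\<pi> v = \<pi> v'"
  shows "\<mu> (tprod F p u v) = \<mu> (tprod F p u' v')"
proof -
  note Rc = F.ideal_carrier[OF R_ideal]
  have \<mu>K: "\<mu> x \<in> carrier k" if "x \<in> carrier F" for x
    using module_homD(1)[OF \<mu> that] by (simp add: self_module_def)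
  have add: "\<mu> (x \<oplus>\<^bsub>F\<^esub> y) = \<mu> x \<oplus>\<^bsub>k\<^esub> \<mu> y" if "x \<in> carrier F" "y \<in> carrier F" for x y
    using module_homD(2)[OF \<mu> that] by (simp add: self_module_def)
  have dec: "x = (x \<ominus>\<^bsub>F\<^esub> y) \<oplus>\<^bsub>F\<^esub> y" if "x \<in> carrier F" "y \<in> carrier F" for x y
    using that by (simp add: a_minus_def F.M.a_assoc F.M.l_neg)
  let ?r = "u \<ominus>\<^bsub>F\<^esub> u'" and ?s = "v \<ominus>\<^bsub>F\<^esub> v'"
  have r: "?r \<in> R" "?s \<in> R" using diff_mem_R c eq by simp_all
  have rc: "?r \<in> carrier F" "?s \<in> carrier F" using c by simp_all
  have "\<mu> (tprod F p u v) = \<mu> (tprod F p (?r \<oplus>\<^bsub>F\<^esub> u') v)" using dec[OF c(1,2)] by simp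
  also have "\<dots> = \<mu> (tprod F p ?r v) \<oplus>\<^bsub>k\<^esub> \<mu> (tprod F p u' v)"
    using rc c F.tprod_add_left[OF rc(1) c(2,3)] add F.tprod_closed by simp
  also have "\<mu> (tprod F p ?r v) = \<zero>\<^bsub>k\<^esub>" by (rule \<mu>0[OF F.bracket_prod(2)[OF Rc c(3) r(1)]])
  also have "\<zero>\<^bsub>k\<^esub> \<oplus>\<^bsub>k\<^esub> \<mu> (tprod F p u' v) = \<mu> (tprod F p u' v)" using \<mu>K c F.tprod_closed by simp
  also have "\<dots> = \<mu> (tprod F p u' (?s \<oplus>\<^bsub>F\<^esub> v'))" using dec[OF c(3,4)] by simp
  also have "\<dots> = \<mu> (tprod F p u' ?s) \<oplus>\<^bsub>k\<^esub> \<mu> (tprod F p u' v')"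
    using rc c F.tprod_add_right[OF c(2) rc(2) c(4)] add F.tprod_closed by simp
  also have "\<mu> (tprod F p u' ?s) = \<zero>\<^bsub>k\<^esub>" by (rule \<mu>0[OF F.bracket_prod(1)[OF Rc c(2) r(2)]])
  also have "\<zero>\<^bsub>k\<^esub> \<oplus>\<^bsub>k\<^esub> \<mu> (tprod F p u' v') = \<mu> (tprod F p u' v')" using \<mu>K c F.tprod_closed by simp
  finally show ?thesis .
qed

lemma section_cocycle:
  assumes \<mu>: "\<mu> \<in> module_hom k F (self_module k)" and \<mu>0: "\<And>b. b \<in> bracket k F R \<Longrightarrow> \<mu> b = \<zero>\<^bsub>k\<^esub>"
    and s: "s \<in> module_hom k L F" "\<And>x. x \<in> carrier L \<Longrightarrow> \<pi> (s x) = x"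
  defines "g \<equiv> \<lambda>p. \<lambda>(x, y)\<in>carrier L \<times> carrier L.
    \<mu> (tprod F p (s x) (s y)) \<ominus>\<^bsub>k\<^esub> \<mu> (s (tprod L p x y))"
  shows "(g Vdash, g Dashv, g Perp) \<in> Z2 k L"
proof -
  have \<mu>K: "\<mu> x \<in> carrier k" if "x \<in> carrier F" for x
    using module_homD(1)[OF \<mu> that] by (simp add: self_module_def)
  have \<mu>add: "\<mu> (x \<oplus>\<^bsub>F\<^esub> y) = \<mu> x \<oplus>\<^bsub>k\<^esub> \<mu> y" if "x \<in> carrier F" "y \<in> carrier F" for x y
    using module_homD(2)[OF \<mu> that] by (simp add: self_module_def)
  have \<mu>smult: "\<mu> (c \<odot>\<^bsub>F\<^esub> x) = c \<otimes>\<^bsub>k\<^esub> \<mu> x" if "c \<in> carrier k" "x \<in> carrier F" for c x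
    using module_homD(3)[OF \<mu> that] by (simp add: self_module_def)
  note sc = module_homD(1)[OF s(1)]
  note cong = functional_tprod_cong[OF \<mu> \<mu>0]
  let ?f = "(g Vdash, g Dashv, g Perp)"
  have f: "coord ?f p = g p" for p by (cases p) simp_all
  have gv: "g p (x, y) = \<mu> (tprod F p (s x) (s y)) \<ominus>\<^bsub>k\<^esub> \<mu> (s (tprod L p x y))"
    if "x \<in> carrier L" "y \<in> carrier L" for p x y
    using that by (simp add: g_def)
  have gc: "g p (x, y) \<in> carrier k" if "x \<in> carrier L" "y \<in> carrier L" for p x y
    using that by (simp add: gv \<mu>K sc F.tprod_closed L.tprod_closed)
  have bil: "g p \<in> carrier (Bil k L L)" for p
    unfolding L.Bil_iff
  proof (intro conjI ballI)
    show "g p \<in> carrier L \<times> carrier L \<rightarrow>\<^sub>E carrier k"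
      using gc by (auto simp: PiE_iff) (simp add: g_def)
    fix y assume y: "y \<in> carrier L"
    show "(\<lambda>x. g p (x, y)) \<in> module_hom k L (self_module k)"
    proof (rule module_homI)
      fix x x' assume x: "x \<in> carrier L" "x' \<in> carrier L"
      show "g p (x \<oplus>\<^bsub>L\<^esub> x', y) = g p (x, y) \<oplus>\<^bsub>self_module k\<^esub> g p (x', y)"
        using x y by (simp add: gv self_module_def L.tprod_add_left module_homD(2)[OF s(1)]
            F.tprod_add_left \<mu>add \<mu>K sc F.tprod_closed L.tprod_closed a_minus_def
            F.R.minus_add F.R.a_ac)
    next
      fix c x assume c: "c \<in> carrier k" and x: "x \<in> carrier L"
      show "g p (c \<odot>\<^bsub>L\<^esub> x, y) = c \<odot>\<^bsub>self_module k\<^esub> g p (x, y)"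
        using c x y by (simp add: gv self_module_def L.tprod_smult_left module_homD(3)[OF s(1)]
            F.tprod_smult_left \<mu>smult \<mu>K sc F.tprod_closed L.tprod_closed a_minus_def
            F.R.r_distr F.R.r_minus)
    qed (use gc y in \<open>simp add: self_module_def\<close>)
    show "(\<lambda>x. g p (y, x)) \<in> module_hom k L (self_module k)"
    proof (rule module_homI)
      fix x x' assume x: "x \<in> carrier L" "x' \<in> carrier L"
      show "g p (y, x \<oplus>\<^bsub>L\<^esub> x') = g p (y, x) \<oplus>\<^bsub>self_module k\<^esub> g p (y, x')"
        using x y by (simp add: gv self_module_def L.tprod_add_right module_homD(2)[OF s(1)]
            F.tprod_add_right \<mu>add \<mu>K sc F.tprod_closed L.tprod_closed a_minus_def
            F.R.minus_add F.R.a_ac)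
    next
      fix c x assume c: "c \<in> carrier k" and x: "x \<in> carrier L"
      show "g p (y, c \<odot>\<^bsub>L\<^esub> x) = c \<odot>\<^bsub>self_module k\<^esub> g p (y, x)"
        using c x y by (simp add: gv self_module_def L.tprod_smult_right module_homD(3)[OF s(1)]
            F.tprod_smult_right \<mu>smult \<mu>K sc F.tprod_closed L.tprod_closed a_minus_def
            F.R.r_distr F.R.r_minus)
    qed (use gc y in \<open>simp add: self_module_def\<close>)
  qed
  \<comment> \<open>The section does not preserve products, but \<open>s (x * y)\<close> and
    \<open>s x * s y\<close> have the same image in \<open>L\<close>, so \<open>cong\<close>
    exchanges them inside a product under \<open>\<mu>\<close>. What remains are triple products in
    \<open>F\<close> and in \<open>L\<close>.\<close>
  have left: "g q (tprod L p x y, z) =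
      \<mu> (tprod F q (tprod F p (s x) (s y)) (s z)) \<ominus>\<^bsub>k\<^esub> \<mu> (s (tprod L q (tprod L p x y) z))"
    and right: "g q (x, tprod L p y z) =
      \<mu> (tprod F q (s x) (tprod F p (s y) (s z))) \<ominus>\<^bsub>k\<^esub> \<mu> (s (tprod L q x (tprod L p y z)))"
    if "x \<in> carrier L" "y \<in> carrier L" "z \<in> carrier L" for p q x y z
  proof -
    have "\<mu> (tprod F q (s (tprod L p x y)) (s z)) = \<mu> (tprod F q (tprod F p (s x) (s y)) (s z))"
      by (rule cong) (use that in \<open>simp_all add: sc F.tprod_closed L.tprod_closed s(2) trias_homD(4)[OF hom]\<close>)
    then show "g q (tprod L p x y, z) =
      \<mu> (tprod F q (tprod F p (s x) (s y)) (s z)) \<ominus>\<^bsub>k\<^esub> \<mu> (s (tprod L q (tprod L p x y) z))"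
      using that by (simp add: gv L.tprod_closed)
    have "\<mu> (tprod F q (s x) (s (tprod L p y z))) = \<mu> (tprod F q (s x) (tprod F p (s y) (s z)))"
      by (rule cong) (use that in \<open>simp_all add: sc F.tprod_closed L.tprod_closed s(2) trias_homD(4)[OF hom]\<close>)
    then show "g q (x, tprod L p y z) =
      \<mu> (tprod F q (s x) (tprod F p (s y) (s z))) \<ominus>\<^bsub>k\<^esub> \<mu> (s (tprod L q x (tprod L p y z)))"
      using that by (simp add: gv L.tprod_closed)
  qed
  show ?thesis
    unfolding L.Z2_iff f
  proof (intro conjI[OF allI[OF bil]] ballI)
    fix x y z assume c: "x \<in> carrier L" "y \<in> carrier L" "z \<in> carrier L"
    note A = L.trias_axioms[OF c] F.trias_axioms[OF sc[OF c(1)] sc[OF c(2)] sc[OF c(3)]]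
    show "g Vdash (x \<turnstile>\<^bsub>L\<^esub> y, z) = g Vdash (x, y \<turnstile>\<^bsub>L\<^esub> z)
      \<and> g Dashv (x \<stileturn>\<^bsub>L\<^esub> y, z) = g Dashv (x, y \<stileturn>\<^bsub>L\<^esub> z)
      \<and> g Vdash (x \<stileturn>\<^bsub>L\<^esub> y, z) = g Vdash (x, y \<turnstile>\<^bsub>L\<^esub> z)
      \<and> g Dashv (x \<stileturn>\<^bsub>L\<^esub> y, z) = g Dashv (x, y \<turnstile>\<^bsub>L\<^esub> z)
      \<and> g Dashv (x \<turnstile>\<^bsub>L\<^esub> y, z) = g Vdash (x, y \<stileturn>\<^bsub>L\<^esub> z)
      \<and> g Vdash (x \<perp>\<^bsub>L\<^esub> y, z) = g Vdash (x, y \<turnstile>\<^bsub>L\<^esub> z)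
      \<and> g Dashv (x \<stileturn>\<^bsub>L\<^esub> y, z) = g Dashv (x, y \<perp>\<^bsub>L\<^esub> z)
      \<and> g Perp (x \<turnstile>\<^bsub>L\<^esub> y, z) = g Vdash (x, y \<perp>\<^bsub>L\<^esub> z)
      \<and> g Dashv (x \<perp>\<^bsub>L\<^esub> y, z) = g Perp (x, y \<stileturn>\<^bsub>L\<^esub> z)
      \<and> g Perp (x \<stileturn>\<^bsub>L\<^esub> y, z) = g Perp (x, y \<turnstile>\<^bsub>L\<^esub> z)
      \<and> g Perp (x \<perp>\<^bsub>L\<^esub> y, z) = g Perp (x, y \<perp>\<^bsub>L\<^esub> z)"
      unfolding left[OF c] right[OF c] using A by metis
  qed
qed

end

section \<open>Condition (1) in terms of brackets\<close>

context trias_epi_central begin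

lemma delta_zero_iff_bracket:
  assumes F: "free_on k F X"
  shows "(\<forall>c \<in> carrier (H2 k L). delta k L Z c = \<zero>\<^bsub>delta_target k L Z\<^esub>) \<longleftrightarrow>
    bracket k F T \<subseteq> bracket k F R"
  unfolding L.delta_zero_iff[OF Z]
proof
  assume sub: "bracket k F T \<subseteq> bracket k F R"
  show "\<forall>f \<in> Z2 k L. \<forall>p. \<forall>x \<in> carrier L. \<forall>z \<in> Z.
      coord f p (x, z) = \<zero>\<^bsub>k\<^esub> \<and> coord f p (z, x) = \<zero>\<^bsub>k\<^esub>"
  proof (intro ballI allI)
    fix f p x z assume f: "f \<in> Z2 k L" and x: "x \<in> carrier L" and z: "z \<in> Z"
    let ?E = "cocycle_extension k L f"
    have "z \<in> fst ` center ?E"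
      by (rule central_extension_center[OF F sub L.cocycle_extension[OF f] z])
    then obtain a where a: "(z, a) \<in> center ?E" by auto
    have "(x, \<zero>\<^bsub>k\<^esub>) \<in> carrier ?E"
      using x by (simp add: cocycle_extension_def direct_sum_def self_module_def)
    \<comment> \<open>The field coordinates of these products are the values of \<open>f\<close> on
      \<open>(z, x)\<close> and \<open>(x, z)\<close>.\<close>
    then have "tprod ?E p (z, a) (x, \<zero>\<^bsub>k\<^esub>) = \<zero>\<^bsub>?E\<^esub>" "tprod ?E p (x, \<zero>\<^bsub>k\<^esub>) (z, a) = \<zero>\<^bsub>?E\<^esub>"
      using a by (simp_all only: center_def mem_Collect_eq)
    then show "coord f p (x, z) = \<zero>\<^bsub>k\<^esub> \<and> coord f p (z, x) = \<zero>\<^bsub>k\<^esub>"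
      by (simp add: cocycle_extension_def direct_sum_def self_module_def)
  qed
next
  assume van: "\<forall>f \<in> Z2 k L. \<forall>p. \<forall>x \<in> carrier L. \<forall>z \<in> Z.
      coord f p (x, z) = \<zero>\<^bsub>k\<^esub> \<and> coord f p (z, x) = \<zero>\<^bsub>k\<^esub>"
  note Rc = F.ideal_carrier[OF R_ideal]
  note K = self_module_vectorspace[OF F.field_axioms]
  obtain s where s: "s \<in> module_hom k L F" "\<And>x. x \<in> carrier L \<Longrightarrow> \<pi> (s x) = x"
    by (rule linear_section[OF F.vectorspace_axioms L.vectorspace_axioms linear surj], rule that)
  note sc = module_homD(1)[OF s(1)]
  show "bracket k F T \<subseteq> bracket k F R"
  proof (rule subsetI, rule ccontr)
    fix t0 assume t0: "t0 \<in> bracket k F T" "t0 \<notin> bracket k F R"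
    have t0c: "t0 \<in> carrier F" using t0(1) F.ideal_carrier[OF F.bracket_ideal[OF T_ideal]] by blast
    obtain \<mu> where \<mu>: "\<mu> \<in> module_hom k F (self_module k)" and \<mu>0: "\<And>b. b \<in> bracket k F R \<Longrightarrow> \<mu> b = \<zero>\<^bsub>k\<^esub>"
      and \<mu>t: "\<mu> t0 \<noteq> \<zero>\<^bsub>k\<^esub>"
      by (rule separating_functional[OF F.vectorspace_axioms F.bracket_subspace[OF Rc] t0c t0(2)], rule that)
    define g where "g p = (\<lambda>(x, y)\<in>carrier L \<times> carrier L.
      \<mu> (tprod F p (s x) (s y)) \<ominus>\<^bsub>k\<^esub> \<mu> (s (tprod L p x y)))" for p
    have g: "(g Vdash, g Dashv, g Perp) \<in> Z2 k L"
      unfolding g_def by (rule section_cocycle[OF \<mu> \<mu>0 s])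
    have coord: "coord (g Vdash, g Dashv, g Perp) p = g p" for p by (cases p) simp_all
    have \<mu>K: "\<mu> x \<in> carrier k" if "x \<in> carrier F" for x
      using module_homD(1)[OF \<mu> that] by (simp add: self_module_def)
    have \<mu>z: "\<mu> (s \<zero>\<^bsub>L\<^esub>) = \<zero>\<^bsub>k\<^esub>"
      using module_hom_zero[OF L.vectorspace_axioms F.vectorspace_axioms s(1)]
        module_hom_zero[OF F.vectorspace_axioms K \<mu>] by (simp add: self_module_def)
    \<comment> \<open>Products of \<open>x\<close> with \<open>z\<close> vanish in \<open>L\<close>,
      so the correction term of \<open>g\<close> is zero and \<open>g\<close> is just
      \<open>\<mu>\<close> of the product of lifts.\<close>
    have sz: "\<mu> (tprod F p (s x) (s z)) = \<zero>\<^bsub>k\<^esub> \<and> \<mu> (tprod F p (s z) (s x)) = \<zero>\<^bsub>k\<^esub>"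
      if x: "x \<in> carrier L" and z: "z \<in> Z" for p x z
    proof -
      have zc: "z \<in> carrier L" using subsetD[OF Z_center z] by (simp add: center_def)
      have "tprod L p x z = \<zero>\<^bsub>L\<^esub>" "tprod L p z x = \<zero>\<^bsub>L\<^esub>"
        using subsetD[OF Z_center z] x by (simp_all add: center_def)
      moreover have "g p (x, z) = \<zero>\<^bsub>k\<^esub>" "g p (z, x) = \<zero>\<^bsub>k\<^esub>"
        using van[rule_format, OF g x z, of p] by (simp_all add: coord)
      ultimately show ?thesis
        using x zc by (simp add: g_def \<mu>z \<mu>K sc F.tprod_closed a_minus_def)
    qed
    have "bracket k F T \<subseteq> {x \<in> carrier F. \<mu> x = \<zero>\<^bsub>self_module k\<^esub>}"
    proof (rule F.bracket_least[OF kernel_subspace[OF F.vectorspace_axioms K \<mu>]])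
      fix p y t assume y: "y \<in> carrier F" and t: "t \<in> T"
      have c: "\<pi> y \<in> carrier L" "\<pi> t \<in> carrier L" "t \<in> carrier F" "\<pi> t \<in> Z"
        using trias_homD(1)[OF hom] y t by auto
      \<comment> \<open>Arbitrary \<open>y\<close> and \<open>t\<close> may be replaced by the
        chosen lifts of their images. Thus \<open>\<mu>\<close> kills the whole bracket of
        \<open>T\<close>, contrary to the choice of \<open>t0\<close>.\<close>
      have "\<mu> (tprod F p y t) = \<mu> (tprod F p (s (\<pi> y)) (s (\<pi> t)))"
        "\<mu> (tprod F p t y) = \<mu> (tprod F p (s (\<pi> t)) (s (\<pi> y)))"
        by (rule functional_tprod_cong[OF \<mu> \<mu>0]; simp add: c y s(2) sc)+
      then show "tprod F p y t \<in> {x \<in> carrier F. \<mu> x = \<zero>\<^bsub>self_module k\<^esub>} \<and>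
          tprod F p t y \<in> {x \<in> carrier F. \<mu> x = \<zero>\<^bsub>self_module k\<^esub>}"
        using sz[OF c(1,4)] y c(3) F.tprod_closed by (simp add: self_module_def)
    qed
    then show False using t0(1) \<mu>t by (auto simp: self_module_def)
  qed
qed

end

section \<open>Covers and their multipliers compared with the quotient
  \<open>(R \<inter> F') / [F, R]\<close>\<close>

section \<open>Multipliers\<close>

text \<open>Exactness and the splitting make \<open>B\<close> the direct sum of the image of
  \<open>\<beta>\<close> and that of \<open>s\<close>. Dividing by the second summand therefore
  leaves a surjection with the same kernel as \<open>\<beta>\<close>, whatever
  \<open>\<theta>\<close> and \<open>s\<close> are.\<close>

lemma complementary_quotient:
  assumes A: "vectorspace k A" and B: "vectorspace k B" and Y: "vectorspace k Y" and B1: "vectorspace k B1"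
    and \<beta>: "\<beta> \<in> module_hom k A B" and \<nu>: "\<nu> \<in> module_hom k B Y"
    and exact: "\<beta> ` carrier A = {b \<in> carrier B. \<nu> b = \<zero>\<^bsub>Y\<^esub>}"
    and s: "s \<in> module_hom k Y B" "\<forall>y \<in> carrier Y. \<nu> (s y) = y"
    and \<theta>: "\<theta> \<in> vs_isos k B B1"
  defines "N \<equiv> \<theta> ` s ` carrier Y"
  shows "subspace k N B1"
    and "(\<lambda>x. N +>\<^bsub>B1\<^esub> \<theta> (\<beta> x)) \<in> module_hom k A (vs_quot B1 N)"
    and "(\<lambda>x. N +>\<^bsub>B1\<^esub> \<theta> (\<beta> x)) ` carrier A = carrier (vs_quot B1 N)"
    and "inj_on (\<lambda>x. N +>\<^bsub>B1\<^esub> \<theta> (\<beta> x)) (carrier A) \<longleftrightarrow> inj_on \<beta> (carrier A)"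
proof -
  interpret A: vectorspace k A by fact
  interpret B: vectorspace k B by fact
  interpret Y: vectorspace k Y by fact
  interpret B1: vectorspace k B1 by fact
  note th = vs_isosD[OF \<theta>]
  note cA = module_homD[OF \<beta>] and cB = module_homD[OF \<nu>] and cY = module_homD[OF s(1)]
    and cT = module_homD[OF th(1)]
  have \<theta>s: "(\<lambda>y. \<theta> (s y)) \<in> module_hom k Y B1" by (rule module_hom_comp[OF s(1) th(1)])
  have N: "N = (\<lambda>y. \<theta> (s y)) ` carrier Y" by (auto simp: N_def)
  show sub: "subspace k N B1"
  proof -
    interpret l: linear_map k Y B1 "\<lambda>y. \<theta> (s y)" by (rule linear_mapI[OF Y B1 \<theta>s])
    show ?thesis using l.imT_is_subspace by (simp only: l.im_def N)
  qed
  let ?Q = "vs_quot B1 N" and ?f = "\<lambda>x. N +>\<^bsub>B1\<^esub> \<theta> (\<beta> x)"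
  note Q = vs_quot[OF B1 sub]
  interpret Q: vectorspace k ?Q by (rule Q(1))
  show f: "?f \<in> module_hom k A ?Q"
    by (rule module_hom_comp[OF module_hom_comp[OF \<beta> th(1)] vs_quot_proj[OF B1 sub]])
  have zero: "?f x = \<zero>\<^bsub>?Q\<^esub> \<longleftrightarrow> \<beta> x = \<zero>\<^bsub>B\<^esub>" if x: "x \<in> carrier A" for x
  proof -
    have b: "\<beta> x \<in> carrier B" using cA(1)[OF x] .
    have "?f x = \<zero>\<^bsub>?Q\<^esub> \<longleftrightarrow> \<theta> (\<beta> x) \<in> N"
      using vs_quot_eq_zero[OF B1 sub cT(1)[OF b]] by (simp add: Q(3))
    also have "\<dots> \<longleftrightarrow> (\<exists>y \<in> carrier Y. \<theta> (\<beta> x) = \<theta> (s y))" by (auto simp: N)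
    also have "\<dots> \<longleftrightarrow> (\<exists>y \<in> carrier Y. \<beta> x = s y)"
      using inj_on_eq_iff[OF th(3) b cY(1)] by auto
    also have "\<dots> \<longleftrightarrow> \<beta> x = \<zero>\<^bsub>B\<^esub>"
    proof
      \<comment> \<open>Applying \<open>\<nu>\<close> kills the left side and returns
        \<open>y\<close> on the right, so the two summands meet only in zero.\<close>
      assume "\<exists>y \<in> carrier Y. \<beta> x = s y"
      then obtain y where y: "y \<in> carrier Y" "\<beta> x = s y" by blast
      have "\<nu> (\<beta> x) = \<zero>\<^bsub>Y\<^esub>" using exact x by blast
      then have "y = \<zero>\<^bsub>Y\<^esub>" using bspec[OF s(2) y(1)] y(2) by simp
      then show "\<beta> x = \<zero>\<^bsub>B\<^esub>" using y(2) module_hom_zero[OF Y B s(1)] by simp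
    next
      assume "\<beta> x = \<zero>\<^bsub>B\<^esub>"
      then show "\<exists>y \<in> carrier Y. \<beta> x = s y"
        using module_hom_zero[OF Y B s(1)] by (intro bexI[of _ "\<zero>\<^bsub>Y\<^esub>"]) auto
    qed
    finally show ?thesis .
  qed
  show "?f ` carrier A = carrier ?Q"
  proof
    show "?f ` carrier A \<subseteq> carrier ?Q" using module_homD(1)[OF f] by blast
    show "carrier ?Q \<subseteq> ?f ` carrier A"
    proof
      fix X assume "X \<in> carrier ?Q"
      then obtain c where c: "c \<in> carrier B1" "X = N +>\<^bsub>B1\<^esub> c" by (auto simp: Q(2))
      have "c \<in> \<theta> ` carrier B" using c(1) by (simp only: th(2))
      then obtain b where b: "b \<in> carrier B" "c = \<theta> b" by blast
      \<comment> \<open>Subtracting \<open>s (\<nu> b)\<close> from \<open>b\<close> leaves an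
        element of the kernel of \<open>\<nu>\<close>, hence of the image of
        \<open>\<beta>\<close>.\<close>
      let ?y = "\<nu> b"
      have y: "?y \<in> carrier Y" using cB(1)[OF b(1)] .
      have sy: "s ?y \<in> carrier B" using cY(1)[OF y] .
      have "\<nu> (b \<ominus>\<^bsub>B\<^esub> s ?y) = \<zero>\<^bsub>Y\<^esub>"
        using module_hom_eq_iff[OF B Y \<nu> b(1) sy] bspec[OF s(2) y] by simp
      moreover have d: "b \<ominus>\<^bsub>B\<^esub> s ?y \<in> carrier B" using b sy by simp
      ultimately have "b \<ominus>\<^bsub>B\<^esub> s ?y \<in> \<beta> ` carrier A" by (simp add: exact)
      then obtain x where x: "x \<in> carrier A" "b \<ominus>\<^bsub>B\<^esub> s ?y = \<beta> x" by blast
      have "b = (b \<ominus>\<^bsub>B\<^esub> s ?y) \<oplus>\<^bsub>B\<^esub> s ?y" using b sy by (simp add: a_minus_def B.M.a_assoc B.M.l_neg)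
      then have "b = \<beta> x \<oplus>\<^bsub>B\<^esub> s ?y" using x(2) by simp
      then have "\<theta> b = \<theta> (\<beta> x \<oplus>\<^bsub>B\<^esub> s ?y)" by simp
      then have "\<theta> b = \<theta> (\<beta> x) \<oplus>\<^bsub>B1\<^esub> \<theta> (s ?y)" using cT(2)[OF cA(1)[OF x(1)] sy] by simp
      then have "X = ?f x \<oplus>\<^bsub>?Q\<^esub> (N +>\<^bsub>B1\<^esub> \<theta> (s ?y))"
        using Q(4)[OF cT(1)[OF cA(1)[OF x(1)]] cT(1)[OF sy]] c(2) b(2) by simp
      also have "N +>\<^bsub>B1\<^esub> \<theta> (s ?y) = \<zero>\<^bsub>?Q\<^esub>"
        using vs_quot_eq_zero[OF B1 sub cT(1)[OF sy]] y by (simp add: Q(3)) (auto simp: N)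
      finally have "X = ?f x" using module_homD(1)[OF f x(1)] by simp
      then show "X \<in> ?f ` carrier A" using x(1) by blast
    qed
  qed
  show "inj_on ?f (carrier A) \<longleftrightarrow> inj_on \<beta> (carrier A)"
  proof
    assume i: "inj_on ?f (carrier A)"
    show "inj_on \<beta> (carrier A)" by (rule inj_onI, rule inj_onD[OF i]) simp_all
  next
    assume i: "inj_on \<beta> (carrier A)"
    show "inj_on ?f (carrier A)"
    proof (rule inj_on_if_kernel_trivial[OF A Q(1) f])
      fix x assume x: "x \<in> carrier A" "?f x = \<zero>\<^bsub>?Q\<^esub>"
      then have "\<beta> x = \<beta> \<zero>\<^bsub>A\<^esub>" using zero module_hom_zero[OF A B \<beta>] by simp
      then show "x = \<zero>\<^bsub>A\<^esub>" by (rule inj_onD[OF i]) (use x in simp_all)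
    qed
  qed
qed

lemma dim_kernel:
  assumes V: "vectorspace k V" and W: "vectorspace k W" and f: "f \<in> module_hom k V W"
    and surj: "f ` carrier V = carrier W" and fd: "vectorspace.fin_dim k V"
    and K: "a_kernel V W f = K"
  shows "vectorspace.dim k W + vectorspace.dim k (V\<lparr>carrier := K\<rparr>) = vectorspace.dim k V"
proof -
  interpret linear_map k V W f by (rule linear_mapI[OF V W f])
  have "ker = K" using K by (simp add: ker_def a_kernel_def kernel_def)
  moreover have "im = carrier W" using surj by (simp add: im_def)
  ultimately show ?thesis using rank_nullity[OF fd] by simp
qed

context trias_epi begin

text \<open>The lift itself may fail to be onto, but \<open>E\<close> is the sum of its image and
  central elements. The latter drop out of products, so every product in \<open>E\<close> is a
  product of lifted elements.\<close>

lemma lift_derived_surj: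
  assumes ext: "central_extension k E \<omega> L" and h: "h \<in> trias_hom k F E"
    "\<And>x. x \<in> carrier F \<Longrightarrow> \<omega> (h x) = \<pi> x"
  shows "derived k E \<subseteq> h ` derived k F"
proof -
  have E: "triassociative k E" and \<omega>: "\<omega> \<in> trias_hom k E L"
    and ker: "a_kernel E L \<omega> \<subseteq> center E"
    using ext by (auto simp: central_extension_def)
  interpret E: triassociative k E by fact
  note d = subspaceD[OF F.derived_subspace]
  have lin: "h \<in> module_hom k F E" using h(1) by (simp add: trias_hom_def)
  have dec: "\<exists>y \<in> carrier F. \<exists>m \<in> center E. e = h y \<oplus>\<^bsub>E\<^esub> m" if e: "e \<in> carrier E" for e
  proof -
    obtain y where y: "y \<in> carrier F" "\<pi> y = \<omega> e" by (rule preimage[OF trias_homD(1)[OF \<omega> e]])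
    have hy: "h y \<in> carrier E" using trias_homD(1)[OF h(1) y(1)] .
    let ?m = "e \<ominus>\<^bsub>E\<^esub> h y"
    have mc: "?m \<in> carrier E" using e hy by simp
    have "\<omega> \<in> module_hom k E L" using \<omega> by (simp add: trias_hom_def)
    then have "\<omega> ?m = \<zero>\<^bsub>L\<^esub>"
      using module_hom_eq_iff[OF E.vectorspace_axioms L.vectorspace_axioms _ e hy] h(2)[OF y(1)] y(2) by metis
    then have "?m \<in> a_kernel E L \<omega>" using mc by (simp add: a_kernel_def kernel_def)
    then have "?m \<in> center E" using ker by blast
    moreover have "e = h y \<oplus>\<^bsub>E\<^esub> ?m" using e hy by (simp add: a_minus_def E.M.a_lcomm E.M.r_neg)
    ultimately show ?thesis using y(1) by blast
  qed
  show ?thesis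
  proof (rule E.derived_least)
    show "subspace k (h ` derived k F) E"
    proof -
      let ?D = "F\<lparr>carrier := derived k F\<rparr>"
      have hD: "h \<in> module_hom k ?D E" by (rule hom_restrict_carrier[OF lin d(1)])
      interpret l: linear_map k ?D E h
        by (rule linear_mapI[OF subspace_vectorspace[OF F.vectorspace_axioms F.derived_subspace]
              E.vectorspace_axioms hD])
      show ?thesis using l.imT_is_subspace by (simp add: l.im_def)
    qed
    fix p x y assume "x \<in> carrier E" "y \<in> carrier E"
    then obtain u m v n where u: "u \<in> carrier F" "m \<in> center E" "x = h u \<oplus>\<^bsub>E\<^esub> m"
      and v: "v \<in> carrier F" "n \<in> center E" "y = h v \<oplus>\<^bsub>E\<^esub> n" using dec by meson
    have c: "h u \<in> carrier E" "h v \<in> carrier E" using trias_homD(1)[OF h(1)] u v by auto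
    have mn: "m \<in> carrier E" "n \<in> carrier E"
      "\<And>x. x \<in> carrier E \<Longrightarrow> tprod E p m x = \<zero>\<^bsub>E\<^esub>" "\<And>x. x \<in> carrier E \<Longrightarrow> tprod E p x n = \<zero>\<^bsub>E\<^esub>"
      using u v by (simp_all add: center_def)
    have "tprod E p x y = tprod E p (h u) (h v)"
      using c mn by (simp add: u(3) v(3) E.tprod_add_left E.tprod_add_right E.tprod_closed)
    also have "\<dots> = h (tprod F p u v)" using trias_homD(4)[OF h(1)] u v by simp
    finally show "tprod E p x y \<in> h ` derived k F" using F.derived_prod[OF u(1) v(1)] by simp
  qed
qed

text \<open>Used twice: for the lift to a cover, where \<open>N\<close> is its multiplier, and for
  the projection onto \<open>F / S\<close>, where \<open>N\<close> is \<open>R / S\<close>.\<close>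

lemma hopf_lift:
  assumes E: "triassociative k E" and h: "h \<in> trias_hom k F E"
    and h0: "\<And>b. b \<in> bracket k F R \<Longrightarrow> h b = \<zero>\<^bsub>E\<^esub>"
    and N: "subspace k N E" "h ` (R \<inter> derived k F) = N"
  obtains g where "g \<in> module_hom k (hopf k F R) (E\<lparr>carrier := N\<rparr>)" "g ` carrier (hopf k F R) = N"
    "\<And>x. x \<in> R \<inter> derived k F \<Longrightarrow> g (bracket k F R +>\<^bsub>F\<^esub> x) = h x"
proof -
  interpret E: triassociative k E by fact
  note H = F.hopf[OF R_ideal]
  let ?V = "F\<lparr>carrier := R \<inter> derived k F\<rparr>" and ?N = "E\<lparr>carrier := N\<rparr>"
  have N': "vectorspace k ?N" by (rule subspace_vectorspace[OF E.vectorspace_axioms N(1)])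
  have Rc: "R \<subseteq> carrier F" by (rule F.ideal_carrier[OF R_ideal])
  have hV: "h \<in> module_hom k ?V ?N"
    using trias_homD[OF h] Rc N(2) by (intro module_homI) (auto simp: subset_iff)
  have h0': "h b = \<zero>\<^bsub>?N\<^esub>" if "b \<in> bracket k F R" for b using h0[OF that] by simp
  let ?g = "\<lambda>C. the_elem (h ` C)"
  have g: "?g \<in> module_hom k (hopf k F R) ?N"
    unfolding hopf_def by (rule quot_lift(1)[OF H(1) N' H(2) hV h0'])
  have app: "?g (bracket k F R +>\<^bsub>F\<^esub> x) = h x" if "x \<in> R \<inter> derived k F" for x
    by (simp only: F.hopf_image[OF R_ideal N' hV h0' that] the_elem_eq)
  have "?g ` carrier (hopf k F R) = h ` (R \<inter> derived k F)"
    unfolding H(4) image_image by (rule image_cong[OF refl app])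
  then show thesis using that[OF g _ app] N(2) by simp
qed

end

context trias_epi begin

text \<open>A complement \<open>S\<close> of \<open>R \<inter> F'\<close> in \<open>R\<close>, relative to \<open>F \<lozenge> R + R \<lozenge> F\<close>, yields a defining
  pair \<open>(F / S, R / S)\<close> whose kernel is a copy of \<open>(R \<inter> F') / (F \<lozenge> R + R \<lozenge> F)\<close>.\<close>

lemma hopf_defining_pair:
  obtains K :: "('k, 'f set) trias" and N g where "defining_pair k L K N"
    "g \<in> vs_isos k (hopf k F R) (K\<lparr>carrier := N\<rparr>)"
proof -
  let ?B = "bracket k F R" and ?D = "R \<inter> derived k F"
  have Rs: "subspace k R F" using R_ideal by (simp add: trias_ideal_def)
  note Rc = F.ideal_carrier[OF R_ideal]
  note B = F.bracket_subspace[OF Rc]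
  obtain S where S: "subspace k S F" "?B \<subseteq> S" "S \<subseteq> R" "S \<inter> ?D \<subseteq> ?B"
    and dec: "\<And>u. u \<in> R \<Longrightarrow> \<exists>s\<in>S. \<exists>d\<in>?D. u = s \<oplus>\<^bsub>F\<^esub> d"
    by (rule relative_complement[OF F.vectorspace_axioms B F.Int_derived_subspace[OF Rs] Rs
          F.bracket_ideal_subset[OF R_ideal]], rule that)
  \<comment> \<open>Every subspace between the bracket of \<open>R\<close> and \<open>R\<close> is
    an ideal, since products with elements of \<open>R\<close> already lie in the bracket.\<close>
  have SI: "trias_ideal k F S"
    unfolding trias_ideal_def
    using S(1) F.bracket_prod[OF Rc _ subsetD[OF S(3)]] subsetD[OF S(2)] by simp
  let ?K = "trias_quot F S" and ?p = "\<lambda>x. S +>\<^bsub>F\<^esub> x"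
  note Q = F.trias_quot_simps[OF SI]
  have ext: "central_extension k ?K quot_proj L"
    by (rule quot_central_extension[OF SI S(2,3)])
  have K: "triassociative k ?K" and q: "quot_proj \<in> trias_hom k ?K L"
    "quot_proj ` carrier ?K = carrier L" and ker: "a_kernel ?K L quot_proj \<subseteq> center ?K"
    using ext by (auto simp: central_extension_def)
  interpret K: triassociative k ?K by (rule K)
  interpret q: trias_epi k ?K L quot_proj
    by (intro trias_epi.intro trias_algebra.intro trias_epi_axioms.intro K L.triassociative_axioms q)
  have p: "?p \<in> trias_hom k F ?K" by (rule trias_homI) (auto simp: Q(1,3-5))
  have plin: "?p \<in> module_hom k F ?K" using p by (simp add: trias_hom_def)
  have p0: "?p x = \<zero>\<^bsub>?K\<^esub> \<longleftrightarrow> x \<in> S" if "x \<in> carrier F" for x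
    using vs_quot_eq_zero[OF F.vectorspace_axioms S(1) that] by (simp add: Q(2))
  \<comment> \<open>Because \<open>S\<close> and \<open>R \<inter> F'\<close> span \<open>R\<close>,
    the kernel \<open>R / S\<close> is the image of \<open>R \<inter> F'\<close> and so lies in the
    derived algebra.\<close>
  have N: "?p ` ?D = q.R"
  proof
    show "?p ` ?D \<subseteq> q.R"
      using Rc R_iff quot_proj_apply[OF SI S(3)] by (auto simp: q.R_iff Q(1))
    show "q.R \<subseteq> ?p ` ?D"
    proof
      fix C assume "C \<in> q.R"
      then have C: "C \<in> carrier ?K" "quot_proj C = \<zero>\<^bsub>L\<^esub>" by (simp_all add: q.R_iff)
      then obtain x where x: "x \<in> carrier F" "C = ?p x" by (auto simp: Q(1))
      have "x \<in> R" using C(2) x quot_proj_apply[OF SI S(3)] by (simp add: R_iff)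
      then obtain s d where s: "s \<in> S" "d \<in> ?D" "x = s \<oplus>\<^bsub>F\<^esub> d" using dec by blast
      have c: "s \<in> carrier F" "d \<in> carrier F" using s Rc S(3) by auto
      have "C = ?p s \<oplus>\<^bsub>?K\<^esub> ?p d" using Q(3)[OF c] x(2) s(3) by simp
      also have "?p s = \<zero>\<^bsub>?K\<^esub>" using p0[OF c(1)] s(1) by simp
      finally have "C = ?p d" using c(2) module_homD(1)[OF plin] by simp
      then show "C \<in> ?p ` ?D" using s(2) by blast
    qed
  qed
  have "?p ` ?D \<subseteq> derived k ?K"
    using trias_hom_derived[OF F.triassociative_axioms K p] by blast
  then have "q.R \<subseteq> derived k ?K" by (simp only: N)
  then have def: "defining_pair k L ?K q.R"
    unfolding defining_pair_iff[OF L.triassociative_axioms]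
    using K q.R_ideal q ker by blast
  have NS: "subspace k q.R ?K" using q.R_ideal by (simp add: trias_ideal_def)
  have B0: "?p b = \<zero>\<^bsub>?K\<^esub>" if "b \<in> ?B" for b
    using p0[of b] that S(2) subspaceD(1)[OF B] by blast
  obtain g where g: "g \<in> module_hom k (hopf k F R) (?K\<lparr>carrier := q.R\<rparr>)"
      "g ` carrier (hopf k F R) = q.R"
    and app: "\<And>x. x \<in> ?D \<Longrightarrow> g (?B +>\<^bsub>F\<^esub> x) = ?p x"
    by (rule hopf_lift[OF K p B0 NS N], assumption, rule that)
  note H = F.hopf[OF R_ideal]
  have "g \<in> vs_isos k (hopf k F R) (?K\<lparr>carrier := q.R\<rparr>)"
  proof (rule vs_isosI[OF g(1)])
    show "g ` carrier (hopf k F R) = carrier (?K\<lparr>carrier := q.R\<rparr>)" using g(2) by simp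
    show "inj_on g (carrier (hopf k F R))"
    proof (rule inj_on_if_kernel_trivial[OF H(3) subspace_vectorspace[OF K.vectorspace_axioms NS] g(1)])
      fix C assume "C \<in> carrier (hopf k F R)" and 0: "g C = \<zero>\<^bsub>?K\<lparr>carrier := q.R\<rparr>\<^esub>"
      then obtain x where x: "x \<in> ?D" "C = ?B +>\<^bsub>F\<^esub> x" by (auto simp: H(4))
      have xc: "x \<in> carrier F" using x(1) Rc by blast
      have "x \<in> S" using 0 p0[OF xc] app[OF x(1)] by (simp add: x(2))
      then have "x \<in> ?B" using S(4) x(1) by blast
      then show "C = \<zero>\<^bsub>hopf k F R\<^esub>" using H(5) H(7)[OF xc] x(2) by simp
    qed
  qed
  with def that show thesis by blast
qed

text \<open>A free lift maps \<open>hopf k F R\<close> onto \<open>M\<close>. Conversely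
  \<open>F / S\<close> is a defining pair whose kernel is a copy of \<open>hopf k F R\<close>, so
  maximality of the cover bounds the dimension of \<open>hopf k F R\<close> by that of
  \<open>M\<close> and makes the surjection injective.\<close>

lemma hopf_cover_iso:
  fixes C :: "('k, 'b) trias"
  assumes F: "free_on k F X" and cov: "cover k L C M"
  obtains g where "g \<in> vs_isos k (hopf k F R) (C\<lparr>carrier := M\<rparr>)" "vectorspace.fin_dim k (hopf k F R)"
proof -
  note H = F.hopf[OF R_ideal]
  have defC: "defining_pair k L C M" and fdC: "vectorspace.fin_dim k C"
    using cov by (auto simp: cover_def)
  then have C: "triassociative k C" and MI: "trias_ideal k C M" and Mc: "M \<subseteq> center C \<inter> derived k C"
    and exq: "\<exists>\<omega> \<in> trias_hom k C L. \<omega> ` carrier C = carrier L \<and> a_kernel C L \<omega> = M"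
    unfolding defining_pair_iff[OF L.triassociative_axioms] by auto
  from exq obtain \<omega> where \<omega>: "\<omega> \<in> trias_hom k C L" "\<omega> ` carrier C = carrier L" "a_kernel C L \<omega> = M"
    by blast
  have ext: "central_extension k C \<omega> L"
    using C \<omega> Mc L.triassociative_axioms by (simp add: central_extension_def)
  interpret C: triassociative k C by (rule C)
  have MS: "subspace k M C" using MI by (simp add: trias_ideal_def)
  have M': "vectorspace k (C\<lparr>carrier := M\<rparr>)" by (rule subspace_vectorspace[OF C.vectorspace_axioms MS])
  obtain h where h: "h \<in> trias_hom k F C" "\<And>x. x \<in> carrier F \<Longrightarrow> \<omega> (h x) = \<pi> x"
    by (rule free_lift[OF F C L.triassociative_axioms hom \<omega>(1,2)], rule that)
  have hR: "h x \<in> M \<longleftrightarrow> x \<in> R" if "x \<in> carrier F" for x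
    using trias_homD(1)[OF h(1) that] h(2)[OF that] that
    by (simp add: \<omega>(3)[symmetric] a_kernel_def kernel_def)
  have h0: "h b = \<zero>\<^bsub>C\<^esub>" if "b \<in> bracket k F R" for b
  proof (rule hom_bracket_zero[OF F.triassociative_axioms C h(1) _ that])
    show "s \<in> carrier F \<and> h s \<in> center C" if "s \<in> R" for s
      using that hR[of s] Mc F.ideal_carrier[OF R_ideal] by blast
  qed
  have N: "h ` (R \<inter> derived k F) = M"
  proof
    show "h ` (R \<inter> derived k F) \<subseteq> M" using hR F.ideal_carrier[OF R_ideal] by blast
    show "M \<subseteq> h ` (R \<inter> derived k F)"
    proof
      fix m assume m: "m \<in> M"
      \<comment> \<open>The inclusion of \<open>M\<close> in the derived algebra provides preimages
        in \<open>F'\<close>; \<open>hR\<close> then places them in \<open>R\<close>.\<close>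
      then have "m \<in> h ` derived k F" using Mc lift_derived_surj[OF ext h] by blast
      then obtain d where d: "d \<in> derived k F" "m = h d" by blast
      then have "d \<in> R" using hR[of d] m subspaceD(1)[OF F.derived_subspace] by blast
      then show "m \<in> h ` (R \<inter> derived k F)" using d by blast
    qed
  qed
  obtain g where g: "g \<in> module_hom k (hopf k F R) (C\<lparr>carrier := M\<rparr>)" "g ` carrier (hopf k F R) = M"
    by (rule hopf_lift[OF C h(1) h0 MS N], assumption, rule that)
  obtain K :: "('k, 'f set) trias" and N f where def: "defining_pair k L K N"
    and f: "f \<in> vs_isos k (hopf k F R) (K\<lparr>carrier := N\<rparr>)"
    by (rule hopf_defining_pair, rule that)
  have K: "triassociative k K" and NI: "trias_ideal k K N"
    and exq: "\<exists>q \<in> trias_hom k K L. q ` carrier K = carrier L \<and> a_kernel K L q = N"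
    using def unfolding defining_pair_iff[OF L.triassociative_axioms] by auto
  from exq obtain q where q: "q \<in> trias_hom k K L" "q ` carrier K = carrier L" "a_kernel K L q = N"
    by blast
  interpret K: triassociative k K by (rule K)
  have NS: "subspace k N K" using NI by (simp add: trias_ideal_def)
  have N': "vectorspace k (K\<lparr>carrier := N\<rparr>)" by (rule subspace_vectorspace[OF K.vectorspace_axioms NS])
  have fdK: "vectorspace.fin_dim k K" and le: "vectorspace.dim k K \<le> vectorspace.dim k C"
    using cover_maximal[OF L.triassociative_axioms cov def] by auto
  \<comment> \<open>The inverse carries finite dimension from the kernel \<open>N\<close>, a
    subspace of the finite-dimensional \<open>K\<close>, to \<open>hopf k F R\<close>.\<close>
  obtain f' where f': "f' \<in> vs_isos k (K\<lparr>carrier := N\<rparr>) (hopf k F R)"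
    by (rule vs_isos_inverse[OF H(3) N' f], rule that)
  have fdN: "vectorspace.fin_dim k (K\<lparr>carrier := N\<rparr>)"
    by (rule subspace_fin_dim[OF K.vectorspace_axioms NS fdK])
  note fdH = vs_isos_fin_dim[OF N' H(3) f' fdN]
  \<comment> \<open>Both \<open>K\<close> and \<open>C\<close> map onto \<open>L\<close>, so
    comparing their dimensions amounts to comparing the kernels \<open>N\<close> and
    \<open>M\<close>.\<close>
  have "vectorspace.dim k L + vectorspace.dim k (K\<lparr>carrier := N\<rparr>) = vectorspace.dim k K"
    by (rule dim_kernel[OF K.vectorspace_axioms L.vectorspace_axioms _ q(2) fdK q(3)])
      (use q(1) in \<open>simp add: trias_hom_def\<close>)
  moreover have "vectorspace.dim k L + vectorspace.dim k (C\<lparr>carrier := M\<rparr>) = vectorspace.dim k C"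
    by (rule dim_kernel[OF C.vectorspace_axioms L.vectorspace_axioms _ \<omega>(2) fdC \<omega>(3)])
      (use \<omega>(1) in \<open>simp add: trias_hom_def\<close>)
  ultimately have "vectorspace.dim k (hopf k F R) \<le> vectorspace.dim k (C\<lparr>carrier := M\<rparr>)"
    using le fdH(2) by simp
  moreover have surj: "g ` carrier (hopf k F R) = carrier (C\<lparr>carrier := M\<rparr>)" using g(2) by simp
  ultimately have "inj_on g (carrier (hopf k F R))"
    by (intro surj_on_le_dim_imp_inj[OF H(3) M' g(1) _ fdH(1)])
  then have "g \<in> vs_isos k (hopf k F R) (C\<lparr>carrier := M\<rparr>)" by (rule vs_isosI[OF g(1) surj])
  then show thesis using fdH(1) by (rule that)
qed

end

section \<open>The exact sequence of multipliers, and condition (3)\<close>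

context trias_epi_central begin

text \<open>Presents \<open>L / Z\<close> by the same algebra \<open>F\<close>, so that
  \<open>hopf_cover_iso\<close> applies with \<open>T\<close> in place of \<open>R\<close>.\<close>

lemma quot_trias_epi:
  shows "trias_epi k F (trias_quot L Z) (\<lambda>x. Z +>\<^bsub>L\<^esub> \<pi> x)"
    and "a_kernel F (trias_quot L Z) (\<lambda>x. Z +>\<^bsub>L\<^esub> \<pi> x) = T"
proof -
  note Q = L.trias_quot_simps[OF Z_ideal]
  have ZS: "subspace k Z L" using Z_ideal by (simp add: trias_ideal_def)
  have "(\<lambda>x. Z +>\<^bsub>L\<^esub> x) \<in> trias_hom k L (trias_quot L Z)" by (rule trias_homI) (auto simp: Q(1,3-5))
  then have "(\<lambda>x. Z +>\<^bsub>L\<^esub> \<pi> x) \<in> trias_hom k F (trias_quot L Z)" by (rule trias_hom_comp[OF hom])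
  moreover have "(\<lambda>x. Z +>\<^bsub>L\<^esub> \<pi> x) ` carrier F = carrier (trias_quot L Z)"
    by (simp only: Q(1) surj[symmetric] image_image)
  ultimately show "trias_epi k F (trias_quot L Z) (\<lambda>x. Z +>\<^bsub>L\<^esub> \<pi> x)"
    by (intro trias_epi.intro trias_algebra.intro trias_epi_axioms.intro F.triassociative_axioms
        trias_quot_triassociative[OF L.triassociative_axioms Z_ideal])
  show "a_kernel F (trias_quot L Z) (\<lambda>x. Z +>\<^bsub>L\<^esub> \<pi> x) = T"
    using vs_quot_eq_zero[OF L.vectorspace_axioms ZS] trias_homD(1)[OF hom]
    by (auto simp: a_kernel_def kernel_def Q(2))
qed

lemma derived_Int_Z: "subspace k (derived k L \<inter> Z) L"
  using L.Int_derived_subspace[of Z] Z_ideal by (simp add: trias_ideal_def Int_commute)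

text \<open>Exactness at \<open>M(L/Z)\<close> holds because an element of
  \<open>T \<inter> F'\<close> that \<open>\<pi>\<close> sends to zero already lies in
  \<open>R \<inter> F'\<close>.\<close>

lemma nat_surj_props:
  defines "Y \<equiv> L\<lparr>carrier := derived k L \<inter> Z\<rparr>"
  shows nat_surj_hom: "nat_surj \<pi> \<in> module_hom k (hopf k F T) Y"
    and nat_surj_surj: "nat_surj \<pi> ` carrier (hopf k F T) = carrier Y"
    and beta_image: "beta k F T ` carrier (hopf k F R) = {A \<in> carrier (hopf k F T). nat_surj \<pi> A = \<zero>\<^bsub>Y\<^esub>}"
proof -
  note HR = F.hopf[OF R_ideal] and HT = F.hopf[OF T_ideal]
  let ?V = "F\<lparr>carrier := T \<inter> derived k F\<rparr>"
  have Y: "vectorspace k Y"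
    unfolding Y_def by (rule subspace_vectorspace[OF L.vectorspace_axioms derived_Int_Z])
  have pd: "\<pi> ` derived k F \<subseteq> derived k L"
    by (rule trias_hom_derived[OF F.triassociative_axioms L.triassociative_axioms hom])
  have \<pi>V: "\<pi> \<in> module_hom k ?V Y"
    using module_homD[OF linear] pd subspaceD(1)[OF F.derived_subspace]
    by (intro module_homI) (auto simp: Y_def)
  have \<pi>0: "\<pi> b = \<zero>\<^bsub>Y\<^esub>" if "b \<in> bracket k F T" for b
    using subsetD[OF bracket_T_subset_R that] R_iff by (simp add: Y_def)
  show nh: "nat_surj \<pi> \<in> module_hom k (hopf k F T) Y"
    unfolding nat_surj_def[abs_def] hopf_def by (rule quot_lift(1)[OF HT(1) Y HT(2) \<pi>V \<pi>0])
  have app: "nat_surj \<pi> (bracket k F T +>\<^bsub>F\<^esub> x) = \<pi> x" if "x \<in> T \<inter> derived k F" for x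
    by (simp only: nat_surj_def F.hopf_image[OF T_ideal Y \<pi>V \<pi>0 that] the_elem_eq)
  \<comment> \<open>The identity of \<open>L\<close> is a central extension with zero kernel and
    \<open>\<pi>\<close> lifts along it, which gives surjectivity of \<open>\<pi>\<close> from
    \<open>F'\<close> onto \<open>L'\<close>.\<close>
  have "id \<in> trias_hom k L L" by (rule trias_homI) auto
  then have ext: "central_extension k L id L"
    by (auto simp: central_extension_def L.triassociative_axioms a_kernel_def kernel_def center_def L.tprod_zero)
  have dl: "derived k L \<subseteq> \<pi> ` derived k F"
    by (rule lift_derived_surj[OF ext hom]) simp
  have "nat_surj \<pi> ` carrier (hopf k F T) = \<pi> ` (T \<inter> derived k F)"
    unfolding HT(4) image_image by (rule image_cong[OF refl app])
  also have "\<dots> = carrier Y"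
    using dl pd subspaceD(1)[OF F.derived_subspace] by (auto simp: Y_def)
  finally show "nat_surj \<pi> ` carrier (hopf k F T) = carrier Y" .
  have 1: "beta k F T ` carrier (hopf k F R) = (\<lambda>x. bracket k F T +>\<^bsub>F\<^esub> x) ` (R \<inter> derived k F)"
    unfolding HR(4) image_image by (rule image_cong[OF refl beta_apply])
  show "beta k F T ` carrier (hopf k F R) = {A \<in> carrier (hopf k F T). nat_surj \<pi> A = \<zero>\<^bsub>Y\<^esub>}"
    unfolding 1
  proof (intro equalityI subsetI)
    fix A assume "A \<in> (\<lambda>x. bracket k F T +>\<^bsub>F\<^esub> x) ` (R \<inter> derived k F)"
    then obtain x where x: "x \<in> R" "x \<in> derived k F" "A = bracket k F T +>\<^bsub>F\<^esub> x" by blast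
    have "x \<in> T \<inter> derived k F" using x R_subset_T by blast
    moreover from this have "nat_surj \<pi> A = \<zero>\<^bsub>L\<^esub>" using app x R_iff by simp
    ultimately show "A \<in> {A \<in> carrier (hopf k F T). nat_surj \<pi> A = \<zero>\<^bsub>Y\<^esub>}"
      using x(3) by (auto simp: HT(4) Y_def)
  next
    fix A assume A: "A \<in> {A \<in> carrier (hopf k F T). nat_surj \<pi> A = \<zero>\<^bsub>Y\<^esub>}"
    then obtain x where x: "x \<in> T \<inter> derived k F" "A = bracket k F T +>\<^bsub>F\<^esub> x" by (auto simp: HT(4))
    have "\<pi> x = \<zero>\<^bsub>L\<^esub>" using A app[OF x(1)] x(2) by (simp add: Y_def)
    then have "x \<in> R \<inter> derived k F" using x(1) R_iff by simp
    then show "A \<in> (\<lambda>x. bracket k F T +>\<^bsub>F\<^esub> x) ` (R \<inter> derived k F)" using x(2) by blast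
  qed
qed

lemma inj_beta_iff_quotient:
  fixes C :: "('k, 'b) trias" and C1 :: "('k, 'd) trias"
  assumes F: "free_on k F X" and cov: "cover k L C M" "cover k (trias_quot L Z) C1 M1"
  shows "inj_on (beta k F T) (carrier (hopf k F R)) \<longleftrightarrow>
    (\<exists>\<theta> \<in> vs_isos k (hopf k F T) (C1\<lparr>carrier := M1\<rparr>).
      \<exists>s \<in> module_hom k (L\<lparr>carrier := derived k L \<inter> Z\<rparr>) (hopf k F T).
        (\<forall>y \<in> derived k L \<inter> Z. nat_surj \<pi> (s y) = y) \<and>
        vs_isos k (C\<lparr>carrier := M\<rparr>)
          (vs_quot (C1\<lparr>carrier := M1\<rparr>) (\<theta> ` s ` (derived k L \<inter> Z))) \<noteq> {})"
    (is "?inj \<longleftrightarrow> ?P3")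
proof -
  let ?Y = "L\<lparr>carrier := derived k L \<inter> Z\<rparr>" and ?HR = "hopf k F R" and ?HT = "hopf k F T"
    and ?M = "C\<lparr>carrier := M\<rparr>" and ?M1 = "C1\<lparr>carrier := M1\<rparr>"
  interpret Q: trias_epi k F "trias_quot L Z" "\<lambda>x. Z +>\<^bsub>L\<^esub> \<pi> x" by (rule quot_trias_epi(1))
  have QR: "Q.R = T" by (rule quot_trias_epi(2))
  have HR: "vectorspace k ?HR" and HT: "vectorspace k ?HT"
    by (rule F.hopf(3)[OF R_ideal], rule F.hopf(3)[OF T_ideal])
  have Y: "vectorspace k ?Y" by (rule subspace_vectorspace[OF L.vectorspace_axioms derived_Int_Z])
  have MV: "vectorspace k (D\<lparr>carrier := N\<rparr>)" if "defining_pair k A D N"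
    for A :: "('k, 'x) trias" and D :: "('k, 'y) trias" and N
    by (rule subspace_vectorspace) (use that in \<open>auto simp: defining_pair_def trias_ideal_def triassociative_def\<close>)
  have M: "vectorspace k ?M" and M1: "vectorspace k ?M1"
    using MV cov unfolding cover_def by blast+
  obtain \<rho> where \<rho>: "\<rho> \<in> vs_isos k ?HR ?M" and fd: "vectorspace.fin_dim k ?HR"
    by (rule hopf_cover_iso[OF F cov(1)], rule that)
  obtain \<rho>' where \<rho>': "\<rho>' \<in> vs_isos k ?M ?HR" by (rule vs_isos_inverse[OF HR M \<rho>], rule that)
  obtain \<tau> where \<tau>: "\<tau> \<in> vs_isos k ?HT ?M1"
    by (rule Q.hopf_cover_iso[OF F cov(2), unfolded QR], rule that)
  show ?thesis
  proof
    assume inj: ?inj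
    obtain s where s: "s \<in> module_hom k ?Y ?HT" "\<And>y. y \<in> carrier ?Y \<Longrightarrow> nat_surj \<pi> (s y) = y"
      by (rule linear_section[OF HT Y nat_surj_hom nat_surj_surj], rule that)
    have s': "\<forall>y \<in> carrier ?Y. nat_surj \<pi> (s y) = y" using s(2) by blast
    note c = complementary_quotient[OF HR HT Y M1 beta_hom nat_surj_hom beta_image s(1) s' \<tau>]
    let ?N = "\<tau> ` s ` carrier ?Y"
    have "(\<lambda>x. ?N +>\<^bsub>?M1\<^esub> \<tau> (beta k F T x)) \<in> vs_isos k ?HR (vs_quot ?M1 ?N)"
      using c(2-4) inj by (intro vs_isosI) simp_all
    then have "(\<lambda>x. ?N +>\<^bsub>?M1\<^esub> \<tau> (beta k F T (\<rho>' x))) \<in> vs_isos k ?M (vs_quot ?M1 ?N)"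
      by (rule vs_isos_comp[OF \<rho>'])
    then show ?P3 using \<tau> s by (intro bexI[of _ \<tau>] bexI[of _ s]) auto
  next
    assume ?P3
    then obtain \<theta> s \<psi> where \<theta>: "\<theta> \<in> vs_isos k ?HT ?M1" and s: "s \<in> module_hom k ?Y ?HT"
        "\<forall>y \<in> carrier ?Y. nat_surj \<pi> (s y) = y"
      and \<psi>: "\<psi> \<in> vs_isos k ?M (vs_quot ?M1 (\<theta> ` s ` carrier ?Y))"
      by auto
    note c = complementary_quotient[OF HR HT Y M1 beta_hom nat_surj_hom beta_image s \<theta>]
    let ?N = "\<theta> ` s ` carrier ?Y" and ?f = "\<lambda>x. (\<theta> ` s ` carrier ?Y) +>\<^bsub>?M1\<^esub> \<theta> (beta k F T x)"
    have Q: "vectorspace k (vs_quot ?M1 ?N)" by (rule vs_quot(1)[OF M1 c(1)])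
    obtain \<psi>' where \<psi>': "\<psi>' \<in> vs_isos k (vs_quot ?M1 ?N) ?M"
      by (rule vs_isos_inverse[OF M Q \<psi>], rule that)
    note i = vs_isos_comp[OF \<psi>' \<rho>']
    \<comment> \<open>The given isomorphism closes the surjection onto the quotient into a
      surjective endomorphism of the finite-dimensional space \<open>hopf k F R\<close>, which must
      be injective.\<close>
    let ?e = "\<lambda>x. \<rho>' (\<psi>' (?f x))"
    have e: "?e \<in> module_hom k ?HR ?HR" by (rule module_hom_comp[OF c(2) vs_isosD(1)[OF i]])
    have "?e ` carrier ?HR = (\<lambda>x. \<rho>' (\<psi>' x)) ` ?f ` carrier ?HR" by (simp only: image_image)
    also have "\<dots> = carrier ?HR" unfolding c(3) by (rule vs_isosD(2)[OF i])
    finally have "inj_on ?e (carrier ?HR)"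
      by (intro surj_on_le_dim_imp_inj[OF HR HR e _ fd]) simp_all
    then have "inj_on ?f (carrier ?HR)" by (auto simp: inj_on_def)
    then show ?inj using c(4) by simp
  qed
qed

end

theorem theorem5p5:
  fixes k :: "('k, 'c) ring_scheme"
    and L :: "('k, 'a) trias" and Z :: "'a set"
    and F :: "('k, 'f) trias" and \<pi> :: "'f \<Rightarrow> 'a" and R T :: "'f set"
    and C :: "('k, 'b) trias" and M :: "'b set"
    and C1 :: "('k, 'd) trias" and M1 :: "'d set"
  assumes "field k"
    and "triassociative k L" and "vectorspace.fin_dim k L"
    and "central_ideal k L Z"
    and "free_presentation k F \<pi> L"
    and "R = a_kernel F L \<pi>" and "T = {x \<in> carrier F. \<pi> x \<in> Z}"
    and "cover k L C M" and "cover k (trias_quot L Z) C1 M1"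
  shows "let
      P1 = (\<forall>c \<in> carrier (H2 k L). delta k L Z c = \<zero>\<^bsub>delta_target k L Z\<^esub>);
      P2 = inj_on (beta k F T) (carrier (hopf k F R));
      P3 = (\<exists>\<theta> \<in> vs_isos k (hopf k F T) (C1\<lparr>carrier := M1\<rparr>).
        \<exists>s \<in> module_hom k (L\<lparr>carrier := derived k L \<inter> Z\<rparr>) (hopf k F T).
          (\<forall>y \<in> derived k L \<inter> Z. nat_surj \<pi> (s y) = y) \<and>
          vs_isos k (C\<lparr>carrier := M\<rparr>)
            (vs_quot (C1\<lparr>carrier := M1\<rparr>) (\<theta> ` s ` (derived k L \<inter> Z))) \<noteq> {});
      P4 = (Z \<subseteq> Zstar k L)
    in (P1 \<longleftrightarrow> P2) \<and> (P2 \<longleftrightarrow> P3) \<and> (P3 \<longleftrightarrow> P4)"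
proof -
  obtain X where X: "free_on k F X" and \<pi>: "\<pi> \<in> trias_hom k F L" "\<pi> ` carrier F = carrier L"
    using assms(5) by (auto simp: free_presentation_def)
  have "triassociative k F" using X by (simp add: free_on_def)
  then interpret E: trias_epi_central k F L \<pi> Z
    using \<pi> assms(2,4)
    by (intro trias_epi_central.intro trias_epi.intro trias_algebra.intro trias_epi_axioms.intro
        trias_epi_central_axioms.intro)
  show ?thesis
    \<comment> \<open>Condition (3) is first folded into injectivity of \<open>beta\<close>; then
      all four conditions become the same inclusion of brackets.\<close>
    unfolding Let_def assms(6,7) E.delta_zero_iff_bracket[OF X] E.Zstar_iff[OF X]
      E.inj_beta_iff_quotient[OF X assms(8,9), symmetric] E.inj_beta_iff
    by simp
qed

end
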